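(* Let $p\ge1$, and let $m_2,\ldots,m_{p-1},r\ge0$ and $m_1,m_p\ge1$ be integers. Put $|\mathbf m|=m_1+\cdots+m_p$ and $H_n=\sum_{k=1}^n 1/k$. For $\sigma=(\sigma_1,\ldots,\sigma_{p+r})\in\{\pm1\}^{p+r}$ write $s(\sigma)$ for the argument list $\bigl(\sigma_{p+r},\,\sigma_{p+r}\sigma_{p+r-1},\,\sigma_{p+r-1}\sigma_{p+r-2},\ldots,\sigma_2\sigma_1\bigr)$ of length $p+r$. Then $$\begin{aligned}&\sum_{j=1}^p(-1)^{j-1}\zeta(m_p+1,m_{p-1}+1,\ldots,m_{j+1}+1)\sum_{n=1}^\infty\frac{\zeta_n^\star(\mathbf m_j^\vee)H_n}{n^{r+1}4^n}\binom{2n}{n}\\ &=\sum_{j=1}^r(-1)^{r-j}\zeta(m_p+1,\ldots,m_1+1,\{1\}_{r-j})\,\zeta_B^\star(j,1)\\ &\quad+(-1)^r2^{|\mathbf m|+1}\sum_{\substack{i_1+\cdots+i_r+j_1+\cdots+j_p=1\\ i_1,\ldots,i_r,j_1,\ldots,j_p\ge0}}\ \prod_{l=1}^p\binom{m_l+j_l}{j_l}\sum_{\sigma\in\{\pm1\}^{p+r}}\sigma_1\,\mathrm{Li}_{m_p+j_p+1,\ldots,m_1+j_1+1,\,i_r+1,\ldots,i_1+1}\bigl(s(\sigma)\bigr)\\ &\quad-(-1)^r2^{|\mathbf m|+1}\log(2)\sum_{\sigma\in\{\pm1\}^{p+r}}\sigma_1\,\mathrm{Li}_{m_p+1,\ldots,m_1+1,\{1\}_r}\bigl(s(\sigma)\bigr)\\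 &\quad-(-1)^r2^{|\mathbf m|+1}\sum_{\sigma\in\{\pm1\}^{p+r}}\sigma_1\,\mathrm{Li}_{m_p+1,\ldots,m_1+1,\{1\}_{r+1}}\bigl(s(\sigma),-\sigma_1\bigr).\end{aligned}$$
   Context: $\zeta(k_1,\ldots,k_r)=\sum_{n_1>\cdots>n_r\ge1}\prod n_j^{-k_j}$ ($k_1\ge2$), with $\zeta(\emptyset)=1$ (this occurs for $j=p$ on the left). $\zeta_n^\star(k_1,\ldots,k_r)=\sum_{n\ge n_1\ge\cdots\ge n_r\ge1}\prod n_j^{-k_j}$, $\zeta_n^\star(\emptyset)=1$. The Apéry-type multiple zeta $B$-star value is $$\zeta_B^\star(k_1,\ldots,k_r)=\sum_{n=1}^\infty\frac{\zeta_n^\star(k_2,\ldots,k_r)}{n^{k_1}4^n}\binom{2n}{n}.$$ Multivariable polylogarithm: $\mathrm{Li}_{a_1,\ldots,a_q}(x_1,\ldots,x_q)=\sum_{n_1>\cdots>n_q\ge1}\frac{x_1^{n_1}\cdots x_q^{n_q}}{n_1^{a_1}\cdots n_q^{a_q}}$. If $p+r=1$ the list $s(\sigma)$ is just $(\sigma_1)$. $\{1\}_d$ is $1$ repeated $d$ times. Put $\mathbf m_j=(m_1,m_2+1,\ldots,m_j+1)$, $\mathbf m_1=(m_1)$. The Hoffman dual of an index (finite sequence of positive integers) $\mathbf a=(a_1,\ldots,a_q)$ is the index $\mathbf a^\vee=(a'_1,\ldots,a'_{q'})$ of the same weight $|\mathbf a|=a_1+\cdots+a_q$ such that $\{1,\ldots,|\mathbf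 a|-1\}$ is the disjoint union of $\{a_1,a_1+a_2,\ldots,a_1+\cdots+a_{q-1}\}$ and $\{a'_1,a'_1+a'_2,\ldots,a'_1+\cdots+a'_{q'-1}\}$. *)

theory Defs
  imports "HOL-Analysis.Analysis"
begin

text \<open>
  Nested sums are written over tuples of summation indices \<open>[n\<^sub>1, \<dots>, n\<^sub>q]\<close>; the only tuple of
  length 0 is the empty list, so that nested sums of depth 0 have the value 1.
\<close>

definition desc_tuples :: "nat \<Rightarrow> nat \<Rightarrow> nat list set" where
  "desc_tuples q N = {ns. length ns = q \<and> set ns \<subseteq> {1..N} \<and> sorted_wrt (>) ns}"

definition weak_desc_tuples :: "nat \<Rightarrow> nat \<Rightarrow> nat list set" where
  "weak_desc_tuples q N = {ns. length ns = q \<and> set ns \<subseteq> {1..N} \<and> sorted_wrt (\<ge>) ns}"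

text \<open>
  Infinite nested sums over \<open>n\<^sub>1 > \<dots> > n\<^sub>q \<ge> 1\<close> are limits of the partial sums with \<open>n\<^sub>1 \<le> N\<close>.
\<close>

definition mzv :: "nat list \<Rightarrow> real" where
  "mzv ks = lim (\<lambda>N. \<Sum>ns\<in>desc_tuples (length ks) N. \<Prod>j<length ks. 1 / real (ns ! j) ^ (ks ! j))"

definition mpolylog :: "nat list \<Rightarrow> 'a::real_normed_field list \<Rightarrow> 'a" where
  "mpolylog as xs =
     lim (\<lambda>N. \<Sum>ns\<in>desc_tuples (length as) N.
                \<Prod>j<length as. (xs ! j) ^ (ns ! j) / of_nat (ns ! j) ^ (as ! j))"

definition zeta_star :: "nat \<Rightarrow> nat list \<Rightarrow> real" where
  "zeta_star n ks =
     (\<Sum>ns\<in>weak_desc_tuples (length ks) n. \<Prod>j<length ks. 1 / real (ns ! j) ^ (ks ! j))"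

text \<open>Series over \<open>n \<ge> 1\<close> are written with \<open>Suc n\<close> in place of \<open>n\<close>.\<close>

fun zeta_B_star :: "nat list \<Rightarrow> real" where
  "zeta_B_star (k # ks) =
     (\<Sum>n. zeta_star (Suc n) ks / (real (Suc n) ^ k * 4 ^ Suc n) * real ((2 * Suc n) choose Suc n))"

definition is_index :: "nat list \<Rightarrow> bool" where
  "is_index as \<longleftrightarrow> (\<forall>a\<in>set as. 0 < a)"

definition proper_psums :: "nat list \<Rightarrow> nat set" where
  "proper_psums as = {sum_list (take k as) | k. 1 \<le> k \<and> k < length as}"

definition is_hoffman_dual :: "nat list \<Rightarrow> nat list \<Rightarrow> bool" where
  "is_hoffman_dual as bs \<longleftrightarrow>
     is_index bs \<and> sum_list bs = sum_list as \<and>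
     proper_psums as \<inter> proper_psums bs = {} \<and>
     proper_psums as \<union> proper_psums bs = {1..<sum_list as}"

definition hoffman_dual :: "nat list \<Rightarrow> nat list" where
  "hoffman_dual as = (THE bs. is_hoffman_dual as bs)"

lemma proper_psums_snoc:
  assumes "as \<noteq> []"
  shows "proper_psums (as @ [x]) = insert (sum_list as) (proper_psums as)"
proof -
  have "{k. 1 \<le> k \<and> k < length (as @ [x])} = insert (length as) {k. 1 \<le> k \<and> k < length as}"
    using assms by (auto simp: Suc_le_eq)
  moreover have "proper_psums bs = (\<lambda>k. sum_list (take k bs)) ` {k. 1 \<le> k \<and> k < length bs}" for bs
    by (auto simp: proper_psums_def)
  ultimately show ?thesis
    by (auto intro!: image_cong)
qed

lemma proper_psums_short: "length as \<le> 1 \<Longrightarrow> proper_psums as = {}"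
  by (auto simp: proper_psums_def)

lemma proper_psums_subset:
  assumes "is_index as"
  shows "proper_psums as \<subseteq> {1..<sum_list as}"
  using assms
proof (induction as rule: rev_induct)
  case Nil
  then show ?case by (simp add: proper_psums_short)
next
  case (snoc x as)
  then have "0 < x" "is_index as" by (auto simp: is_index_def)
  moreover have "0 < sum_list as" if "as \<noteq> []"
    using \<open>is_index as\<close> that by (cases as) (auto simp: is_index_def)
  ultimately show ?case
    using snoc.IH by (cases "as = []") (auto simp: proper_psums_short proper_psums_snoc)
qed

lemma index_exists:
  assumes "S \<subseteq> {1..<w}"
  shows "\<exists>as. is_index as \<and> sum_list as = w \<and> proper_psums as = S"
  using assms
proof (induction w arbitrary: S rule: less_induct)
  case (less w)
  show ?case
  proof (cases "S = {}")
    case True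
    show ?thesis
    proof (cases "w = 0")
      case True
      then show ?thesis using \<open>S = {}\<close>
        by (intro exI[of _ "[]"]) (auto simp: is_index_def proper_psums_short)
    next
      case False
      then show ?thesis using \<open>S = {}\<close>
        by (intro exI[of _ "[w]"]) (auto simp: is_index_def proper_psums_short)
    qed
  next
    case False
    have fin: "finite S" using less.prems finite_subset by blast
    define v where "v = Max S"
    have v: "v \<in> S" using False fin by (simp add: v_def)
    then have vw: "1 \<le> v" "v < w" using less.prems by auto
    have "S - {v} \<subseteq> {1..<v}"
    proof
      fix u assume u: "u \<in> S - {v}"
      then have "u \<le> v" using fin by (simp add: v_def)
      then show "u \<in> {1..<v}" using u less.prems by force
    qed
    from less.IH[OF vw(2) this] obtain bs
      where bs: "is_index bs" "sum_list bs = v" "proper_psums bs = S - {v}" by blast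
    from bs(2) vw(1) have "bs \<noteq> []" by auto
    then have "proper_psums (bs @ [w - v]) = S"
      using bs(3) v by (simp add: proper_psums_snoc bs(2) insert_absorb)
    moreover have "sum_list (bs @ [w - v]) = w"
      using bs(2) vw(2) by simp
    moreover have "is_index (bs @ [w - v])"
      using bs(1) vw(2) by (simp add: is_index_def)
    ultimately show ?thesis by blast
  qed
qed

lemma index_unique:
  assumes "is_index as" "is_index bs" "sum_list as = sum_list bs"
    "proper_psums as = proper_psums bs"
  shows "as = bs"
  using assms
proof (induction as arbitrary: bs rule: rev_induct)
  case Nil
  then show ?case by (cases bs) (auto simp: is_index_def)
next
  case (snoc x as)
  have x: "0 < x" "is_index as" using snoc.prems(1) by (auto simp: is_index_def)
  have "bs \<noteq> []" using snoc.prems(3) x by auto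
  then obtain cs y where bs: "bs = cs @ [y]" by (metis rev_exhaust)
  have y: "0 < y" "is_index cs" using snoc.prems(2) by (auto simp: is_index_def bs)
  note sub = proper_psums_subset[OF x(2)] proper_psums_subset[OF y(2)]
  show ?case
  proof (cases "as = [] \<or> cs = []")
    case True
    have ne: "proper_psums (zs @ [z]) \<noteq> {}" if "zs \<noteq> []" for zs z
      using that by (simp add: proper_psums_snoc)
    have emp: "proper_psums ([] @ [z]) = {}" for z
      by (simp add: proper_psums_short)
    have eq: "proper_psums (as @ [x]) = proper_psums (cs @ [y])"
      using snoc.prems(4) by (simp add: bs)
    have "as = [] \<and> cs = []"
      using True
    proof
      assume "as = []"
      then show ?thesis using eq emp ne by blast
    next
      assume "cs = []"
      then show ?thesis using eq emp ne by blast
    qed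
    then show ?thesis using snoc.prems(3) by (simp add: bs)
  next
    case False
    then have eq: "insert (sum_list as) (proper_psums as) = insert (sum_list cs) (proper_psums cs)"
      using snoc.prems(4) by (simp add: bs proper_psums_snoc)
    have s: "sum_list as = sum_list cs"
    proof (rule ccontr)
      assume "sum_list as \<noteq> sum_list cs"
      then have "sum_list as \<in> proper_psums cs" "sum_list cs \<in> proper_psums as"
        using eq by (metis insertE insertI1)+
      then show False using sub by fastforce
    qed
    moreover have "proper_psums as = proper_psums cs"
    proof -
      have "sum_list as \<notin> proper_psums as" "sum_list cs \<notin> proper_psums cs"
        using sub by auto
      then show ?thesis using eq s by (metis insert_ident)
    qed
    ultimately have "as = cs" using snoc.IH x y by blast
    then show ?thesis using snoc.prems(3) by (simp add: bs)
  qed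
qed

lemma hoffman_dual_ex1:
  assumes "is_index as"
  shows "\<exists>!bs. is_hoffman_dual as bs"
proof -
  from index_exists[of "{1..<sum_list as} - proper_psums as" "sum_list as"]
  obtain bs where bs: "is_index bs" "sum_list bs = sum_list as"
    "proper_psums bs = {1..<sum_list as} - proper_psums as" by blast
  show ?thesis
  proof (rule ex1I)
    show "is_hoffman_dual as bs"
      using bs proper_psums_subset[OF assms] by (auto simp: is_hoffman_dual_def)
    fix cs assume cs: "is_hoffman_dual as cs"
    then have "proper_psums cs = {1..<sum_list as} - proper_psums as"
      by (auto simp: is_hoffman_dual_def)
    then show "cs = bs" using cs bs by (intro index_unique) (auto simp: is_hoffman_dual_def)
  qed
qed

text \<open>\<open>(m\<^sub>1, m\<^sub>2 + 1, \<dots>, m\<^sub>j + 1)\<close>, for \<open>j \<ge> 1\<close>.\<close>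

definition m_index :: "(nat \<Rightarrow> nat) \<Rightarrow> nat \<Rightarrow> nat list" where
  "m_index m j = m 1 # map (\<lambda>i. m i + 1) [2..<j + 1]"

text \<open>\<open>(f b, f (b - 1), \<dots>, f a)\<close>, empty if \<open>b < a\<close>.\<close>

definition down_list :: "(nat \<Rightarrow> 'a) \<Rightarrow> nat \<Rightarrow> nat \<Rightarrow> 'a list" where
  "down_list f b a = map f (rev [a..<b + 1])"

definition signs :: "nat \<Rightarrow> (nat \<Rightarrow> real) set" where
  "signs d = {1..d} \<rightarrow>\<^sub>E {1, -1}"

text \<open>\<open>(\<sigma>\<^sub>d, \<sigma>\<^sub>d\<sigma>\<^sub>d\<^sub>-\<^sub>1, \<dots>, \<sigma>\<^sub>2\<sigma>\<^sub>1)\<close>, for \<open>d \<ge> 1\<close>.\<close>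

definition sign_args :: "nat \<Rightarrow> (nat \<Rightarrow> real) \<Rightarrow> real list" where
  "sign_args d \<sigma> = \<sigma> d # down_list (\<lambda>k. \<sigma> (k + 1) * \<sigma> k) (d - 1) 1"

text \<open>
  Pairs of tuples \<open>(i\<^sub>1, \<dots>, i\<^sub>r)\<close>, \<open>(j\<^sub>1, \<dots>, j\<^sub>p)\<close> of natural numbers with total sum 1. The
  extensionality of \<open>\<rightarrow>\<^sub>E\<close> makes every such pair of tuples occur exactly once.
\<close>

definition unit_tuples :: "nat \<Rightarrow> nat \<Rightarrow> ((nat \<Rightarrow> nat) \<times> (nat \<Rightarrow> nat)) set" where
  "unit_tuples r p = {(is, js). is \<in> {1..r} \<rightarrow>\<^sub>E UNIV \<and> js \<in> {1..p} \<rightarrow>\<^sub>E UNIV \<and>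
                        (\<Sum>l=1..r. is l) + (\<Sum>l=1..p. js l) = 1}"

end

theory Submission
  imports Defs "HOL-Real_Asymp.Real_Asymp"
begin

text \<open>
  Put \<open>f(z) = \<Sum>\<^bsub>0 < n\<^sub>1 < \<dots> < n\<^sub>q\<^esub> \<Prod>\<^sub>i (n\<^sub>i + z)\<^bsup>-k\<^sub>i\<^esup>\<close>, with \<open>k = ({1}\<^sub>r, m\<^sub>1 + 1, \<dots>, m\<^sub>p + 1)\<close>, and let \<open>b(n)\<close>
  be the \<open>n\<close>-th difference \<open>\<Sum>\<^sub>i (-1)\<^sup>i (n choose i) f(i)\<close>. Peeling off \<open>n\<^sub>1\<close> shows that passing from
  the shorter index to \<open>k\<close> iterates averages \<open>u \<mapsto> (1/n) \<Sum>\<^bsub>j \<le> n\<^esub> u(j)\<close> on \<open>b\<close>, and Hoffman duality is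
  exactly the rule by which such averages build star sums. Hence the left-hand side is
  \<open>\<Sum>\<^sub>n c\<^sub>n H\<^sub>n b(n)\<close> with \<open>c\<^sub>n = (2n choose n) / 4\<^sup>n\<close>, up to the sign \<open>(-1)\<^sup>r\<close> and the terms with \<open>\<zeta>\<^sub>B\<^sup>\<star>(j, 1)\<close>.
  On the other hand \<open>f(z) = \<integral>\<^sub>0\<^sup>1 x\<^sup>z w(x) dx\<close> for some \<open>w \<ge> 0\<close>, so that \<open>b(n) = \<integral>\<^sub>0\<^sup>1 (1 - x)\<^sup>n w(x) dx\<close>, and
  \<open>\<Sum>\<^sub>n c\<^sub>n H\<^sub>n (1 - x)\<^sup>n = 2x\<^bsup>-1/2\<^esup> ln ((1 + x\<^bsup>1/2\<^esup>) / (2x\<^bsup>1/2\<^esup>))\<close>. Expanding the logarithms in powers of \<open>x\<close> and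
  integrating against \<open>w\<close> gives
  \<open>\<Sum>\<^sub>n c\<^sub>n H\<^sub>n b(n) = -f'(-1/2) - 2 ln 2 f(-1/2) - \<Sum>\<^bsub>k \<ge> 1\<^esub> f(k - 1/2) / k + \<Sum>\<^bsub>k \<ge> 0\<^esub> f(k) / (k + 1/2)\<close>.
  The sums over signs are these terms, because they select summation indices of prescribed parity.
\<close>

section \<open>Nested sums\<close>

text \<open>The integrated identity is kept with nonnegative terms on both sides and proved in
  \<open>ennreal\<close>, where sums and integrals may be exchanged freely. The price is that
  nothing may be subtracted before it is known to be finite. The values at -1/2 are finite by
  comparison with those at 0; the series in c_n H_n b(n) by logarithmic bounds on iterated averages;
  the two series with weights 1/k and 1/(k + 1/2) because, up to a factor, they are the limits of
  parity-restricted nested sums of depth one more, which converge absolutely.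

  The argument -1/2 arises twice: from the generating function (1 - y) to the power -1/2 of the c_n,
  at y = 1 - x, and from odd summation indices 2n - 1 = 2(n - 1/2).

  The constant in front of the sign sums balances two powers of 2: summing over p + r signs gives 2
  to the power p + r, and halving the indices gives 2 to minus the weight. The index in the term
  with log 2 has weight |m| + p + r, the other two have one more; so a factor 2 survives in front of
  log 2 only.\<close>

fun nested_sum :: "(nat \<Rightarrow> real) list \<Rightarrow> nat \<Rightarrow> nat \<Rightarrow> real" where
  "nested_sum [] M N = 1"
| "nested_sum (g # gs) M N = (\<Sum>n\<in>{M<..N}. g n * nested_sum gs M (n - 1))"

lemma desc_tuples_0: "desc_tuples 0 N = {[]}"
  by (auto simp: desc_tuples_def)

lemma desc_tuples_Suc:
  "desc_tuples (Suc q) N = (\<lambda>(n, ns). n # ns) ` (SIGMA n:{0<..N}. desc_tuples q (n - 1))"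
proof (intro equalityI subsetI)
  fix xs assume xs: "xs \<in> desc_tuples (Suc q) N"
  then obtain n ns where [simp]: "xs = n # ns" by (cases xs) (auto simp: desc_tuples_def)
  have "n \<in> {0<..N}" "ns \<in> desc_tuples q (n - 1)"
    using xs by (fastforce simp: desc_tuples_def)+
  then show "xs \<in> (\<lambda>(n, ns). n # ns) ` (SIGMA n:{0<..N}. desc_tuples q (n - 1))" by force
qed (fastforce simp: desc_tuples_def)

lemma finite_desc_tuples [simp]: "finite (desc_tuples q N)"
  by (induction q arbitrary: N) (auto simp: desc_tuples_0 desc_tuples_Suc)

lemma weak_desc_tuples_0: "weak_desc_tuples 0 N = {[]}"
  by (auto simp: weak_desc_tuples_def)

lemma weak_desc_tuples_Suc:
  "weak_desc_tuples (Suc q) N = (\<lambda>(n, ns). n # ns) ` (SIGMA n:{0<..N}. weak_desc_tuples q n)"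
proof (intro equalityI subsetI)
  fix xs assume xs: "xs \<in> weak_desc_tuples (Suc q) N"
  then obtain n ns where [simp]: "xs = n # ns" by (cases xs) (auto simp: weak_desc_tuples_def)
  have "n \<in> {0<..N}" "ns \<in> weak_desc_tuples q n"
    using xs by (fastforce simp: weak_desc_tuples_def)+
  then show "xs \<in> (\<lambda>(n, ns). n # ns) ` (SIGMA n:{0<..N}. weak_desc_tuples q n)" by force
qed (fastforce simp: weak_desc_tuples_def)

lemma finite_weak_desc_tuples [simp]: "finite (weak_desc_tuples q N)"
  by (induction q arbitrary: N) (auto simp: weak_desc_tuples_0 weak_desc_tuples_Suc)

lemma sum_desc_tuples_Suc:
  "sum f (desc_tuples (Suc q) N) = (\<Sum>n\<in>{0<..N}. \<Sum>ns\<in>desc_tuples q (n - 1). f (n # ns))"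
  by (subst sum.Sigma) (auto simp: desc_tuples_Suc sum.reindex inj_on_def case_prod_beta)

lemma sum_weak_desc_tuples_Suc:
  "sum f (weak_desc_tuples (Suc q) N) = (\<Sum>n\<in>{0<..N}. \<Sum>ns\<in>weak_desc_tuples q n. f (n # ns))"
  by (subst sum.Sigma) (auto simp: weak_desc_tuples_Suc sum.reindex inj_on_def case_prod_beta)

lemma sum_desc_tuples:
  "(\<Sum>ns\<in>desc_tuples (length gs) N. \<Prod>j<length gs. (gs ! j) (ns ! j)) = nested_sum gs 0 N"
proof (induction gs arbitrary: N)
  case Nil
  then show ?case by (simp add: desc_tuples_0)
next
  case (Cons g gs)
  then show ?case
    by (simp add: sum_desc_tuples_Suc prod.lessThan_Suc_shift sum_distrib_left[symmetric]
        del: prod.lessThan_Suc)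
qed

lemma zeta_star_Nil: "zeta_star n [] = 1"
  by (simp add: zeta_star_def weak_desc_tuples_0)

lemma zeta_star_Cons:
  "zeta_star N (k # ks) = (\<Sum>n\<in>{0<..N}. zeta_star n ks / real n ^ k)"
  by (simp add: zeta_star_def sum_weak_desc_tuples_Suc prod.lessThan_Suc_shift
      sum_divide_distrib del: prod.lessThan_Suc)

text \<open>The recursion of \<open>nested_sum\<close> splits off the largest index; exchanging the
  order of summation splits off the smallest one, and the remaining indices are then bounded below
  by it. The lower bound \<open>M\<close> is a parameter for the sake of this step.\<close>

lemma nested_sum_snoc: "nested_sum (gs @ [g]) M N = (\<Sum>n\<in>{M<..N}. g n * nested_sum gs n N)"
proof (induction gs arbitrary: N)
  case Nil
  then show ?case by simp
next
  case (Cons h gs)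
  have "nested_sum ((h # gs) @ [g]) M N
      = (\<Sum>l\<in>{M<..N}. \<Sum>n\<in>{M<..l - 1}. h l * (g n * nested_sum gs n (l - 1)))"
    by (simp add: Cons.IH sum_distrib_left)
  also have "\<dots> = (\<Sum>n\<in>{M<..N}. \<Sum>l\<in>{n<..N}. h l * (g n * nested_sum gs n (l - 1)))"
    by (subst sum.Sigma, simp, simp, subst sum.Sigma, simp, simp,
        rule sum.reindex_bij_witness[of _ "\<lambda>(a, b). (b, a)" "\<lambda>(a, b). (b, a)"]) auto
  finally show ?case by (simp add: sum_distrib_left mult_ac)
qed

lemma nested_sum_nonneg:
  assumes "\<And>g n. g \<in> set gs \<Longrightarrow> n > M \<Longrightarrow> 0 \<le> g n"
  shows "0 \<le> nested_sum gs M N"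
  using assms by (induction gs arbitrary: N) (auto intro!: sum_nonneg)

lemma nested_sum_cong:
  assumes "list_all2 (\<lambda>g h. \<forall>n>M. g n = h n) gs hs"
  shows "nested_sum gs M N = nested_sum hs M N"
  using assms
  by (induction gs hs arbitrary: N rule: list_all2_induct) (auto intro!: sum.cong)

lemma abs_nested_sum_le:
  assumes "list_all2 (\<lambda>g h. \<forall>n>M. \<bar>g n\<bar> \<le> h n) gs hs"
  shows "\<bar>nested_sum gs M N\<bar> \<le> nested_sum hs M N"
  using assms
proof (induction gs hs arbitrary: N rule: list_all2_induct)
  case (Cons g gs h hs)
  have "\<bar>nested_sum (g # gs) M N\<bar> \<le> (\<Sum>n\<in>{M<..N}. \<bar>g n * nested_sum gs M (n - 1)\<bar>)"
    by simp
  also have "\<dots> \<le> (\<Sum>n\<in>{M<..N}. h n * nested_sum hs M (n - 1))"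
    using Cons(1) Cons(3) unfolding abs_mult
    by (intro sum_mono mult_mono) (auto intro: order_trans[OF abs_ge_zero])
  finally show ?case by simp
qed auto

lemma nested_sum_mono:
  assumes "\<And>g n. g \<in> set gs \<Longrightarrow> n > M \<Longrightarrow> 0 \<le> g n" "N \<le> N'"
  shows "nested_sum gs M N \<le> nested_sum gs M N'"
proof (cases gs)
  case (Cons g hs)
  then show ?thesis using assms
    by (auto intro!: sum_mono2 mult_nonneg_nonneg nested_sum_nonneg)
qed auto

text \<open>Used for t n = 2n - 1 and t n = 2n, with factors that vanish off the range of
  \<open>t\<close>. The two cut-offs are translated separately; the inner upper bound becomes
  \<open>t n - 1\<close>, which is a true predecessor because of \<open>pos\<close>.\<close>

lemma nested_sum_reindex:
  fixes t :: "nat \<Rightarrow> nat"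
  assumes t: "strict_mono t" and pos: "\<And>n. n > M \<Longrightarrow> 0 < t n"
    and M: "\<And>n. n > M \<longleftrightarrow> t n > M'" and N: "\<And>n. n \<le> N \<longleftrightarrow> t n \<le> N'"
    and supp: "\<And>g n. g \<in> set gs \<Longrightarrow> n > M' \<Longrightarrow> n \<notin> range t \<Longrightarrow> g n = 0"
  shows "nested_sum gs M' N' = nested_sum (map (\<lambda>g. g \<circ> t) gs) M N"
  using N supp
proof (induction gs arbitrary: N N')
  case (Cons g gs)
  have "nested_sum (g # gs) M' N' = (\<Sum>n\<in>t ` {M<..N}. g n * nested_sum gs M' (n - 1))"
    unfolding nested_sum.simps
  proof (intro sum.mono_neutral_right ballI)
    fix i assume i: "i \<in> {M'<..N'} - t ` {M<..N}"
    then have "i \<notin> range t" using M Cons.prems(1) by fastforce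
    then show "g i * nested_sum gs M' (i - 1) = 0" using i Cons.prems(2)[of g i] by auto
  qed (use M Cons.prems in auto)
  also have "\<dots> = (\<Sum>n\<in>{M<..N}. g (t n) * nested_sum gs M' (t n - 1))"
    using strict_mono_imp_inj_on[OF t] by (subst sum.reindex) (auto intro: inj_on_subset)
  also have "\<dots> = (\<Sum>n\<in>{M<..N}. g (t n) * nested_sum (map (\<lambda>g. g \<circ> t) gs) M (n - 1))"
  proof (intro sum.cong refl arg_cong2[of _ _ _ _ "(*)"] Cons.IH)
    fix n k assume n: "n \<in> {M<..N}"
    have "k \<le> n - 1 \<longleftrightarrow> k < n" using n by auto
    also have "\<dots> \<longleftrightarrow> t k < t n" using t by (simp add: strict_mono_less)
    also have "\<dots> \<longleftrightarrow> t k \<le> t n - 1" using pos[of n] n by auto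
    finally show "k \<le> n - 1 \<longleftrightarrow> t k \<le> t n - 1" .
  qed (use Cons.prems in auto)
  finally show ?case by (simp add: comp_def)
qed simp

lemma nested_sum_scale:
  "nested_sum (map (\<lambda>k n. c ^ k * G k n) ks) M N = c ^ sum_list ks * nested_sum (map G ks) M N"
  for c :: real
  by (induction ks arbitrary: N) (auto simp: power_add sum_distrib_left mult_ac)

section \<open>Absolute convergence of nested sums\<close>

definition convergent_index :: "nat list \<Rightarrow> bool" where
  "convergent_index ks \<longleftrightarrow> is_index ks \<and> (ks \<noteq> [] \<longrightarrow> 2 \<le> hd ks)"

text \<open>All exponents are at least 1, so forgetting the order of the indices bounds the sum by a
  product of harmonic sums. Powers of \<open>harm\<close> grow slower than any power of N, so this
  crude bound suffices.\<close>

lemma nested_sum_power_le: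
  assumes "is_index ks"
  shows "nested_sum (map (\<lambda>k n. 1 / real n ^ k) ks) 0 N \<le> harm N ^ length ks"
  using assms
proof (induction ks arbitrary: N)
  case (Cons k ks)
  have k: "0 < k" "is_index ks" using Cons.prems by (auto simp: is_index_def)
  have "nested_sum (map (\<lambda>k n. 1 / real n ^ k) (k # ks)) 0 N
      \<le> (\<Sum>n\<in>{0<..N}. inverse (real n) * harm N ^ length ks)"
    unfolding list.map nested_sum.simps
  proof (intro sum_mono mult_mono)
    fix n assume n: "n \<in> {0<..N}"
    have "real n ^ 1 \<le> real n ^ k" using n k by (intro power_increasing) auto
    then show "1 / real n ^ k \<le> inverse (real n)" using n by (simp add: field_simps)
    have "harm (n - 1) \<le> (harm N :: real)" using n by (intro harm_mono) auto
    then have "harm (n - 1) ^ length ks \<le> (harm N :: real) ^ length ks"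
      by (intro power_mono) (auto simp: harm_nonneg)
    then show "nested_sum (map (\<lambda>k n. 1 / real n ^ k) ks) 0 (n - 1) \<le> harm N ^ length ks"
      using Cons.IH[OF k(2), of "n - 1"] by linarith
  qed (auto intro!: nested_sum_nonneg)
  also have "\<dots> = harm N ^ length (k # ks)"
    by (simp add: sum_distrib_right[symmetric] harm_def atLeastSucAtMost_greaterThanAtMost)
  finally show ?case .
qed simp

lemma harm_power_bigo: "(\<lambda>n. harm (Suc n) ^ q) \<in> O(\<lambda>n. real (Suc n) powr (1/4))"
proof -
  \<comment> \<open>Chosen so that e * q < 1/4; \<open>Suc q\<close> avoids a division by 0 at q =
    0.\<close>
  define e :: real where "e = 1 / (4 * real (Suc q))"
  have e: "e > 0" by (simp add: e_def)
  have "harm (Suc n) \<le> 1 + ln (real (Suc n))" for n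
    using decseqD[OF decseq_harm_diff_ln, of 0 n] by (simp add: harm_expand)
  then have "(\<lambda>n. harm (Suc n)) \<in> O(\<lambda>n. 1 + ln (real (Suc n)))"
    by (intro bigoI[of _ 1] always_eventually) (auto simp: harm_nonneg intro: order_trans[OF _ abs_ge_self])
  also have "(\<lambda>n. 1 + ln (real (Suc n))) \<in> O(\<lambda>n. real (Suc n) powr e)"
    using e by real_asymp
  finally have "(\<lambda>n. harm (Suc n) ^ q) \<in> O(\<lambda>n. (real (Suc n) powr e) ^ q)"
    by (rule landau_o.big_power)
  also have "(\<lambda>n. (real (Suc n) powr e) ^ q) \<in> O(\<lambda>n. real (Suc n) powr (1/4))"
  proof (intro bigoI[of _ 1] always_eventually allI)
    fix n
    have "(real (Suc n) powr e) ^ q = real (Suc n) powr (e * q)"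
      by (simp add: powr_powr flip: powr_realpow)
    also have "\<dots> \<le> real (Suc n) powr (1/4)"
      by (intro powr_mono) (auto simp: e_def field_simps)
    finally show "norm ((real (Suc n) powr e) ^ q) \<le> 1 * norm (real (Suc n) powr (1/4))" by simp
  qed
  finally show ?thesis .
qed

text \<open>The exponent -3/2 serves two purposes: it dominates 1/n^k for k >= 2, and it is the
  decay of \<open>central n\<close> times 1/n. The exponent 1/4 in the bound for \<open>harm\<close>
  leaves -5/4, still below -1.\<close>

lemma summable_harm_power: "summable (\<lambda>n. harm (Suc n) ^ q * real (Suc n) powr (-3/2))"
proof (rule summable_comparison_test_bigo)
  have "(\<lambda>n. harm (Suc n) ^ q * real (Suc n) powr (-3/2))
      \<in> O(\<lambda>n. real (Suc n) powr (1/4) * real (Suc n) powr (-3/2))"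
    by (intro landau_o.big.mult harm_power_bigo) auto
  then show "(\<lambda>n. harm (Suc n) ^ q * real (Suc n) powr (-3/2)) \<in> O(\<lambda>n. real (Suc n) powr (-5/4))"
    by (simp flip: powr_add)
  show "summable (\<lambda>n. norm (real (Suc n) powr (-5/4)))"
    using summable_real_powr_iff[of "-5/4"] by (subst summable_Suc_iff) auto
qed

lemma sum_greaterThan0_atMost: "(\<Sum>n\<in>{0<..N}. f n) = (\<Sum>n<N. f (Suc n))" for f :: "nat \<Rightarrow> 'a :: comm_monoid_add"
  by (rule sum.reindex_bij_witness[of _ Suc "\<lambda>n. n - 1"]) auto

lemma bounded_nested_sum:
  assumes "convergent_index ks"
  obtains C where "\<And>N. nested_sum (map (\<lambda>k n. 1 / real n ^ k) ks) 0 N \<le> C"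
proof (cases ks)
  case Nil
  then show ?thesis using that[of 1] by simp
next
  case (Cons k ls)
  have k: "k \<ge> 2" "is_index ls"
    using assms by (auto simp: convergent_index_def Cons is_index_def)
  let ?u = "\<lambda>n. harm (Suc n) ^ length ls * real (Suc n) powr (-3/2)"
  have "nested_sum (map (\<lambda>k n. 1 / real n ^ k) ks) 0 N \<le> (\<Sum>n. ?u n)" for N
  proof -
    have "nested_sum (map (\<lambda>k n. 1 / real n ^ k) ks) 0 N
       = (\<Sum>n<N. 1 / real (Suc n) ^ k * nested_sum (map (\<lambda>k n. 1 / real n ^ k) ls) 0 n)"
      by (simp add: Cons sum_greaterThan0_atMost)
    also have "\<dots> \<le> (\<Sum>n<N. real (Suc n) powr (-3/2) * harm (Suc n) ^ length ls)"
    proof (intro sum_mono mult_mono)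
      fix n
      have "1 / real (Suc n) ^ k = real (Suc n) powr (- real k)"
        by (simp add: powr_minus powr_realpow field_simps)
      also have "\<dots> \<le> real (Suc n) powr (-3/2)" using k by (intro powr_mono) auto
      finally show "1 / real (Suc n) ^ k \<le> real (Suc n) powr (-3/2)" .
      have "harm n ^ length ls \<le> (harm (Suc n) :: real) ^ length ls"
        by (intro power_mono harm_mono) (auto simp: harm_nonneg)
      then show "nested_sum (map (\<lambda>k n. 1 / real n ^ k) ls) 0 n \<le> harm (Suc n) ^ length ls"
        using nested_sum_power_le[OF k(2), of n] by linarith
    qed (auto intro!: nested_sum_nonneg)
    also have "\<dots> \<le> (\<Sum>n. ?u n)"
      using sum_le_suminf[OF summable_harm_power, of "{..<N}"]
      by (simp add: mult.commute harm_nonneg)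
    finally show ?thesis .
  qed
  then show ?thesis by (rule that)
qed

text \<open>Comparison with the positive sum. Only the size of the factors enters, so that the lemma
  covers both the signs in \<open>mpolylog\<close> and the parity conditions of
  \<open>parity_term\<close>.\<close>

lemma convergent_nested_sum:
  assumes "convergent_index ks"
    and gs: "list_all2 (\<lambda>g k. \<forall>n>0. \<bar>g n\<bar> \<le> 1 / real n ^ k) gs ks"
  shows "convergent (nested_sum gs 0)"
proof (cases ks)
  case Nil
  then have "nested_sum gs 0 = (\<lambda>N. 1)" using gs by (auto simp: fun_eq_iff)
  then show ?thesis by (simp add: convergent_const)
next
  case (Cons k ls)
  let ?G = "\<lambda>k n. 1 / real n ^ k"
  obtain g hs where [simp]: "gs = g # hs"
    and g: "\<forall>n>0. \<bar>g n\<bar> \<le> ?G k n" and hs: "list_all2 (\<lambda>g k. \<forall>n>0. \<bar>g n\<bar> \<le> ?G k n) hs ls"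
    using gs by (auto simp: Cons list_all2_Cons2)
  obtain C where C: "\<And>N. nested_sum (map ?G ks) 0 N \<le> C" using bounded_nested_sum[OF assms(1)] by blast
  have sm: "summable (\<lambda>n. ?G k (Suc n) * nested_sum (map ?G ls) 0 n)"
  proof (rule summableI_nonneg_bounded)
    fix N
    show "(\<Sum>n<N. ?G k (Suc n) * nested_sum (map ?G ls) 0 n) \<le> C"
      using C[of N] by (simp add: Cons sum_greaterThan0_atMost)
  qed (intro mult_nonneg_nonneg nested_sum_nonneg; auto)
  have "summable (\<lambda>n. g (Suc n) * nested_sum hs 0 n)"
  proof (rule summable_comparison_test'[OF sm])
    fix n
    have "\<bar>nested_sum hs 0 n\<bar> \<le> nested_sum (map ?G ls) 0 n"
      using hs by (intro abs_nested_sum_le) (simp add: list_all2_map2)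
    then show "norm (g (Suc n) * nested_sum hs 0 n) \<le> ?G k (Suc n) * nested_sum (map ?G ls) 0 n"
      using g unfolding real_norm_def abs_mult by (intro mult_mono) auto
  qed
  then have "convergent (\<lambda>N. \<Sum>n<N. g (Suc n) * nested_sum hs 0 n)"
    by (simp add: summable_iff_convergent)
  moreover have "nested_sum gs 0 = (\<lambda>N. \<Sum>n<N. g (Suc n) * nested_sum hs 0 n)"
    by (simp add: fun_eq_iff sum_greaterThan0_atMost)
  ultimately show ?thesis by simp
qed

section \<open>Multiple Hurwitz zeta values\<close>

text \<open>Here, and for lists called \<open>ks\<close> below, the exponents are listed starting from the smallest
  summation index, in the opposite order to \<^const>\<open>mzv\<close>.\<close>

fun hurwitz :: "nat list \<Rightarrow> real \<Rightarrow> ennreal" where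
  "hurwitz [] z = 1"
| "hurwitz (k # ks) z = (\<Sum>n. ennreal (1 / (z + real (Suc n)) ^ k) * hurwitz ks (z + real (Suc n)))"

text \<open>Monotone convergence when the range and the summands both grow with \<open>N\<close>:
  padding by 0 beyond the range gives series \<open>a N\<close> that increase in every term.\<close>

lemma SUP_triangular_sum:
  fixes g :: "nat \<Rightarrow> real" and u :: "nat \<Rightarrow> nat \<Rightarrow> real"
  assumes g: "\<And>n. n > M \<Longrightarrow> 0 \<le> g n"
    and u: "\<And>n N. n > M \<Longrightarrow> 0 \<le> u n N" "\<And>n. n > M \<Longrightarrow> mono (u n)"
  shows "(SUP N. ennreal (\<Sum>n\<in>{M<..N}. g n * u n N))
    = (\<Sum>i. ennreal (g (Suc (M + i))) * (SUP N. ennreal (u (Suc (M + i)) N)))"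
proof -
  define a where "a N i = (if Suc (M + i) \<le> N then ennreal (g (Suc (M + i)) * u (Suc (M + i)) N) else 0)" for N i
  have gu: "ennreal (g (Suc (M + i))) * ennreal (u (Suc (M + i)) N) = ennreal (g (Suc (M + i)) * u (Suc (M + i)) N)" for i N
    using g by (intro ennreal_mult'[symmetric]) auto
  have le: "ennreal (g (Suc (M + i)) * u (Suc (M + i)) N) \<le> ennreal (g (Suc (M + i)) * u (Suc (M + i)) N')"
    if "N \<le> N'" for i N N'
    using g monoD[OF u(2) that] by (intro ennreal_leI mult_left_mono) auto
  have inc: "incseq (\<lambda>N. a N i)" for i
    by (intro incseq_SucI) (auto simp: a_def intro: le)
  have sum_a: "ennreal (\<Sum>n\<in>{M<..N}. g n * u n N) = (\<Sum>i. a N i)" for N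
  proof -
    have "(\<Sum>n\<in>{M<..N}. g n * u n N) = (\<Sum>i<N - M. g (Suc (M + i)) * u (Suc (M + i)) N)"
      by (rule sum.reindex_bij_witness[of _ "\<lambda>i. Suc (M + i)" "\<lambda>n. n - Suc M"]) auto
    also have "ennreal \<dots> = (\<Sum>i<N - M. ennreal (g (Suc (M + i)) * u (Suc (M + i)) N))"
      using g u by (intro sum_ennreal[symmetric] mult_nonneg_nonneg) auto
    also have "\<dots> = (\<Sum>i<N - M. a N i)"
      by (intro sum.cong refl) (auto simp: a_def)
    also have "\<dots> = (\<Sum>i. a N i)"
      by (rule suminf_finite[symmetric]) (auto simp: a_def)
    finally show ?thesis .
  qed
  have SUP_a: "(SUP N. a N i) = ennreal (g (Suc (M + i))) * (SUP N. ennreal (u (Suc (M + i)) N))" for i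
  proof -
    have "(SUP N. a N i) = (SUP N. ennreal (g (Suc (M + i))) * ennreal (u (Suc (M + i)) N))"
    proof (rule antisym)
      show "(SUP N. a N i) \<le> (SUP N. ennreal (g (Suc (M + i))) * ennreal (u (Suc (M + i)) N))"
        unfolding gu by (intro SUP_mono) (auto simp: a_def)
      show "(SUP N. ennreal (g (Suc (M + i))) * ennreal (u (Suc (M + i)) N)) \<le> (SUP N. a N i)"
        unfolding gu
      proof (intro SUP_mono)
        fix N
        \<comment> \<open>The witness is at least \<open>N\<close> and large enough for the term not
          to be padded.\<close>
        show "\<exists>m\<in>UNIV. ennreal (g (Suc (M + i)) * u (Suc (M + i)) N) \<le> a m i"
          by (intro bexI[of _ "N + Suc (M + i)"]) (auto simp: a_def intro!: le)
      qed
    qed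
    then show ?thesis by (simp add: SUP_mult_left_ennreal)
  qed
  have "(SUP N. ennreal (\<Sum>n\<in>{M<..N}. g n * u n N)) = (\<Sum>i. SUP N. a N i)"
    unfolding sum_a by (rule ennreal_suminf_SUP_eq[symmetric]) (rule inc)
  then show ?thesis unfolding SUP_a .
qed

text \<open>Both sides peel off the smallest index. \<open>M\<close> has to be arbitrary since each
  step of \<open>hurwitz\<close> shifts the argument; \<open>rev\<close> reconciles the two orders
  of listing exponents.\<close>

lemma hurwitz_SUP:
  assumes "z + real M > -1"
  shows "hurwitz ks (z + real M) = (SUP N. ennreal (nested_sum (map (\<lambda>k n. 1 / (z + real n) ^ k) (rev ks)) M N))"
  using assms
proof (induction ks arbitrary: M)
  case (Cons k ks)
  let ?g = "\<lambda>k n. 1 / (z + real n) ^ k"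
  have "(SUP N. ennreal (nested_sum (map ?g (rev (k # ks))) M N))
      = (SUP N. ennreal (\<Sum>n\<in>{M<..N}. ?g k n * nested_sum (map ?g (rev ks)) n N))"
    by (simp add: nested_sum_snoc)
  also have "\<dots> = (\<Sum>i. ennreal (?g k (Suc (M + i))) * (SUP N. ennreal (nested_sum (map ?g (rev ks)) (Suc (M + i)) N)))"
    using Cons.prems by (intro SUP_triangular_sum) (auto intro!: nested_sum_nonneg monoI nested_sum_mono)
  also have "\<dots> = hurwitz (k # ks) (z + real M)"
    using Cons.prems by (simp add: Cons.IH[symmetric] add_ac)
  finally show ?case ..
qed simp

lemma SUP_eq_imp_tendsto:
  assumes "\<And>N. 0 \<le> u N" "mono u" "(SUP N. ennreal (u N)) = ennreal c" "0 \<le> c"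
  shows "u \<longlonglongrightarrow> c"
proof -
  have "(\<lambda>N. ennreal (u N)) \<longlonglongrightarrow> ennreal c"
    unfolding assms(3)[symmetric] using assms(2) by (intro LIMSEQ_SUP) (auto simp: mono_def ennreal_leI)
  then show ?thesis using assms by (simp add: tendsto_ennreal_iff)
qed

definition hurwitz_real :: "nat list \<Rightarrow> real \<Rightarrow> real" where
  "hurwitz_real ks z = enn2real (hurwitz ks z)"

lemma hurwitz_real_nonneg [simp]: "0 \<le> hurwitz_real ks z"
  by (simp add: hurwitz_real_def)

lemma hurwitz_real_Nil [simp]: "hurwitz_real [] z = 1"
  by (simp add: hurwitz_real_def)

text \<open>For n >= 1 and z >= -1/2 one has n + z >= n/2, so the factor with exponent k is at most
  2^k times its value at z = 0.\<close>

lemma hurwitz_less_top: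
  assumes "convergent_index (rev ks)" "-1/2 \<le> z"
  shows "hurwitz ks z < top"
proof -
  obtain C where C: "\<And>N. nested_sum (map (\<lambda>k n. 1 / real n ^ k) (rev ks)) 0 N \<le> C"
    using bounded_nested_sum[OF assms(1)] by blast
  have "hurwitz ks z = (SUP N. ennreal (nested_sum (map (\<lambda>k n. 1 / (z + real n) ^ k) (rev ks)) 0 N))"
    using hurwitz_SUP[of z 0 ks] assms by simp
  also have "\<dots> \<le> ennreal (2 ^ sum_list (rev ks) * C)"
  proof (intro SUP_least ennreal_leI)
    fix N
    have "\<bar>nested_sum (map (\<lambda>k n. 1 / (z + real n) ^ k) (rev ks)) 0 N\<bar>
        \<le> nested_sum (map (\<lambda>k n. 2 ^ k * (1 / real n ^ k)) (rev ks)) 0 N"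
    proof (intro abs_nested_sum_le, unfold list_all2_map1 list_all2_map2, rule list.rel_refl_strong, intro allI impI)
      fix k n :: nat assume n: "n > 0"
      have "1 / (z + real n) \<le> 2 / real n" "0 < z + real n"
        using n assms by (auto simp: field_simps)
      then have "(1 / (z + real n)) ^ k \<le> (2 / real n) ^ k" by (intro power_mono) auto
      then show "\<bar>1 / (z + real n) ^ k\<bar> \<le> 2 ^ k * (1 / real n ^ k)"
        using \<open>0 < z + real n\<close> by (simp add: power_divide)
    qed
    also have "\<dots> \<le> 2 ^ sum_list (rev ks) * C"
      unfolding nested_sum_scale by (intro mult_left_mono C) auto
    finally show "nested_sum (map (\<lambda>k n. 1 / (z + real n) ^ k) (rev ks)) 0 N \<le> 2 ^ sum_list (rev ks) * C"
      by simp
  qed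
  also have "\<dots> < top" by simp
  finally show ?thesis .
qed

lemma ennreal_hurwitz_real:
  assumes "convergent_index (rev ks)" "-1/2 \<le> z"
  shows "ennreal (hurwitz_real ks z) = hurwitz ks z"
  using hurwitz_less_top[OF assms] by (simp add: hurwitz_real_def)

lemma nested_sum_tendsto_hurwitz_real:
  assumes "convergent_index (rev ks)" "-1/2 \<le> z"
  shows "nested_sum (map (\<lambda>k n. 1 / (z + real n) ^ k) (rev ks)) M \<longlonglongrightarrow> hurwitz_real ks (z + real M)"
proof (rule SUP_eq_imp_tendsto)
  show "mono (nested_sum (map (\<lambda>k n. 1 / (z + real n) ^ k) (rev ks)) M)"
    unfolding mono_def using assms(2) by (auto intro!: nested_sum_mono)
  show "(SUP N. ennreal (nested_sum (map (\<lambda>k n. 1 / (z + real n) ^ k) (rev ks)) M N)) = ennreal (hurwitz_real ks (z + real M))"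
    using assms by (simp add: ennreal_hurwitz_real hurwitz_SUP)
qed (use assms in \<open>auto intro!: nested_sum_nonneg\<close>)

lemma mzv_eq_hurwitz_real:
  assumes "convergent_index ks"
  shows "mzv ks = hurwitz_real (rev ks) 0"
proof -
  have "(\<Sum>ns\<in>desc_tuples (length ks) N. \<Prod>j<length ks. 1 / real (ns ! j) ^ (ks ! j))
      = nested_sum (map (\<lambda>k n. 1 / real n ^ k) ks) 0 N" for N
    using sum_desc_tuples[of "map (\<lambda>k n. 1 / real n ^ k) ks" N] by simp
  then show ?thesis
    using nested_sum_tendsto_hurwitz_real[of "rev ks" 0 0] assms by (simp add: mzv_def limI)
qed

section \<open>The generating function of the central binomial coefficients times harmonic numbers\<close>

definition central :: "nat \<Rightarrow> real" where
  "central n = real ((2 * n) choose n) / 4 ^ n"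

lemma central_0 [simp]: "central 0 = 1"
  by (simp add: central_def)

lemma central_nonneg [simp]: "0 \<le> central n"
  by (simp add: central_def)

lemma central_Suc: "real (Suc n) * central (Suc n) = (real n + 1/2) * central n"
proof -
  have "Suc n * Suc n * ((2 * Suc n) choose Suc n) = (2 * n + 2) * (2 * n + 1) * ((2 * n) choose n)"
  proof -
    have "Suc n * ((2 * Suc n) choose Suc n) = (2 * n + 2) * ((2 * n + 1) choose n)"
      using Suc_times_binomial[of n "2 * n + 1"] by simp
    moreover have "Suc n * ((2 * n + 1) choose n) = (2 * n + 1) * ((2 * n) choose n)"
      using binomial_absorb_comp[of "2 * n + 1" n] by simp
    ultimately show ?thesis by (metis mult.assoc mult.left_commute)
  qed
  then have "real (Suc n * Suc n * ((2 * Suc n) choose Suc n))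
      = real ((2 * n + 2) * (2 * n + 1) * ((2 * n) choose n))" by presburger
  then have "real (Suc n) * (real (Suc n) * real ((2 * Suc n) choose Suc n))
      = real (Suc n) * ((4 * real n + 2) * real ((2 * n) choose n))"
    by (simp add: algebra_simps)
  then have "real (Suc n) * real ((2 * Suc n) choose Suc n) = (4 * real n + 2) * real ((2 * n) choose n)"
    by (metis mult_left_cancel of_nat_eq_0_iff nat.distinct(1))
  then show ?thesis by (simp add: central_def field_simps)
qed

lemma central_gbinomial: "central n = (-1) ^ n * ((-1/2) gchoose n)"
proof (induction n)
  case (Suc n)
  have "real (Suc n) * ((-1/2) gchoose Suc n) = (-1/2 - real n) * ((-1/2) gchoose n)"
    using gbinomial_mult_1[of "-1/2 :: real" n] by (simp add: algebra_simps)
  then have "(-1) ^ Suc n * (real (Suc n) * ((-1/2) gchoose Suc n))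
      = (-1) ^ Suc n * ((-1/2 - real n) * ((-1/2) gchoose n))" by (rule arg_cong)
  also have "\<dots> = (real n + 1/2) * ((-1) ^ n * ((-1/2) gchoose n))"
    by (simp add: algebra_simps)
  finally have "real (Suc n) * ((-1) ^ Suc n * ((-1/2) gchoose Suc n)) = (real n + 1/2) * ((-1) ^ n * ((-1/2) gchoose n))"
    by (simp only: mult.left_commute)
  then show ?case using central_Suc[of n] Suc.IH
    by (metis mult_left_cancel of_nat_eq_0_iff nat.distinct(1))
qed simp

text \<open>The left-hand side is 1 at n = 0 and does not increase, because (2n + 1)(2n + 3) <= (2n
  + 2)^2. In this form the bound of order n^(-1/2) for \<open>central n\<close> is
  inductive.\<close>

lemma central_sq_le: "central n ^ 2 * (2 * real n + 1) \<le> 1"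
proof (induction n)
  case (Suc n)
  have c: "central (Suc n) = (2 * real n + 1) / (2 * real n + 2) * central n"
    using central_Suc[of n] by (simp add: field_simps)
  have "central (Suc n) ^ 2 * (2 * real (Suc n) + 1)
     = central n ^ 2 * (2 * real n + 1) * ((2 * real n + 1) * (2 * real n + 3) / (2 * real n + 2) ^ 2)"
    unfolding c by (simp add: power2_eq_square power_divide algebra_simps)
  also have "\<dots> \<le> 1 * 1"
  proof (intro mult_mono Suc.IH)
    have "(2 * real n + 1) * (2 * real n + 3) \<le> (2 * real n + 2) ^ 2"
      by (simp add: algebra_simps power2_eq_square)
    then show "(2 * real n + 1) * (2 * real n + 3) / (2 * real n + 2) ^ 2 \<le> 1"
      by (simp add: divide_le_eq_1)
  qed auto
  finally show ?case by simp
qed simp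

lemma central_le: "central (Suc n) \<le> real (Suc n) powr (-1/2)"
proof -
  have "central (Suc n) ^ 2 * real (Suc n) \<le> central (Suc n) ^ 2 * (2 * real (Suc n) + 1)"
    by (intro mult_left_mono) auto
  also have "\<dots> \<le> 1" by (rule central_sq_le)
  finally have "central (Suc n) ^ 2 \<le> 1 / real (Suc n)" by (simp add: field_simps)
  then have "sqrt (central (Suc n) ^ 2) \<le> sqrt (1 / real (Suc n))" by (rule real_sqrt_le_mono)
  then show ?thesis
    by (simp add: real_sqrt_divide powr_minus powr_half_sqrt field_simps)
qed

lemma central_sums:
  assumes "\<bar>y\<bar> < 1"
  shows "(\<lambda>n. central n * y ^ n) sums (1 / sqrt (1 - y))"
proof -
  have "(\<lambda>n. ((-1/2) gchoose n) * (- y) ^ n) sums (1 + - y) powr (-1/2)"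
    using assms by (intro gen_binomial_real) auto
  moreover have "((-1/2) gchoose n) * (- y) ^ n = central n * y ^ n" for n
    by (simp add: central_gbinomial power_minus[of y])
  ultimately show ?thesis
    using assms by (simp add: powr_minus powr_half_sqrt field_simps)
qed

lemma harm_le_of_nat: "harm n \<le> real n"
proof (induction n)
  case (Suc n)
  have "inverse (real (Suc n)) \<le> 1" by (simp add: field_simps)
  then show ?case using Suc by (simp add: harm_Suc)
qed (simp add: harm_expand)

lemma central_le_1: "central n \<le> 1"
proof -
  have "central n ^ 2 * 1 \<le> central n ^ 2 * (2 * real n + 1)" by (intro mult_left_mono) auto
  also have "\<dots> \<le> 1" by (rule central_sq_le)
  finally show ?thesis by (simp add: abs_square_le_1)
qed

lemma summable_central_harm:
  fixes y :: real
  assumes "\<bar>y\<bar> < 1"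
  shows "summable (\<lambda>n. central n * harm n * y ^ n)"
proof (rule summable_comparison_test')
  have "(\<lambda>n. real (Suc n) * \<bar>y\<bar> ^ n) sums (1 / (1 - \<bar>y\<bar>)\<^sup>2)"
    using assms by (intro geometric_deriv_sums) auto
  then have "summable (\<lambda>n. real (Suc n) * \<bar>y\<bar> ^ n)" by (rule sums_summable)
  then show "summable (\<lambda>n. real n * \<bar>y\<bar> ^ n)"
    by (rule summable_comparison_test') (auto simp: abs_mult mult_right_mono)
  show "norm (central n * harm n * y ^ n) \<le> real n * \<bar>y\<bar> ^ n" for n
    using mult_mono[OF central_le_1[of n] harm_le_of_nat[of n]]
    by (auto simp: abs_mult power_abs harm_nonneg intro!: mult_right_mono)
qed

text \<open>With \<open>central_Suc\<close>, the coefficients satisfy (n + 1) c_(n+1) H_(n+1) = (n +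
  1/2) c_n H_n + c_(n+1). This is a first-order linear differential equation for the series, whose
  inhomogeneous part is the binomial series of \<open>central_sums\<close> without its constant
  term, divided by z.\<close>

lemma central_harm_suminf:
  fixes y :: real
  assumes y: "0 \<le> y" "y < 1"
  shows "(\<Sum>n. central n * harm n * y ^ n) = 2 / sqrt (1 - y) * ln ((1 + sqrt (1 - y)) / (2 * sqrt (1 - y)))"
proof -
  define c where "c n = central n * harm n" for n
  define G where "G z = (\<Sum>n. c n * z ^ n)" for z
  define G' where "G' z = (\<Sum>n. diffs c n * z ^ n)" for z
  have sm: "summable (\<lambda>n. c n * z ^ n)" if "norm z < 1" for z
    using summable_central_harm[of z] that by (simp add: c_def)
  have smd: "summable (\<lambda>n. diffs c n * z ^ n)" if "norm z < 1" for z
    using that by (intro termdiff_converges[of z 1] sm) auto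
  have dG: "(G has_real_derivative G' z) (at z)" if "norm z < 1" for z
    unfolding G_def G'_def using that by (intro termdiffs_strong'[of 1] sm) auto
  have diffs_c: "diffs c n = real n * c n + c n / 2 + central (Suc n)" for n
  proof -
    have "diffs c n = (real (Suc n) * central (Suc n)) * harm n + central (Suc n)"
      by (simp add: diffs_def c_def harm_Suc field_simps)
    then show ?thesis unfolding central_Suc by (simp add: c_def algebra_simps)
  qed
  have ode: "(1 - z) * G' z - G z / 2 = (1 / sqrt (1 - z) - 1) / z" if "0 < z" "z < 1" for z
  proof -
    have nz: "norm z < 1" using that by simp
    have "(\<lambda>n. central (Suc n) * z ^ Suc n) sums (1 / sqrt (1 - z) - 1)"
      using central_sums[of z] nz by (subst sums_Suc_iff) simp
    then have 1: "(\<lambda>n. central (Suc n) * z ^ n) sums ((1 / sqrt (1 - z) - 1) / z)"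
      using sums_divide[of _ _ z] that by (fastforce simp: field_simps)
    have "(\<lambda>n. real (Suc n) * c (Suc n) * z ^ n) sums G' z"
      using summable_sums[OF smd[OF nz]] by (simp add: G'_def diffs_def)
    then have "(\<lambda>n. real (Suc n) * c (Suc n) * z ^ n * z) sums (G' z * z)"
      by (rule sums_mult2)
    then have "(\<lambda>n. (\<lambda>n. real n * c n * z ^ n) (Suc n)) sums (G' z * z)" by (simp add: mult_ac)
    then have "(\<lambda>n. real n * c n * z ^ n) sums (G' z * z)"
      by (subst (asm) sums_Suc_iff) simp
    from sums_add[OF sums_add[OF this sums_divide[OF summable_sums[OF sm[OF nz]], of 2]] 1]
    have "(\<lambda>n. diffs c n * z ^ n) sums (G' z * z + G z / 2 + (1 / sqrt (1 - z) - 1) / z)"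
      by (simp add: diffs_c G_def algebra_simps)
    then have "G' z = G' z * z + G z / 2 + (1 / sqrt (1 - z) - 1) / z"
      unfolding G'_def by (rule sums_unique[symmetric])
    then show ?thesis by (simp add: algebra_simps)
  qed
  \<comment> \<open>\<open>sqrt (1 - z)\<close> is the integrating factor, and what is subtracted is
    an antiderivative of the resulting right-hand side. So \<open>K\<close> is constant, and
    \<open>K 0\<close> gives the term with ln 2.\<close>
  define K where "K z = sqrt (1 - z) * G z - 2 * (ln (1 + sqrt (1 - z)) - ln (sqrt (1 - z)))" for z
  have "K y = K 0"
  proof (cases "y = 0")
    case False
    then have "0 < y" using y by simp
    then show ?thesis
    proof (rule DERIV_isconst2)
      have dK: "(K has_real_derivative (- 1 / (2 * sqrt (1 - z)) * G z + G' z * sqrt (1 - z)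
         - 2 * (1 / (1 + sqrt (1 - z)) * (0 + - 1 / (2 * sqrt (1 - z)))
              - 1 / sqrt (1 - z) * (- 1 / (2 * sqrt (1 - z)))))) (at z)"
        if z: "norm z < 1" for z
      proof -
        have s: "sqrt (1 - z) > 0" "z < 1" using z by auto
        have dsq: "((\<lambda>z. sqrt (1 - z)) has_real_derivative (- 1 / (2 * sqrt (1 - z)))) (at z)"
          using s by (auto intro!: derivative_eq_intros simp: field_simps)
        have l1: "((\<lambda>z. ln (1 + sqrt (1 - z))) has_real_derivative
           (1 / (1 + sqrt (1 - z)) * (0 + - 1 / (2 * sqrt (1 - z))))) (at z)"
          using add_pos_pos[OF zero_less_one s(1)]
          by (intro DERIV_chain2[OF DERIV_ln_divide DERIV_add[OF DERIV_const dsq]])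
        have l2: "((\<lambda>z. ln (sqrt (1 - z))) has_real_derivative
           (1 / sqrt (1 - z) * (- 1 / (2 * sqrt (1 - z))))) (at z)"
          using s by (intro DERIV_chain2[OF DERIV_ln_divide dsq]) auto
        show ?thesis unfolding K_def
          by (rule DERIV_diff[OF DERIV_mult[OF dsq dG[OF z]] DERIV_cmult[OF DERIV_diff[OF l1 l2]]])
      qed
      \<comment> \<open>The differential equation divides by z, so the endpoint 0 is reached by
        continuity only.\<close>
      show "continuous_on {0..y} K"
        using y by (intro continuous_at_imp_continuous_on ballI DERIV_isCont[OF dK]) auto
      show "(K has_real_derivative 0) (at z)" if "0 < z" "z < y" for z
      proof -
        have z: "0 < z" "z < 1" using that y by auto
        \<comment> \<open>In terms of s, z = (1 - s)(1 + s), so the factor 1 - s cancels and (1/s -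
          1)/z = 1/(s (1 + s)).\<close>
        define s where "s = sqrt (1 - z)"
        have s: "0 < s" "s < 1" "s\<^sup>2 = 1 - z" using z by (auto simp: s_def)
        have zs: "z = (1 - s) * (1 + s)" using s(3) by (simp add: algebra_simps power2_eq_square)
        have o: "s\<^sup>2 * G' z = G z / 2 + (1 / s - 1) / z"
          using ode[OF z] unfolding s(3) s_def[symmetric] by simp
        have "1 / s - 1 = (1 - s) / s" using s by (simp add: field_simps)
        then have "(1 / s - 1) / z = 1 / (s * (1 + s))"
          using s zs by simp
        with o have "s * (s * G' z) = G z / 2 + 1 / (s * (1 + s))"
          by (simp add: power2_eq_square mult.assoc)
        also have "\<dots> = s * (G z / (2 * s) + 1 / (s\<^sup>2 * (1 + s)))"
        proof -
          have "s * (1 / (s\<^sup>2 * c)) = 1 / (s * c)" for c using s(1) by (simp add: power2_eq_square)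
          from this[of "1 + s"] show ?thesis using s(1) unfolding distrib_left[of s "G z / (2 * s)"] by simp
        qed
        finally have "s * (s * G' z) = s * (G z / (2 * s) + 1 / (s\<^sup>2 * (1 + s)))" .
        then have o2: "s * G' z = G z / (2 * s) + 1 / (s\<^sup>2 * (1 + s))"
          using s by (metis mult_left_cancel less_irrefl)
        have e: "1 / (1 + s) * (- 1 / (2 * s)) - 1 / s * (- 1 / (2 * s)) = 1 / (2 * (s\<^sup>2 * (1 + s)))"
          using s(1) by (simp add: divide_simps power2_eq_square)
        have "- 1 / (2 * s) * G z + G' z * s
         - 2 * (1 / (1 + s) * (0 + - 1 / (2 * s)) - 1 / s * (- 1 / (2 * s))) = 0"
          unfolding mult.commute[of "G' z" s] o2 add_0_left e using s by simp
        with dK[of z] z show ?thesis by (simp add: s_def)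
      qed
    qed (use \<open>0 < y\<close> in auto)
  qed simp
  also have "K 0 = - 2 * ln 2" by (simp add: K_def G_def c_def powser_zero harm_expand)
  finally have "sqrt (1 - y) * G y = 2 * (ln (1 + sqrt (1 - y)) - ln 2 - ln (sqrt (1 - y)))"
    by (simp add: K_def)
  moreover have "ln ((1 + sqrt (1 - y)) / (2 * sqrt (1 - y))) = ln (1 + sqrt (1 - y)) - ln 2 - ln (sqrt (1 - y))"
  proof -
    have "sqrt (1 - y) > 0" using y by simp
    moreover from this have "1 + sqrt (1 - y) > 0" by linarith
    ultimately show ?thesis by (simp add: ln_div ln_mult)
  qed
  ultimately have "sqrt (1 - y) * G y = 2 * ln ((1 + sqrt (1 - y)) / (2 * sqrt (1 - y)))" by simp
  then show ?thesis
    using y by (simp add: G_def c_def field_simps)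
qed

text \<open>The first series is the odd part of the logarithmic series at sqrt x; the second is the
  logarithmic series at x, divided by sqrt x. They will produce f at integers and at
  half-integers.\<close>

lemma log_kernel_sums:
  fixes x :: real
  assumes x: "0 < x" "x < 1"
  shows "(\<lambda>n. x ^ n / (real n + 1/2)) sums ((ln (1 + sqrt x) - ln (1 - sqrt x)) / sqrt x)"
    and "(\<lambda>n. x powr (real n + 1/2) / real (Suc n)) sums (- ln (1 - x) / sqrt x)"
proof -
  define s where "s = sqrt x"
  have s: "0 < s" "s < 1" "x = s\<^sup>2" using x by (auto simp: s_def)
  have ln: "(\<lambda>n. - ((- y) ^ n) / real n) sums (ln (1 + y))" if "\<bar>y\<bar> < 1" for y :: real
    using ln_series'[OF that] .
  have "(\<lambda>n. - ((- s) ^ n) / real n - (- ((- (- s)) ^ n) / real n)) sums (ln (1 + s) - ln (1 + - s))"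
    using s by (intro sums_diff ln) auto
  then have "(\<lambda>n. (s ^ n - (- s) ^ n) / real n) sums (ln (1 + s) - ln (1 - s))"
    by (simp add: diff_divide_distrib)
  then have "(\<lambda>n. (s ^ (2 * n + 1) - (- s) ^ (2 * n + 1)) / real (2 * n + 1)) sums (ln (1 + s) - ln (1 - s))"
  proof (subst sums_mono_reindex)
    show "strict_mono (\<lambda>n::nat. 2 * n + 1)" by (simp add: strict_mono_def)
    fix n :: nat assume "n \<notin> range (\<lambda>n. 2 * n + 1)"
    then have "even n" by (metis oddE rangeI)
    then show "(s ^ n - (- s) ^ n) / real n = 0" by simp
  qed
  from sums_divide[OF this, of s]
  show "(\<lambda>n. x ^ n / (real n + 1/2)) sums ((ln (1 + sqrt x) - ln (1 - sqrt x)) / sqrt x)"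
  proof -
    have "(s ^ (2 * n + 1) - (- s) ^ (2 * n + 1)) / real (2 * n + 1) / s = x ^ n / (real n + 1/2)" for n
    proof -
      have "(- s) ^ (2 * n + 1) = - (s ^ (2 * n + 1))" by simp
      moreover have "s ^ (2 * n + 1) = x ^ n * s" unfolding s(3) by (simp add: power_mult)
      moreover have "(a * s - - (a * s)) / (2 * c) / s = a / c" for a c :: real
        using s(1) by simp
      from this[of "x ^ n" "real n + 1/2"]
      have "(x ^ n * s - - (x ^ n * s)) / real (2 * n + 1) / s = x ^ n / (real n + 1/2)"
        by (simp add: algebra_simps)
      ultimately show ?thesis by (simp only:)
    qed
    then show ?thesis
      using \<open>(\<lambda>n. (s ^ (2 * n + 1) - (- s) ^ (2 * n + 1)) / real (2 * n + 1) / s) sums _\<close>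
      unfolding s_def[symmetric] by simp
  qed
  have "(\<lambda>n. - (- ((- (- x)) ^ n) / real n)) sums (- ln (1 + - x))"
    using x by (intro sums_minus ln) auto
  then have "(\<lambda>n. x ^ n / real n) sums (- ln (1 - x))" by simp
  then have "(\<lambda>n. x ^ Suc n / real (Suc n)) sums (- ln (1 - x))"
    by (subst sums_Suc_iff) simp
  from sums_divide[OF this, of s]
  show "(\<lambda>n. x powr (real n + 1/2) / real (Suc n)) sums (- ln (1 - x) / sqrt x)"
  proof -
    have "x ^ Suc n / real (Suc n) / s = x powr (real n + 1/2) / real (Suc n)" for n
    proof -
      have "x powr (real n + 1/2) = x ^ n * s"
        using x by (simp add: powr_add powr_half_sqrt powr_realpow s_def)
      moreover have "x ^ Suc n = x ^ n * s * s" by (simp add: s(3) power2_eq_square)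
      moreover have "a * s * s / c / s = a * s / c" for a c :: real using s(1) by simp
      ultimately show ?thesis by (simp only:)
    qed
    then show ?thesis
      using \<open>(\<lambda>n. x ^ Suc n / real (Suc n) / s) sums _\<close> by (simp only: minus_divide_left s_def[symmetric])
  qed
qed

text \<open>With s = sqrt x, every term is a combination of ln (1 + s), ln (1 - s), ln s and ln 2,
  divided by s, and ln (1 - x) = ln (1 - s) + ln (1 + s) makes the two sides agree. The terms are
  distributed over the sides so that each of them is nonnegative on (0, 1).\<close>

lemma kernel_identity:
  fixes x :: real
  assumes x: "0 < x" "x < 1"
  shows "(\<Sum>n. central (Suc n) * harm (Suc n) * (1 - x) ^ Suc n) + 2 * ln 2 * x powr (-1/2)
      + (\<Sum>k. x powr (real k + 1/2) / real (Suc k))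
     = - ln x * x powr (-1/2) + (\<Sum>k. x ^ k / (real k + 1/2))"
proof -
  define s where "s = sqrt x"
  have s: "0 < s" "s < 1" "x = s\<^sup>2" using x by (auto simp: s_def)
  \<comment> \<open>The term at n = 0 vanishes because \<open>harm 0 = 0\<close>.\<close>
  have 0: "(\<Sum>n. central (Suc n) * harm (Suc n) * (1 - x) ^ Suc n)
      = (\<Sum>n. central n * harm n * (1 - x) ^ n)"
    using suminf_split_head[OF summable_central_harm[of "1 - x"]] x by (simp add: harm_expand)
  also have "\<dots> = 2 / s * ln ((1 + s) / (2 * s))"
    using central_harm_suminf[of "1 - x"] x by (simp add: s_def)
  finally have 1: "(\<Sum>n. central (Suc n) * harm (Suc n) * (1 - x) ^ Suc n)
     = 2 / s * (ln (1 + s) - ln 2 - ln s)"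
    using s by (simp add: ln_div ln_mult)
  have 2: "x powr (-1/2) = 1 / s" using x by (simp add: s_def powr_minus powr_half_sqrt field_simps)
  have 3: "ln x = 2 * ln s" using s by (simp add: ln_realpow)
  have 4: "ln (1 - x) = ln (1 - s) + ln (1 + s)"
  proof -
    have "1 - x = (1 - s) * (1 + s)" using s by (simp add: algebra_simps power2_eq_square)
    then show ?thesis using s by (simp add: ln_mult)
  qed
  show ?thesis
    unfolding 1 2 sums_unique[OF log_kernel_sums(1)[OF x], symmetric]
      sums_unique[OF log_kernel_sums(2)[OF x], symmetric] s_def[symmetric] 4 3
    using s by (simp add: field_simps)
qed

section \<open>Integral representation of multiple Hurwitz zeta values\<close>

definition moment :: "(real \<Rightarrow> ennreal) \<Rightarrow> real \<Rightarrow> ennreal" where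
  "moment w z = (\<integral>\<^sup>+x. ennreal (x powr z) * w x * indicator {0<..<1} x \<partial>lborel)"

text \<open>Formally -d/dz of \<open>moment w z\<close>. It is computed as an integral in its own
  right, so that no differentiation under the integral sign occurs.\<close>

definition log_moment :: "(real \<Rightarrow> ennreal) \<Rightarrow> real \<Rightarrow> ennreal" where
  "log_moment w z = (\<integral>\<^sup>+x. ennreal (- ln x * x powr z) * w x * indicator {0<..<1} x \<partial>lborel)"

definition tail_op :: "(real \<Rightarrow> ennreal) \<Rightarrow> real \<Rightarrow> ennreal" where
  "tail_op w x = ennreal (1 / x) * (\<integral>\<^sup>+y. w y * indicator {x<..<1} y \<partial>lborel)"

lemma indicator_Ioo_swap:
  "indicator {0<..<1} x * indicator {x<..<1} y = (indicator {0<..<1} y * indicator {0<..<y} x :: ennreal)"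
  for x y :: real
  by (auto simp: indicator_def)

lemma measurable_tail_integrand:
  fixes w :: "real \<Rightarrow> ennreal"
  assumes [measurable]: "w \<in> borel_measurable borel"
  shows "(\<lambda>p. w (snd p) * indicator {fst p<..<1} (snd p)) \<in> borel_measurable (lborel \<Otimes>\<^sub>M lborel)"
proof -
  have "(\<lambda>p. w (snd p) * indicator {fst p<..<1} (snd p))
      = (\<lambda>p. if fst p < snd p \<and> snd p < 1 then w (snd p) else 0)"
    by (auto simp: fun_eq_iff)
  also have "\<dots> \<in> borel_measurable (lborel \<Otimes>\<^sub>M lborel)" by measurable
  finally show ?thesis .
qed

lemma measurable_tail_op [measurable]:
  assumes [measurable]: "w \<in> borel_measurable borel"
  shows "tail_op w \<in> borel_measurable borel"
proof -
  have "(\<lambda>x. \<integral>\<^sup>+y. w y * indicator {x<..<1} y \<partial>lborel) \<in> borel_measurable lborel"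
    using measurable_tail_integrand[OF assms]
    by (intro lborel.borel_measurable_nn_integral) (simp add: case_prod_beta)
  then show ?thesis unfolding tail_op_def by measurable
qed

text \<open>Exchanging the integrals over the triangle 0 < x < y < 1 leaves an elementary integral
  \<open>G y\<close> over 0 < x < y.\<close>

lemma tail_op_Tonelli:
  fixes w :: "real \<Rightarrow> ennreal" and g :: "real \<Rightarrow> ennreal"
  assumes [measurable]: "w \<in> borel_measurable borel" "g \<in> borel_measurable borel"
    and G: "\<And>y. 0 < y \<Longrightarrow> y < 1 \<Longrightarrow> (\<integral>\<^sup>+x. g x * ennreal (1 / x) * indicator {0<..<y} x \<partial>lborel) = G y"
  shows "(\<integral>\<^sup>+x. g x * tail_op w x * indicator {0<..<1} x \<partial>lborel)
    = (\<integral>\<^sup>+y. G y * w y * indicator {0<..<1} y \<partial>lborel)"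
proof -
  have m [measurable]: "(\<lambda>p. w (snd p) * indicator {fst p<..<1} (snd p)) \<in> borel_measurable (lborel \<Otimes>\<^sub>M lborel)"
    by (rule measurable_tail_integrand) fact
  have [measurable]: "(\<lambda>y. w y * indicator {x<..<1} y) \<in> borel_measurable borel" for x by measurable
  have "(\<integral>\<^sup>+x. g x * tail_op w x * indicator {0<..<1} x \<partial>lborel)
      = (\<integral>\<^sup>+x. \<integral>\<^sup>+y. g x * ennreal (1 / x) * indicator {0<..<1} x * (w y * indicator {x<..<1} y) \<partial>lborel \<partial>lborel)"
    unfolding tail_op_def
    by (intro nn_integral_cong) (subst nn_integral_cmult, auto simp: mult_ac)
  also have "\<dots> = (\<integral>\<^sup>+y. \<integral>\<^sup>+x. g x * ennreal (1 / x) * indicator {0<..<1} x * (w y * indicator {x<..<1} y) \<partial>lborel \<partial>lborel)"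
    by (rule lborel_pair.Fubini'[symmetric]) (simp add: case_prod_beta)
  also have "\<dots> = (\<integral>\<^sup>+y. \<integral>\<^sup>+x. w y * indicator {0<..<1} y * (g x * ennreal (1 / x) * indicator {0<..<y} x) \<partial>lborel \<partial>lborel)"
  proof (intro nn_integral_cong)
    fix x y :: real
    have "g x * ennreal (1 / x) * indicator {0<..<1} x * (w y * indicator {x<..<1} y)
        = g x * ennreal (1 / x) * w y * (indicator {0<..<1} x * indicator {x<..<1} y)"
      by (simp only: mult_ac)
    also have "\<dots> = w y * indicator {0<..<1} y * (g x * ennreal (1 / x) * indicator {0<..<y} x)"
      unfolding indicator_Ioo_swap by (simp only: mult_ac)
    finally show "g x * ennreal (1 / x) * indicator {0<..<1} x * (w y * indicator {x<..<1} y)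
        = w y * indicator {0<..<1} y * (g x * ennreal (1 / x) * indicator {0<..<y} x)" .
  qed
  also have "\<dots> = (\<integral>\<^sup>+y. G y * w y * indicator {0<..<1} y \<partial>lborel)"
  proof (intro nn_integral_cong)
    fix y :: real
    have "(\<integral>\<^sup>+x. w y * indicator {0<..<1} y * (g x * ennreal (1 / x) * indicator {0<..<y} x) \<partial>lborel)
      = w y * indicator {0<..<1} y * (\<integral>\<^sup>+x. g x * ennreal (1 / x) * indicator {0<..<y} x \<partial>lborel)"
      by (rule nn_integral_cmult) measurable
    also have "\<dots> = G y * w y * indicator {0<..<1} y"
      using G[of y] by (cases "y \<in> {0<..<1}") (simp_all add: mult.commute)
    finally show "(\<integral>\<^sup>+x. w y * indicator {0<..<1} y * (g x * ennreal (1 / x) * indicator {0<..<y} x) \<partial>lborel)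
      = G y * w y * indicator {0<..<1} y" .
  qed
  finally show ?thesis .
qed

lemma nn_integral_powr_Ioo:
  fixes y z :: real
  assumes "0 < z" "0 < y"
  shows "(\<integral>\<^sup>+x. ennreal (x powr (z - 1)) * indicator {0<..<y} x \<partial>lborel) = ennreal (y powr z / z)"
proof (rule nn_integral_has_integral_lebesgue')
  show "((\<lambda>x. x powr (z - 1)) has_integral y powr z / z) {0<..<y}"
    using has_integral_powr_from_0[of "z - 1" y] assms by (simp add: has_integral_Icc_iff_Ioo)
qed simp

lemma nn_integral_log_powr_Ioo:
  fixes y z :: real
  assumes z: "0 < z" and y: "0 < y" "y \<le> 1"
  shows "(\<integral>\<^sup>+x. ennreal (- ln x * x powr (z - 1)) * indicator {0<..<y} x \<partial>lborel)
    = ennreal (- ln y * y powr z / z + y powr z / z\<^sup>2)"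
proof (rule nn_integral_has_integral_lebesgue')
  \<comment> \<open>The antiderivative, by parts. Since \<open>0 powr z = 0\<close>, also
    \<open>F 0 = 0\<close>, and continuity at 0 is the limit from the right.\<close>
  define F where "F x = - ln x * x powr z / z + x powr z / z\<^sup>2" for x :: real
  have "((\<lambda>x. - ln x * x powr (z - 1)) has_integral F y - F 0) {0..y}"
  proof (rule fundamental_theorem_of_calculus_interior)
    have "(F \<longlongrightarrow> 0) (at_right 0)" unfolding F_def using z by real_asymp
    moreover have "at 0 within {0..y} = at_right 0"
      using y by (intro at_within_nhd[of _ "{-1<..<y}"]) auto
    ultimately have "continuous (at 0 within {0..y}) F"
      by (simp add: continuous_within F_def)
    moreover have "continuous (at x within {0..y}) F" if "0 < x" for x
      unfolding F_def using that z by (intro continuous_intros) auto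
    ultimately show "continuous_on {0..y} F"
      unfolding continuous_on_eq_continuous_within by (metis atLeastAtMost_iff less_eq_real_def)
    show "(F has_vector_derivative - ln x * x powr (z - 1)) (at x)" if "x \<in> {0<..<y}" for x
    proof -
      have x: "x > 0" using that by simp
      have "(F has_real_derivative - ln x * x powr (z - 1)) (at x)"
        unfolding F_def using z x
        by (auto intro!: derivative_eq_intros simp: powr_diff field_simps power2_eq_square)
      then show ?thesis by (simp add: has_real_derivative_iff_has_vector_derivative)
    qed
  qed (use y in auto)
  then show "((\<lambda>x. - ln x * x powr (z - 1)) has_integral - ln y * y powr z / z + y powr z / z\<^sup>2) {0<..<y}"
    by (simp add: has_integral_Icc_iff_Ioo F_def)
  show "0 \<le> - ln x * x powr (z - 1)" if "x \<in> {0<..<y}" for x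
    using that y by (auto simp: mult_nonpos_nonneg)
qed

lemma moment_tail_op:
  assumes [measurable]: "w \<in> borel_measurable borel" and z: "0 < z"
  shows "moment (tail_op w) z = ennreal (1 / z) * moment w z"
proof -
  have "moment (tail_op w) z = (\<integral>\<^sup>+y. ennreal (y powr z / z) * w y * indicator {0<..<1} y \<partial>lborel)"
    unfolding moment_def
  proof (rule tail_op_Tonelli)
    fix y :: real assume y: "0 < y" "y < 1"
    have "(\<integral>\<^sup>+x. ennreal (x powr z) * ennreal (1 / x) * indicator {0<..<y} x \<partial>lborel)
      = (\<integral>\<^sup>+x. ennreal (x powr (z - 1)) * indicator {0<..<y} x \<partial>lborel)"
      by (intro nn_integral_cong) (auto simp: indicator_def ennreal_mult'[symmetric] powr_diff)
    then show "(\<integral>\<^sup>+x. ennreal (x powr z) * ennreal (1 / x) * indicator {0<..<y} x \<partial>lborel) = ennreal (y powr z / z)"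
      using nn_integral_powr_Ioo[OF z y(1)] by simp
  qed auto
  also have "\<dots> = (\<integral>\<^sup>+y. ennreal (1 / z) * (ennreal (y powr z) * w y * indicator {0<..<1} y) \<partial>lborel)"
    using z by (intro nn_integral_cong) (simp add: mult.assoc[symmetric] ennreal_mult'[symmetric])
  also have "\<dots> = ennreal (1 / z) * moment w z"
    unfolding moment_def by (rule nn_integral_cmult) measurable
  finally show ?thesis .
qed

text \<open>The product rule for -d/dz of \<open>moment w z / z\<close>.\<close>

lemma log_moment_tail_op:
  assumes [measurable]: "w \<in> borel_measurable borel" and z: "0 < z"
  shows "log_moment (tail_op w) z = ennreal (1 / z) * log_moment w z + ennreal (1 / z\<^sup>2) * moment w z"
proof -
  have "log_moment (tail_op w) z
      = (\<integral>\<^sup>+y. ennreal (- ln y * y powr z / z + y powr z / z\<^sup>2) * w y * indicator {0<..<1} y \<partial>lborel)"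
    unfolding log_moment_def
  proof (rule tail_op_Tonelli)
    fix y :: real assume y: "0 < y" "y < 1"
    have "(\<integral>\<^sup>+x. ennreal (- ln x * x powr z) * ennreal (1 / x) * indicator {0<..<y} x \<partial>lborel)
      = (\<integral>\<^sup>+x. ennreal (- ln x * x powr (z - 1)) * indicator {0<..<y} x \<partial>lborel)"
      by (intro nn_integral_cong) (auto simp: indicator_def ennreal_mult''[symmetric] powr_diff)
    then show "(\<integral>\<^sup>+x. ennreal (- ln x * x powr z) * ennreal (1 / x) * indicator {0<..<y} x \<partial>lborel)
        = ennreal (- ln y * y powr z / z + y powr z / z\<^sup>2)"
      using nn_integral_log_powr_Ioo[OF z y(1)] y by simp
  qed auto
  also have "\<dots> = (\<integral>\<^sup>+y. ennreal (1 / z) * (ennreal (- ln y * y powr z) * w y * indicator {0<..<1} y)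
      + ennreal (1 / z\<^sup>2) * (ennreal (y powr z) * w y * indicator {0<..<1} y) \<partial>lborel)"
  proof (intro nn_integral_cong)
    fix y :: real
    show "ennreal (- ln y * y powr z / z + y powr z / z\<^sup>2) * w y * indicator {0<..<1} y
      = ennreal (1 / z) * (ennreal (- ln y * y powr z) * w y * indicator {0<..<1} y)
      + ennreal (1 / z\<^sup>2) * (ennreal (y powr z) * w y * indicator {0<..<1} y)"
    proof (cases "y \<in> {0<..<1}")
      case True
      then have "0 \<le> - ln y * y powr z" by (auto simp: mult_nonpos_nonneg)
      moreover have "ennreal (A / z + B / z\<^sup>2) = ennreal (1 / z) * ennreal A + ennreal (1 / z\<^sup>2) * ennreal B"
        if "0 \<le> A" "0 \<le> B" for A B
        using z that by (simp add: ennreal_mult'[symmetric])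
      from this[OF _ powr_ge_zero] calculation have "ennreal (- ln y * y powr z / z + y powr z / z\<^sup>2)
        = ennreal (1 / z) * ennreal (- ln y * y powr z) + ennreal (1 / z\<^sup>2) * ennreal (y powr z)"
        by (simp only: simp_thms)
      then show ?thesis using True by (simp add: distrib_right mult.assoc)
    qed simp
  qed
  also have "\<dots> = ennreal (1 / z) * log_moment w z + ennreal (1 / z\<^sup>2) * moment w z"
    unfolding log_moment_def moment_def by (simp add: nn_integral_add nn_integral_cmult)
  finally show ?thesis .
qed

lemma measurable_tail_op_pow [measurable]:
  assumes "w \<in> borel_measurable borel"
  shows "(tail_op ^^ k) w \<in> borel_measurable borel"
  using assms by (induction k) auto

lemma moment_tail_op_pow:
  assumes "w \<in> borel_measurable borel" "0 < z"
  shows "moment ((tail_op ^^ k) w) z = ennreal (1 / z ^ k) * moment w z"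
proof (induction k)
  case (Suc k)
  then show ?case using assms
    by (simp add: moment_tail_op mult.assoc[symmetric] ennreal_mult'[symmetric])
qed simp

lemma log_moment_tail_op_pow:
  assumes "w \<in> borel_measurable borel" "0 < z"
  shows "log_moment ((tail_op ^^ k) w) z
    = ennreal (1 / z ^ k) * log_moment w z + ennreal (real k / z ^ Suc k) * moment w z"
proof (induction k)
  case (Suc k)
  have "log_moment ((tail_op ^^ Suc k) w) z
    = ennreal (1 / z) * (ennreal (1 / z ^ k) * log_moment w z + ennreal (real k / z ^ Suc k) * moment w z)
      + ennreal (1 / z\<^sup>2) * (ennreal (1 / z ^ k) * moment w z)"
    using assms by (simp only: funpow.simps comp_apply log_moment_tail_op measurable_tail_op_pow Suc moment_tail_op_pow)
  also have "\<dots> = ennreal (1 / z * (1 / z ^ k)) * log_moment w z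
      + ennreal (1 / z * (real k / z ^ Suc k) + 1 / z\<^sup>2 * (1 / z ^ k)) * moment w z"
    using assms by (simp add: distrib_left distrib_right mult.assoc[symmetric] ennreal_mult'[symmetric] add.assoc)
  also have "1 / z * (real k / z ^ Suc k) + 1 / z\<^sup>2 * (1 / z ^ k) = real (Suc k) / z ^ Suc (Suc k)"
    using assms by (simp add: add_divide_distrib power2_eq_square mult_ac)
  finally show ?case by (simp add: mult.commute)
qed simp

definition geom_op :: "(real \<Rightarrow> ennreal) \<Rightarrow> real \<Rightarrow> ennreal" where
  "geom_op w x = ennreal (x / (1 - x)) * w x"

lemma measurable_geom_op [measurable]:
  assumes [measurable]: "w \<in> borel_measurable borel"
  shows "geom_op w \<in> borel_measurable borel"
  unfolding geom_op_def by measurable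

text \<open>The geometric series for x/(1 - x), whose exponents start at 1. The factor
  \<open>c\<close> is 1 for moments and \<open>- ln x\<close> for logarithmic moments.\<close>

lemma geom_op_expand:
  assumes x: "x \<in> {0<..<1}" and c: "0 \<le> c"
  shows "ennreal (c * x powr z) * geom_op w x = (\<Sum>n. ennreal (c * x powr (z + real (Suc n))) * w x)"
proof -
  have "(\<lambda>n. c * x powr z * x * x ^ n) sums (c * x powr z * x * (1 / (1 - x)))"
    using x by (intro sums_mult geometric_sums) auto
  moreover have "c * x powr z * x * x ^ n = c * x powr (z + real (Suc n))" for n
    using x by (simp add: powr_add powr_realpow mult_ac flip: powr_realpow)
  ultimately have "(\<lambda>n. c * x powr (z + real (Suc n))) sums (c * x powr z * (x / (1 - x)))" by simp
  then have "(\<Sum>n. ennreal (c * x powr (z + real (Suc n)))) = ennreal (c * x powr z * (x / (1 - x)))"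
    using c by (intro suminf_ennreal_eq) auto
  moreover have "ennreal (c * x powr z * (x / (1 - x))) = ennreal (c * x powr z) * ennreal (x / (1 - x))"
    using x c by (intro ennreal_mult) auto
  ultimately show ?thesis unfolding geom_op_def ennreal_suminf_multc by (simp only: mult.assoc)
qed

lemma moment_geom_op:
  assumes [measurable]: "w \<in> borel_measurable borel"
  shows "moment (geom_op w) z = (\<Sum>n. moment w (z + real (Suc n)))"
proof -
  have "moment (geom_op w) z = (\<integral>\<^sup>+x. (\<Sum>n. ennreal (x powr (z + real (Suc n))) * w x * indicator {0<..<1} x) \<partial>lborel)"
    unfolding moment_def
  proof (intro nn_integral_cong)
    fix x :: real
    show "ennreal (x powr z) * geom_op w x * indicator {0<..<1} x = (\<Sum>n. ennreal (x powr (z + real (Suc n))) * w x * indicator {0<..<1} x)"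
    proof (cases "x \<in> {0<..<1}")
      case True
      then show ?thesis
        using geom_op_expand[OF True, of 1 z w] by (simp only: mult_1 indicator_simps(1)[OF True] mult_1_right)
    qed simp
  qed
  also have "\<dots> = (\<Sum>n. moment w (z + real (Suc n)))"
    unfolding moment_def by (rule nn_integral_suminf) measurable
  finally show ?thesis .
qed

lemma log_moment_geom_op:
  assumes [measurable]: "w \<in> borel_measurable borel"
  shows "log_moment (geom_op w) z = (\<Sum>n. log_moment w (z + real (Suc n)))"
proof -
  have "log_moment (geom_op w) z = (\<integral>\<^sup>+x. (\<Sum>n. ennreal (- ln x * x powr (z + real (Suc n))) * w x * indicator {0<..<1} x) \<partial>lborel)"
    unfolding log_moment_def
  proof (intro nn_integral_cong)
    fix x :: real
    show "ennreal (- ln x * x powr z) * geom_op w x * indicator {0<..<1} x = (\<Sum>n. ennreal (- ln x * x powr (z + real (Suc n))) * w x * indicator {0<..<1} x)"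
    proof (cases "x \<in> {0<..<1}")
      case True
      then show ?thesis
        using geom_op_expand[OF True, of "- ln x" z w] True by (simp only: indicator_simps(1)[OF True] mult_1_right) simp
    qed simp
  qed
  also have "\<dots> = (\<Sum>n. log_moment w (z + real (Suc n)))"
    unfolding log_moment_def by (rule nn_integral_suminf) measurable
  finally show ?thesis .
qed

text \<open>\<^const>\<open>tail_op\<close> divides the \<open>z\<close>-th moment by \<open>z\<close>, and \<^const>\<open>geom_op\<close> sums the moments at \<open>z + n\<close> over \<open>n \<ge> 1\<close>.
  The value at \<open>[]\<close> is arbitrary: the constant function 1 is the moment function of a point mass.\<close>

fun density_of :: "nat list \<Rightarrow> real \<Rightarrow> ennreal" where
  "density_of [] = (\<lambda>x. 0)"
| "density_of [k] = geom_op ((tail_op ^^ (k - 1)) (\<lambda>x. ennreal (1 / x)))"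
| "density_of (k # ks) = geom_op ((tail_op ^^ k) (density_of ks))"

lemma measurable_density_of [measurable]: "density_of ks \<in> borel_measurable borel"
  by (induction ks rule: density_of.induct) auto

text \<open>Formally 1/x is \<open>tail_op\<close> applied to a point mass at 1. This accounts for
  one of the k divisions by z, hence the \<open>k - 1\<close> in
  \<open>density_of [k]\<close>.\<close>

lemma moment_inverse: "0 < z \<Longrightarrow> moment (\<lambda>x. ennreal (1 / x)) z = ennreal (1 / z)"
proof -
  assume z: "0 < z"
  have "moment (\<lambda>x. ennreal (1 / x)) z = (\<integral>\<^sup>+x. ennreal (x powr (z - 1)) * indicator {0<..<1} x \<partial>lborel)"
    unfolding moment_def by (intro nn_integral_cong) (auto simp: indicator_def ennreal_mult'[symmetric] powr_diff)
  then show ?thesis using nn_integral_powr_Ioo[OF z, of 1] by simp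
qed

lemma log_moment_inverse: "0 < z \<Longrightarrow> log_moment (\<lambda>x. ennreal (1 / x)) z = ennreal (1 / z\<^sup>2)"
proof -
  assume z: "0 < z"
  have "log_moment (\<lambda>x. ennreal (1 / x)) z = (\<integral>\<^sup>+x. ennreal (- ln x * x powr (z - 1)) * indicator {0<..<1} x \<partial>lborel)"
    unfolding log_moment_def by (intro nn_integral_cong) (auto simp: indicator_def ennreal_mult''[symmetric] powr_diff)
  then show ?thesis using nn_integral_log_powr_Ioo[OF z, of 1] by simp
qed

lemma moment_density_of:
  assumes "is_index ks" "ks \<noteq> []" "-1 < z"
  shows "moment (density_of ks) z = hurwitz ks z"
  using assms
proof (induction ks arbitrary: z rule: density_of.induct)
  case (2 k)
  have "moment (density_of [k]) z = (\<Sum>n. ennreal (1 / (z + real (Suc n)) ^ (k - 1)) * ennreal (1 / (z + real (Suc n))))"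
    using 2 by (simp add: moment_geom_op moment_tail_op_pow moment_inverse)
  also have "\<dots> = (\<Sum>n. ennreal (1 / (z + real (Suc n)) ^ k))"
  proof (intro suminf_cong)
    fix n
    have "(z + real (Suc n)) ^ k = (z + real (Suc n)) ^ (k - 1) * (z + real (Suc n))"
      using 2 by (simp add: is_index_def power_eq_if)
    then show "ennreal (1 / (z + real (Suc n)) ^ (k - 1)) * ennreal (1 / (z + real (Suc n))) = ennreal (1 / (z + real (Suc n)) ^ k)"
      using 2 by (simp add: ennreal_mult'[symmetric])
  qed
  finally show ?case by simp
next
  case (3 k l ks)
  have "is_index (l # ks)" using "3.prems" by (simp add: is_index_def)
  have "moment (density_of (k # l # ks)) z
    = (\<Sum>n. ennreal (1 / (z + real (Suc n)) ^ k) * moment (density_of (l # ks)) (z + real (Suc n)))"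
    using "3.prems" by (simp add: moment_geom_op moment_tail_op_pow)
  also have "\<dots> = hurwitz (k # l # ks) z"
    using "3.prems" \<open>is_index (l # ks)\<close> unfolding hurwitz.simps(2)[of k]
    by (intro suminf_cong arg_cong2[of _ _ _ _ "(*)"] refl "3.IH") auto
  finally show ?case .
qed simp

text \<open>The termwise -d/dz of \<open>hurwitz\<close> by the Leibniz rule. It enters as the value
  of a logarithmic moment, and no derivative is taken.\<close>

fun hurwitz_deriv :: "nat list \<Rightarrow> real \<Rightarrow> ennreal" where
  "hurwitz_deriv [] z = 0"
| "hurwitz_deriv (k # ks) z = (\<Sum>n. ennreal (1 / (z + real (Suc n)) ^ k) * hurwitz_deriv ks (z + real (Suc n))
      + ennreal (real k / (z + real (Suc n)) ^ Suc k) * hurwitz ks (z + real (Suc n)))"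

lemma log_moment_density_of:
  assumes "is_index ks" "ks \<noteq> []" "-1 < z"
  shows "log_moment (density_of ks) z = hurwitz_deriv ks z"
  using assms
proof (induction ks arbitrary: z rule: density_of.induct)
  case (2 k)
  have "log_moment (density_of [k]) z = (\<Sum>n. ennreal (1 / (z + real (Suc n)) ^ (k - 1)) * ennreal (1 / (z + real (Suc n))\<^sup>2)
      + ennreal (real (k - 1) / (z + real (Suc n)) ^ Suc (k - 1)) * ennreal (1 / (z + real (Suc n))))"
    using 2 by (simp add: log_moment_geom_op log_moment_tail_op_pow moment_inverse log_moment_inverse del: power_Suc)
  also have "\<dots> = (\<Sum>n. ennreal (real k / (z + real (Suc n)) ^ Suc k))"
  proof (intro suminf_cong)
    fix n
    define u where "u = z + real (Suc n)"
    have u: "u > 0" using 2 by (simp add: u_def)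
    obtain j where k: "k = Suc j" using 2 by (cases k) (auto simp: is_index_def)
    have "1 / u ^ j * (1 / u\<^sup>2) + real j / u ^ Suc j * (1 / u) = real (Suc j) / u ^ Suc (Suc j)"
      using u by (simp add: field_simps power2_eq_square)
    then show "ennreal (1 / (z + real (Suc n)) ^ (k - 1)) * ennreal (1 / (z + real (Suc n))\<^sup>2)
      + ennreal (real (k - 1) / (z + real (Suc n)) ^ Suc (k - 1)) * ennreal (1 / (z + real (Suc n)))
      = ennreal (real k / (z + real (Suc n)) ^ Suc k)"
      using u unfolding u_def[symmetric] k
      by (simp add: ennreal_mult'[symmetric] ennreal_plus[symmetric] del: ennreal_plus)
  qed
  finally show ?case by simp
next
  case (3 k l ks)
  have i: "is_index (l # ks)" using "3.prems" by (simp add: is_index_def)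
  have "log_moment (density_of (k # l # ks)) z
    = (\<Sum>n. ennreal (1 / (z + real (Suc n)) ^ k) * log_moment (density_of (l # ks)) (z + real (Suc n))
      + ennreal (real k / (z + real (Suc n)) ^ Suc k) * moment (density_of (l # ks)) (z + real (Suc n)))"
    using "3.prems" by (simp add: log_moment_geom_op log_moment_tail_op_pow)
  also have "\<dots> = hurwitz_deriv (k # l # ks) z"
    using "3.prems" i unfolding hurwitz_deriv.simps(2)[of k]
    by (intro suminf_cong arg_cong2[of _ _ _ _ "(*)"] arg_cong2[of _ _ _ _ "(+)"] refl "3.IH" moment_density_of) auto
  finally show ?case .
qed simp

section \<open>Iterated differences and iterated averages\<close>

text \<open>The sum of (-1)^i (n choose i) f(j + i). The offset \<open>j\<close> makes the recursion
  possible; if f(j) is the j-th moment of w, the result is the integral of (1 - x)^n x^j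
  w(x).\<close>

fun alt_diff :: "nat \<Rightarrow> (nat \<Rightarrow> real) \<Rightarrow> nat \<Rightarrow> real" where
  "alt_diff 0 f j = f j"
| "alt_diff (Suc n) f j = alt_diff n f j - alt_diff n f (Suc j)"

lemma alt_diff_shift: "alt_diff n (\<lambda>i. f (Suc i)) j = alt_diff n f (Suc j)"
  by (induction n arbitrary: j) auto

lemma alt_diff_diff: "alt_diff n (\<lambda>i. f i - g i) j = alt_diff n f j - alt_diff n g j"
  by (induction n arbitrary: j) auto

lemma alt_diff_Suc_diff: "alt_diff (Suc n) f j = alt_diff n (\<lambda>i. f i - f (Suc i)) j"
  by (simp add: alt_diff_diff alt_diff_shift)

text \<open>Leibniz rule for differences. At j = 0 the right-hand side is an increment of n -> (n +
  1) \<open>alt_diff n u 0\<close>, so it telescopes on summation: dividing a sequence by i + 1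
  averages its differences.\<close>

lemma alt_diff_times_id:
  "alt_diff n (\<lambda>i. real (Suc i) * u i) j = real (Suc (j + n)) * alt_diff n u j - real n * alt_diff (n - 1) u j"
proof (induction n arbitrary: j)
  case (Suc n)
  show ?case
  proof (cases n)
    case (Suc m)
    then show ?thesis using Suc.IH[of j] Suc.IH[of "Suc j"] by (simp add: algebra_simps)
  qed (simp add: algebra_simps)
qed simp

definition avg :: "(nat \<Rightarrow> real) \<Rightarrow> nat \<Rightarrow> real" where
  "avg u N = (\<Sum>n\<in>{0<..N}. u n) / real N"

lemma avg_pow_Suc: "(avg ^^ Suc k) u N = (\<Sum>n\<in>{0<..N}. (avg ^^ k) u n) / real N"
  by (simp only: funpow.simps comp_apply) (rule avg_def)

lemma avg_cong: "(\<And>n. n > 0 \<Longrightarrow> u n = v n) \<Longrightarrow> avg u N = avg v N"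
  by (simp add: avg_def)

lemma avg_pow_cong:
  assumes "\<And>n. n > 0 \<Longrightarrow> u n = v n" "N > 0"
  shows "(avg ^^ k) u N = (avg ^^ k) v N"
  using assms by (induction k arbitrary: N) (auto simp: avg_pow_Suc simp del: funpow.simps(2))

lemma avg_pow_diff: "(avg ^^ k) (\<lambda>n. u n - v n) N = (avg ^^ k) u N - (avg ^^ k) v N"
proof (induction k arbitrary: N)
  case (Suc k)
  then have "(avg ^^ k) (\<lambda>n. u n - v n) = (\<lambda>N. (avg ^^ k) u N - (avg ^^ k) v N)" by blast
  then show ?case by (simp add: avg_pow_Suc sum_subtractf diff_divide_distrib del: funpow.simps)
qed simp

lemma avg_pow_cmult: "(avg ^^ k) (\<lambda>n. c * u n) N = c * (avg ^^ k) u N"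
proof (induction k arbitrary: N)
  case (Suc k)
  then have "(avg ^^ k) (\<lambda>n. c * u n) = (\<lambda>N. c * (avg ^^ k) u N)" by blast
  then show ?case by (simp add: avg_pow_Suc sum_distrib_left del: funpow.simps)
qed simp

lemma avg_pow_sum: "(avg ^^ k) (\<lambda>n. \<Sum>j\<in>A. u j n) N = (\<Sum>j\<in>A. (avg ^^ k) (u j) N)"
proof (induction k arbitrary: N)
  case (Suc k)
  then have "(avg ^^ k) (\<lambda>n. \<Sum>j\<in>A. u j n) = (\<lambda>N. \<Sum>j\<in>A. (avg ^^ k) (u j) N)" by blast
  then show ?case by (simp add: avg_pow_Suc sum_divide_distrib del: funpow.simps) (rule sum.swap)
qed simp

text \<open>Splits according to whether the smallest index equals 1. Finiteness is needed to leave
  \<open>ennreal\<close>.\<close>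

lemma hurwitz_real_diff:
  assumes "convergent_index (rev (k # ks))" "-1/2 \<le> z"
  shows "hurwitz_real (k # ks) z = hurwitz_real ks (z + 1) / (z + 1) ^ k + hurwitz_real (k # ks) (z + 1)"
proof -
  have fin: "hurwitz (k # ks) z < top" "hurwitz (k # ks) (z + 1) < top"
    using assms by (intro hurwitz_less_top; simp)+
  have z1: "0 < z + 1" using assms by simp
  let ?t = "\<lambda>n. ennreal (1 / (z + real (Suc n)) ^ k) * hurwitz ks (z + real (Suc n))"
  have "hurwitz (k # ks) z = ?t 0 + (\<Sum>n. ?t (Suc n))"
    using suminf_offset[of ?t 1] by simp
  also have "(\<Sum>n. ?t (Suc n)) = hurwitz (k # ks) (z + 1)"
    by (simp add: add_ac)
  finally have eq: "hurwitz (k # ks) z = ?t 0 + hurwitz (k # ks) (z + 1)" .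
  then have "?t 0 < top" using fin by (metis ennreal_add_less_top)
  then have "enn2real (hurwitz (k # ks) z) = enn2real (?t 0) + enn2real (hurwitz (k # ks) (z + 1))"
    unfolding eq using fin by (intro enn2real_plus) auto
  then show ?thesis using z1 by (simp add: hurwitz_real_def enn2real_mult add.commute)
qed

lemma convergent_index_tl:
  assumes "convergent_index (rev (k # ks))"
  shows "convergent_index (rev ks)" "0 < k"
  using assms by (cases ks rule: rev_cases; auto simp: convergent_index_def is_index_def)+

text \<open>One difference replaces f for \<open>k # ks\<close> by f for \<open>ks\<close> at i + 1,
  divided by (i + 1)^k. Each of the k divisions averages the differences; the first average is of a
  telescoping sum and evaluates to the bracket over n, so k - 1 averages remain.\<close>

lemma alt_diff_hurwitz_real_Cons:
  assumes "convergent_index (rev (k # ks))" "N > 0"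
  shows "alt_diff N (\<lambda>i. hurwitz_real (k # ks) (real i)) 0
    = (avg ^^ (k - 1)) (\<lambda>n. (hurwitz_real ks 0 - alt_diff n (\<lambda>i. hurwitz_real ks (real i)) 0) / real n) N"
proof -
  let ?f = "\<lambda>i. hurwitz_real ks (real i)"
  define e where "e a n = alt_diff n (\<lambda>i. ?f (Suc i) / real (Suc i) ^ a) 0" for a n
  \<comment> \<open>Telescoping of \<open>alt_diff_times_id\<close>; its term with
    \<open>n - 1\<close> at n = 0 has the coefficient 0.\<close>
  have step: "real (Suc n) * e (Suc a) n = (\<Sum>j\<le>n. e a j)" for a n
  proof -
    have "e a n = real (Suc n) * e (Suc a) n - real n * e (Suc a) (n - 1)" for n
    proof -
      have "(\<lambda>i. ?f (Suc i) / real (Suc i) ^ a) = (\<lambda>i. real (Suc i) * (?f (Suc i) / real (Suc i) ^ Suc a))"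
        by (simp add: fun_eq_iff del: of_nat_Suc)
      then show ?thesis
        unfolding e_def using alt_diff_times_id[of n "\<lambda>i. ?f (Suc i) / real (Suc i) ^ Suc a" 0]
        by (simp only: add_0)
    qed
    then show ?thesis by (induction n) auto
  qed
  have e1: "e (Suc a) n = avg (\<lambda>n. e a (n - 1)) (Suc n)" for a n
    using step[of n a] sum_greaterThan0_atMost[of "\<lambda>n. e a (n - 1)" "Suc n"]
    by (simp add: avg_def field_simps lessThan_Suc_atMost)
  have e0: "(\<Sum>j\<le>n. e 0 j) = ?f 0 - alt_diff (Suc n) ?f 0" for n
  proof -
    have "e 0 j = alt_diff j ?f 0 - alt_diff (Suc j) ?f 0" for j
      using alt_diff_shift[of j ?f 0] by (simp add: e_def)
    then show ?thesis by (induction n) auto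
  qed
  have ek: "e (Suc a) (N - 1) = (avg ^^ a) (\<lambda>n. (?f 0 - alt_diff n ?f 0) / real n) N" if "N > 0" for a N
    using that
  proof (induction a arbitrary: N)
    case 0
    then show ?case using step[of "N - 1" 0] e0[of "N - 1"] by (simp add: field_simps)
  next
    case (Suc a)
    have "e (Suc (Suc a)) (N - 1) = avg (\<lambda>n. e (Suc a) (n - 1)) N"
      using e1[of "Suc a" "N - 1"] Suc.prems by simp
    also have "\<dots> = avg ((avg ^^ a) (\<lambda>n. (?f 0 - alt_diff n ?f 0) / real n)) N"
      using Suc.IH by (intro avg_cong) auto
    finally show ?case by simp
  qed
  have "hurwitz_real (k # ks) (real i) - hurwitz_real (k # ks) (real (Suc i)) = ?f (Suc i) / real (Suc i) ^ k" for i
    using hurwitz_real_diff[OF assms(1), of "real i"] by (simp add: add.commute)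
  then have "alt_diff N (\<lambda>i. hurwitz_real (k # ks) (real i)) 0 = e k (N - 1)"
    using assms(2) alt_diff_Suc_diff[of "N - 1" "\<lambda>i. hurwitz_real (k # ks) (real i)" 0] by (simp add: e_def)
  then show ?thesis using ek[OF assms(2), of "k - 1"] convergent_index_tl(2)[OF assms(1)] by simp
qed

lemma alt_diff_const: "alt_diff (Suc n) (\<lambda>_. c) j = 0"
  by (induction n arbitrary: j) auto

lemma sum_from_1_Suc: "(\<Sum>j=1..Suc L. g j) = g 1 + (\<Sum>j=1..L. g (Suc j))"
  for g :: "nat \<Rightarrow> real"
  by (induction L) (auto simp: algebra_simps)

text \<open>What iterating \<open>alt_diff_hurwitz_real_Cons\<close> produces: an entry k stands for
  one division by n followed by k - 1 averages.\<close>

fun nested_avg :: "nat list \<Rightarrow> nat \<Rightarrow> real" where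
  "nested_avg [] = (\<lambda>n. 1)"
| "nested_avg (k # ks) = (avg ^^ (k - 1)) (\<lambda>n. nested_avg ks n / real n)"

text \<open>Each entry peeled off leaves a constant, the zeta value of the remaining entries, minus
  the differences for those entries. Hence the alternating sum in which the suffix gives a zeta
  value and the prefix an iterated average. For the empty index f = 1, and its differences
  vanish.\<close>

lemma alt_diff_hurwitz_real:
  assumes "convergent_index (rev ks)" "N > 0"
  shows "alt_diff N (\<lambda>i. hurwitz_real ks (real i)) 0
    = (\<Sum>j=1..length ks. (-1) ^ (j - 1) * hurwitz_real (drop j ks) 0 * nested_avg (take j ks) N)"
  using assms
proof (induction ks arbitrary: N)
  case Nil
  then show ?case using alt_diff_const[of "N - 1" 1 0] by simp
next
  case (Cons k ks)
  note c = convergent_index_tl[OF Cons.prems(1)]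
  let ?t = "\<lambda>j n. (-1) ^ (j - 1) * hurwitz_real (drop j ks) 0 * (nested_avg (take j ks) n / real n)"
  have "alt_diff N (\<lambda>i. hurwitz_real (k # ks) (real i)) 0
    = (avg ^^ (k - 1)) (\<lambda>n. hurwitz_real ks 0 * (1 / real n) - (\<Sum>j=1..length ks. ?t j n)) N"
    unfolding alt_diff_hurwitz_real_Cons[OF Cons.prems]
    using Cons.IH[OF c(1)] Cons.prems(2)
    by (intro avg_pow_cong) (auto simp: diff_divide_distrib sum_divide_distrib)
  also have "\<dots> = hurwitz_real ks 0 * nested_avg [k] N
      - (\<Sum>j=1..length ks. (-1) ^ (j - 1) * hurwitz_real (drop j ks) 0 * nested_avg (k # take j ks) N)"
    by (simp only: avg_pow_diff avg_pow_cmult avg_pow_sum nested_avg.simps)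
  also have "\<dots> = (\<Sum>j=1..length (k # ks). (-1) ^ (j - 1) * hurwitz_real (drop j (k # ks)) 0 * nested_avg (take j (k # ks)) N)"
  proof -
    have "(\<Sum>j=1..Suc (length ks). (-1) ^ (j - 1) * hurwitz_real (drop j (k # ks)) 0 * nested_avg (take j (k # ks)) N)
      = hurwitz_real ks 0 * nested_avg [k] N + (\<Sum>j=1..length ks. (-1) ^ j * hurwitz_real (drop j ks) 0 * nested_avg (k # take j ks) N)"
      by (simp only: sum_from_1_Suc) simp
    also have "(\<Sum>j=1..length ks. (-1) ^ j * hurwitz_real (drop j ks) 0 * nested_avg (k # take j ks) N)
      = - (\<Sum>j=1..length ks. (-1) ^ (j - 1) * hurwitz_real (drop j ks) 0 * nested_avg (k # take j ks) N)"
      unfolding sum_negf[symmetric]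
      by (intro sum.cong refl) (auto simp: power_eq_if simp del: nested_avg.simps)
    finally show ?thesis by simp
  qed
  finally show ?case .
qed

text \<open>For k = 1 there are no averages, so prefixing a 1 satisfies b_r / N = h_r / N - b_(r+1).
  Iterating this absorbs 1/N^r; the terms h left behind give the sums with
  \<open>zeta_B_star [j, 1]\<close>.\<close>

lemma alt_diff_hurwitz_real_replicate:
  assumes "convergent_index (rev ks)" "ks \<noteq> []" "N > 0"
  shows "alt_diff N (\<lambda>i. hurwitz_real ks (real i)) 0 / real N ^ r
    = (\<Sum>j=1..r. (-1) ^ (r - j) * hurwitz_real (replicate (r - j) 1 @ ks) 0 / real N ^ j)
      + (-1) ^ r * alt_diff N (\<lambda>i. hurwitz_real (replicate r 1 @ ks) (real i)) 0"
proof (induction r)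
  case (Suc r)
  have c: "convergent_index (rev (1 # replicate r 1 @ ks))"
    using assms by (cases ks rule: rev_cases) (auto simp: convergent_index_def is_index_def)
  let ?b = "\<lambda>r. alt_diff N (\<lambda>i. hurwitz_real (replicate r 1 @ ks) (real i)) 0"
  let ?h = "\<lambda>r. hurwitz_real (replicate r 1 @ ks) 0"
  have b: "?b r / real N = ?h r / real N - ?b (Suc r)"
    using alt_diff_hurwitz_real_Cons[OF c assms(3)] by (simp add: diff_divide_distrib)
  have "alt_diff N (\<lambda>i. hurwitz_real ks (real i)) 0 / real N ^ Suc r
      = ((\<Sum>j=1..r. (-1) ^ (r - j) * ?h (r - j) / real N ^ j) + (-1) ^ r * ?b r) / real N"
    unfolding Suc.IH[symmetric] by (simp add: mult.commute)
  also have "\<dots> = (\<Sum>j=1..r. (-1) ^ (r - j) * ?h (r - j) / real N ^ Suc j) + (-1) ^ r * (?b r / real N)"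
    by (simp add: add_divide_distrib sum_divide_distrib mult.commute)
  also have "\<dots> = (\<Sum>j=1..Suc r. (-1) ^ (Suc r - j) * ?h (Suc r - j) / real N ^ j) + (-1) ^ Suc r * ?b (Suc r)"
    unfolding b sum_from_1_Suc by (simp add: algebra_simps)
  finally show ?case .
qed simp

section \<open>Integration of the generating function\<close>

definition binomial_moment :: "(real \<Rightarrow> ennreal) \<Rightarrow> nat \<Rightarrow> nat \<Rightarrow> ennreal" where
  "binomial_moment w n j = (\<integral>\<^sup>+x. ennreal ((1 - x) ^ n * x ^ j) * w x * indicator {0<..<1} x \<partial>lborel)"

lemma binomial_moment_Suc:
  assumes [measurable]: "w \<in> borel_measurable borel"
  shows "binomial_moment w (Suc n) j + binomial_moment w n (Suc j) = binomial_moment w n j"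
proof -
  have "binomial_moment w (Suc n) j + binomial_moment w n (Suc j)
    = (\<integral>\<^sup>+x. ennreal ((1 - x) ^ Suc n * x ^ j) * w x * indicator {0<..<1} x
        + ennreal ((1 - x) ^ n * x ^ Suc j) * w x * indicator {0<..<1} x \<partial>lborel)"
    unfolding binomial_moment_def by (rule nn_integral_add[symmetric]) measurable
  also have "\<dots> = binomial_moment w n j"
    unfolding binomial_moment_def
  proof (intro nn_integral_cong)
    fix x :: real
    show "ennreal ((1 - x) ^ Suc n * x ^ j) * w x * indicator {0<..<1} x
        + ennreal ((1 - x) ^ n * x ^ Suc j) * w x * indicator {0<..<1} x
        = ennreal ((1 - x) ^ n * x ^ j) * w x * indicator {0<..<1} x"
    proof (cases "x \<in> {0<..<1}")
      case True
      have "ennreal ((1 - x) ^ Suc n * x ^ j) + ennreal ((1 - x) ^ n * x ^ Suc j)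
        = ennreal ((1 - x) ^ Suc n * x ^ j + (1 - x) ^ n * x ^ Suc j)"
        using True by (intro ennreal_plus[symmetric]) auto
      also have "(1 - x) ^ Suc n * x ^ j + (1 - x) ^ n * x ^ Suc j = (1 - x) ^ n * x ^ j"
        by (simp add: algebra_simps)
      finally show ?thesis by (simp only: distrib_right[symmetric])
    qed simp
  qed
  finally show ?thesis .
qed

text \<open>Both sides obey the same recursion in n. Nonnegativity is part of the induction because
  subtraction in \<open>ennreal\<close> is truncated; it is the complete monotonicity of a moment
  sequence.\<close>

lemma binomial_moment_eq_alt_diff:
  assumes [measurable]: "w \<in> borel_measurable borel"
    and f: "\<And>j. binomial_moment w 0 j = ennreal (f j)" "\<And>j. 0 \<le> f j"
  shows "binomial_moment w n j = ennreal (alt_diff n f j) \<and> 0 \<le> alt_diff n f j"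
proof (induction n arbitrary: j)
  case (Suc n)
  have eq: "binomial_moment w (Suc n) j + ennreal (alt_diff n f (Suc j)) = ennreal (alt_diff n f j)"
    using binomial_moment_Suc[OF assms(1), of n j] Suc by simp
  then have "ennreal (alt_diff n f (Suc j)) \<le> ennreal (alt_diff n f j)"
    by (metis le_add_same_cancel2 zero_le add.commute le_iff_add)
  then have le: "alt_diff n f (Suc j) \<le> alt_diff n f j" using Suc by (simp add: ennreal_le_iff)
  have "binomial_moment w (Suc n) j = ennreal (alt_diff n f j) - ennreal (alt_diff n f (Suc j))"
    unfolding eq[symmetric] by simp
  then show ?case using le Suc by (simp add: ennreal_minus)
qed (use f in auto)

lemma binomial_moment_0: "binomial_moment w 0 j = moment w (real j)"
  unfolding binomial_moment_def moment_def
  by (intro nn_integral_cong) (auto simp: indicator_def powr_realpow)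

text \<open>The factor \<open>x ^ 0\<close> gives the summands the shape of
  \<open>binomial_moment w (Suc n) 0\<close>.\<close>

lemma kernel_identity_ennreal:
  assumes "x \<in> {0<..<1}"
  shows "(\<Sum>n. ennreal (central (Suc n) * harm (Suc n)) * ennreal ((1 - x) ^ Suc n * x ^ 0))
      + ennreal (2 * ln 2) * ennreal (x powr (-1/2))
      + (\<Sum>k. ennreal (1 / real (Suc k)) * ennreal (x powr (real k + 1/2)))
     = ennreal (- ln x * x powr (-1/2)) + (\<Sum>k. ennreal (1 / (real k + 1/2)) * ennreal (x powr real k))"
proof -
  have x: "0 < x" "x < 1" using assms by auto
  have l: "0 \<le> - ln x * x powr (-1/2)" using x by (auto simp: mult_nonpos_nonneg)
  have s1: "summable (\<lambda>n. central (Suc n) * harm (Suc n) * (1 - x) ^ Suc n)"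
    using summable_central_harm[of "1 - x"] x
    by (subst summable_Suc_iff[of "\<lambda>n. central n * harm n * (1 - x) ^ n"]) auto
  note s2 = sums_summable[OF log_kernel_sums(1)[OF x]]
  note s3 = sums_summable[OF log_kernel_sums(2)[OF x]]
  have "(\<Sum>n. ennreal (central (Suc n) * harm (Suc n)) * ennreal ((1 - x) ^ Suc n * x ^ 0))
      = ennreal (\<Sum>n. central (Suc n) * harm (Suc n) * (1 - x) ^ Suc n)"
  proof -
    have "(\<Sum>n. ennreal (central (Suc n) * harm (Suc n)) * ennreal ((1 - x) ^ Suc n * x ^ 0))
      = (\<Sum>n. ennreal (central (Suc n) * harm (Suc n) * (1 - x) ^ Suc n))"
      by (simp only: power_0 mult_1_right ennreal_mult'[symmetric] central_nonneg harm_nonneg mult_nonneg_nonneg)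
    then show ?thesis using x s1
      by (simp only:) (intro suminf_ennreal2, auto simp: harm_nonneg)
  qed
  moreover have "(\<Sum>k. ennreal (1 / real (Suc k)) * ennreal (x powr (real k + 1/2)))
      = ennreal (\<Sum>k. x powr (real k + 1/2) / real (Suc k))"
    using s3 by (subst suminf_ennreal2[symmetric]) (auto simp: ennreal_mult'[symmetric])
  moreover have "(\<Sum>k. ennreal (1 / (real k + 1/2)) * ennreal (x powr real k))
      = ennreal (\<Sum>k. x ^ k / (real k + 1/2))"
    using s2 x by (subst suminf_ennreal2[symmetric]) (auto simp: ennreal_mult'[symmetric] powr_realpow)
  moreover have "ennreal (2 * ln 2) * ennreal (x powr (-1/2)) = ennreal (2 * ln 2 * x powr (-1/2))"
    by (simp add: ennreal_mult')
  moreover have "0 \<le> (\<Sum>n. central (Suc n) * harm (Suc n) * (1 - x) ^ Suc n)"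
    using s1 x by (intro suminf_nonneg) (auto simp: harm_nonneg)
  moreover have "0 \<le> (\<Sum>k. x powr (real k + 1/2) / real (Suc k))" using s3 by (intro suminf_nonneg) auto
  moreover have "0 \<le> (\<Sum>k. x ^ k / (real k + 1/2))" using s2 x by (intro suminf_nonneg) auto
  moreover have "ennreal A + ennreal B + ennreal C = ennreal D + ennreal E"
    if "A + B + C = D + E" "0 \<le> A" "0 \<le> B" "0 \<le> C" "0 \<le> D" "0 \<le> E" for A B C D E
    using that by (simp add: ennreal_plus[symmetric] del: ennreal_plus)
  ultimately show ?thesis
    using kernel_identity[OF x] l by (simp only:) simp
qed

lemma nn_integral_weighted_series:
  fixes w :: "real \<Rightarrow> ennreal"
  assumes [measurable]: "w \<in> borel_measurable borel" "\<And>n. f n \<in> borel_measurable borel"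
  shows "(\<integral>\<^sup>+x. (\<Sum>n. a n * f n x) * w x * indicator {0<..<1} x \<partial>lborel)
    = (\<Sum>n. a n * (\<integral>\<^sup>+x. f n x * w x * indicator {0<..<1} x \<partial>lborel))"
proof -
  have "(\<integral>\<^sup>+x. (\<Sum>n. a n * f n x) * w x * indicator {0<..<1} x \<partial>lborel)
    = (\<integral>\<^sup>+x. (\<Sum>n. a n * (f n x * w x * indicator {0<..<1} x)) \<partial>lborel)"
    by (simp only: ennreal_suminf_multc[symmetric] mult.assoc)
  also have "\<dots> = (\<Sum>n. \<integral>\<^sup>+x. a n * (f n x * w x * indicator {0<..<1} x) \<partial>lborel)"
    by (rule nn_integral_suminf) measurable
  also have "\<dots> = (\<Sum>n. a n * (\<integral>\<^sup>+x. f n x * w x * indicator {0<..<1} x \<partial>lborel))"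
    by (intro suminf_cong nn_integral_cmult) measurable
  finally show ?thesis .
qed

text \<open>Termwise integration of nonnegative series; the equation also holds when both sides are
  infinite.\<close>

lemma integrated_kernel_identity:
  assumes [measurable]: "w \<in> borel_measurable borel"
  shows "(\<Sum>n. ennreal (central (Suc n) * harm (Suc n)) * binomial_moment w (Suc n) 0)
      + ennreal (2 * ln 2) * moment w (-1/2)
      + (\<Sum>k. ennreal (1 / real (Suc k)) * moment w (real k + 1/2))
     = log_moment w (-1/2) + (\<Sum>k. ennreal (1 / (real k + 1/2)) * moment w (real k))"
proof -
  let ?I = "\<lambda>x. indicator {0<..<1} x :: ennreal"
  let ?A = "\<lambda>x. (\<Sum>n. ennreal (central (Suc n) * harm (Suc n)) * ennreal ((1 - x) ^ Suc n * x ^ 0))"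
  let ?C = "\<lambda>x. (\<Sum>k. ennreal (1 / real (Suc k)) * ennreal (x powr (real k + 1/2)))"
  let ?E = "\<lambda>x. (\<Sum>k. ennreal (1 / (real k + 1/2)) * ennreal (x powr real k))"
  have B: "ennreal (2 * ln 2) * moment w (-1/2) = (\<integral>\<^sup>+x. ennreal (2 * ln 2) * ennreal (x powr (-1/2)) * w x * ?I x \<partial>lborel)"
    unfolding moment_def by (subst nn_integral_cmult[symmetric]) (auto simp: mult.assoc)
  have "(\<Sum>n. ennreal (central (Suc n) * harm (Suc n)) * binomial_moment w (Suc n) 0)
      + ennreal (2 * ln 2) * moment w (-1/2)
      + (\<Sum>k. ennreal (1 / real (Suc k)) * moment w (real k + 1/2))
      = (\<integral>\<^sup>+x. ?A x * w x * ?I x \<partial>lborel) + (\<integral>\<^sup>+x. ennreal (2 * ln 2) * ennreal (x powr (-1/2)) * w x * ?I x \<partial>lborel)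
        + (\<integral>\<^sup>+x. ?C x * w x * ?I x \<partial>lborel)"
    unfolding B unfolding binomial_moment_def moment_def
    by (subst (1 2) nn_integral_weighted_series) (auto simp del: power_Suc)
  also have "\<dots> = (\<integral>\<^sup>+x. ?A x * w x * ?I x + ennreal (2 * ln 2) * ennreal (x powr (-1/2)) * w x * ?I x
        + ?C x * w x * ?I x \<partial>lborel)"
    by (simp add: nn_integral_add del: power_Suc)
  also have "\<dots> = (\<integral>\<^sup>+x. ennreal (- ln x * x powr (-1/2)) * w x * ?I x + ?E x * w x * ?I x \<partial>lborel)"
  proof (intro nn_integral_cong)
    fix x :: real
    show "?A x * w x * ?I x + ennreal (2 * ln 2) * ennreal (x powr (-1/2)) * w x * ?I x + ?C x * w x * ?I x
      = ennreal (- ln x * x powr (-1/2)) * w x * ?I x + ?E x * w x * ?I x"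
    proof (cases "x \<in> {0<..<1}")
      case True
      then show ?thesis by (simp only: distrib_right[symmetric] kernel_identity_ennreal)
    qed simp
  qed
  also have "\<dots> = log_moment w (-1/2) + (\<integral>\<^sup>+x. ?E x * w x * ?I x \<partial>lborel)"
    unfolding log_moment_def by (rule nn_integral_add) measurable
  also have "(\<integral>\<^sup>+x. ?E x * w x * ?I x \<partial>lborel) = (\<Sum>k. ennreal (1 / (real k + 1/2)) * moment w (real k))"
    unfolding moment_def by (rule nn_integral_weighted_series) measurable
  finally show ?thesis .
qed

lemma hurwitz_identity:
  assumes ks: "convergent_index (rev ks)" "ks \<noteq> []"
  shows "(\<Sum>n. ennreal (central (Suc n) * harm (Suc n)) * ennreal (alt_diff (Suc n) (\<lambda>i. hurwitz_real ks (real i)) 0))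
      + ennreal (2 * ln 2) * hurwitz ks (-1/2)
      + (\<Sum>k. ennreal (1 / real (Suc k)) * hurwitz ks (real k + 1/2))
     = hurwitz_deriv ks (-1/2) + (\<Sum>k. ennreal (1 / (real k + 1/2)) * hurwitz ks (real k))"
    (is ?eq)
    and "0 \<le> alt_diff n (\<lambda>i. hurwitz_real ks (real i)) 0"
proof -
  have i: "is_index ks" using ks by (auto simp: convergent_index_def is_index_def)
  have m: "moment (density_of ks) z = hurwitz ks z" if "-1 < z" for z
    using moment_density_of[OF i ks(2) that] .
  have b: "binomial_moment (density_of ks) n j = ennreal (alt_diff n (\<lambda>i. hurwitz_real ks (real i)) j)
      \<and> 0 \<le> alt_diff n (\<lambda>i. hurwitz_real ks (real i)) j" for n j
    by (rule binomial_moment_eq_alt_diff) (auto simp: binomial_moment_0 m ennreal_hurwitz_real ks)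
  show "0 \<le> alt_diff n (\<lambda>i. hurwitz_real ks (real i)) 0" using b by blast
  show ?eq
    using integrated_kernel_identity[OF measurable_density_of[of ks]]
    by (simp add: m b log_moment_density_of i ks(2) del: alt_diff.simps)
qed

section \<open>Hoffman duality\<close>

lemma proper_psums_Cons:
  "proper_psums (a # as) = (if as = [] then {} else insert a ((+) a ` proper_psums as))"
proof (cases "as = []")
  case False
  have pp: "proper_psums xs = (\<lambda>k. sum_list (take k xs)) ` {1..<length xs}" for xs
    by (auto simp: proper_psums_def)
  have "{1..<length (a # as)} = Suc ` insert 0 {1..<length as}"
  proof -
    have "insert 0 {1..<length as} = {0..<length as}" using False by auto
    then show ?thesis by (simp only: image_Suc_atLeastLessThan length_Cons One_nat_def)
  qed
  then have "proper_psums (a # as) = (\<lambda>k. a + sum_list (take k as)) ` insert 0 {1..<length as}"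
    unfolding pp by (simp only: image_image take_Suc_Cons sum_list.Cons)
  also have "\<dots> = insert a ((+) a ` proper_psums as)"
    unfolding pp by (simp add: image_image)
  finally show ?thesis using False by simp
qed (simp add: proper_psums_short)

lemma proper_psums_Suc: "proper_psums (Suc a # as) = Suc ` proper_psums (a # as)"
  by (auto simp: proper_psums_Cons image_image)

lemma is_hoffman_dual_sym: "is_index as \<Longrightarrow> is_hoffman_dual as bs \<Longrightarrow> is_hoffman_dual bs as"
  by (auto simp: is_hoffman_dual_def)

text \<open>Raising the first entry of one index shifts its partial sums by 1 and frees the position
  1; prefixing a 1 to the other index shifts its partial sums and occupies that position. With
  symmetry, this move generates the dual pairs from ([1], [1]).\<close>

lemma is_hoffman_dual_Suc:
  assumes "is_index (a # as)" "is_hoffman_dual (a # as) bs" "bs \<noteq> []"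
  shows "is_hoffman_dual (Suc a # as) (1 # bs)"
proof -
  let ?w = "sum_list (a # as)"
  have w: "1 \<le> ?w" using assms(1) by (auto simp: is_index_def)
  have d: "is_index bs" "sum_list bs = ?w" "proper_psums (a # as) \<inter> proper_psums bs = {}"
    "proper_psums (a # as) \<union> proper_psums bs = {1..<?w}"
    using assms(2) by (auto simp: is_hoffman_dual_def)
  have p: "proper_psums (1 # bs) = insert 1 (Suc ` proper_psums bs)"
    using assms(3) by (simp add: proper_psums_Cons image_def)
  have n1: "1 \<notin> Suc ` proper_psums (a # as)"
    using proper_psums_subset[OF assms(1)] by auto
  have "proper_psums (Suc a # as) \<inter> proper_psums (1 # bs) = Suc ` (proper_psums (a # as) \<inter> proper_psums bs)"
    using n1 unfolding p proper_psums_Suc by auto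
  moreover have "proper_psums (Suc a # as) \<union> proper_psums (1 # bs) = insert 1 (Suc ` (proper_psums (a # as) \<union> proper_psums bs))"
    unfolding p proper_psums_Suc by auto
  moreover have "insert 1 (Suc ` {1..<?w}) = {1..<Suc ?w}" using w by (auto simp: image_Suc_atLeastLessThan)
  ultimately show ?thesis
    using d by (simp add: is_hoffman_dual_def is_index_def)
qed

text \<open>Averages follow the moves of duality. One more average turns the power n^(-b) into a
  summed entry b with a new factor 1/n, as prefixing 1 does; a division by n raises b by 1. The
  first entry of the dual is separated since it is the power that is not summed over.\<close>

lemma nested_avg_eq_zeta_star:
  assumes "is_index ks" "ks \<noteq> []"
  shows "\<exists>b bs. is_hoffman_dual ks (b # bs) \<and> (\<forall>n>0. nested_avg ks n = zeta_star n bs / real n ^ b)"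
  using assms
proof (induction ks)
  case (Cons k ks)
  then have k: "0 < k" "is_index ks" by (auto simp: is_index_def)
  \<comment> \<open>Inner induction on the first entry k = j + 1.\<close>
  have "\<exists>b bs. is_hoffman_dual (Suc j # ks) (b # bs) \<and> (\<forall>n>0. nested_avg (Suc j # ks) n = zeta_star n bs / real n ^ b)" for j
  proof (induction j)
    case 0
    show ?case
    proof (cases "ks = []")
      case True
      have "is_hoffman_dual [Suc 0] [1]"
        by (auto simp: is_hoffman_dual_def is_index_def proper_psums_short)
      then show ?thesis using True by (intro exI[of _ 1] exI[of _ "[]"]) (auto simp: zeta_star_Nil)
    next
      case False
      then obtain b bs where b: "is_hoffman_dual ks (b # bs)"
        "\<forall>n>0. nested_avg ks n = zeta_star n bs / real n ^ b"
        using Cons.IH k by blast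
      have i: "is_index (b # bs)" using b(1) by (simp add: is_hoffman_dual_def)
      \<comment> \<open>Prefixing 1 to \<open>ks\<close> is, read from the dual side, raising the
        first entry of its dual.\<close>
      have "is_hoffman_dual (Suc b # bs) (1 # ks)"
        using is_hoffman_dual_Suc[OF i is_hoffman_dual_sym[OF k(2) b(1)] False] .
      then have "is_hoffman_dual (1 # ks) (Suc b # bs)"
        using i by (intro is_hoffman_dual_sym[of "Suc b # bs" "1 # ks"]) (auto simp: is_index_def)
      moreover have "nested_avg (Suc 0 # ks) n = zeta_star n bs / real n ^ Suc b" if "n > 0" for n
        using b(2) that by (simp add: mult.commute)
      ultimately show ?thesis by (metis One_nat_def)
    qed
  next
    case (Suc j)
    then obtain b bs where b: "is_hoffman_dual (Suc j # ks) (b # bs)"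
        "\<forall>n>0. nested_avg (Suc j # ks) n = zeta_star n bs / real n ^ b" by blast
    have i: "is_index (Suc j # ks)" using k by (auto simp: is_index_def)
    have "nested_avg (Suc (Suc j) # ks) n = zeta_star n (b # bs) / real n ^ 1" for n
    proof -
      have "nested_avg (Suc (Suc j) # ks) n = avg (nested_avg (Suc j # ks)) n" by simp
      also have "\<dots> = zeta_star n (b # bs) / real n ^ 1"
        using b(2) by (simp add: avg_def[of "nested_avg _"] zeta_star_Cons del: nested_avg.simps)
      finally show ?thesis .
    qed
    then show ?case using is_hoffman_dual_Suc[OF i b(1)] by blast
  qed
  from this[of "k - 1"] show ?case using k by simp
qed simp

lemma hoffman_dual_eqI: "is_index as \<Longrightarrow> is_hoffman_dual as bs \<Longrightarrow> hoffman_dual as = bs"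
  unfolding hoffman_dual_def using hoffman_dual_ex1 by (metis the1_equality)

text \<open>Because the first entry is k + 1, a last average follows and sums the first entry of the
  dual of \<open>k # ks\<close> too. This is why \<open>m_index\<close> starts with m_1 and not with
  m_1 + 1.\<close>

lemma nested_avg_hoffman_dual:
  assumes "is_index (k # ks)"
  shows "nested_avg (Suc k # ks) n = zeta_star n (hoffman_dual (k # ks)) / real n"
proof -
  obtain b bs where b: "is_hoffman_dual (k # ks) (b # bs)"
      "\<forall>n>0. nested_avg (k # ks) n = zeta_star n bs / real n ^ b"
    using nested_avg_eq_zeta_star[OF assms] by auto
  obtain j where j: "k = Suc j" using assms by (cases k) (auto simp: is_index_def)
  have "nested_avg (Suc k # ks) n = avg (nested_avg (k # ks)) n" by (simp add: j)
  also have "\<dots> = zeta_star n (b # bs) / real n"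
    using b(2) by (simp add: avg_def[of "nested_avg _"] zeta_star_Cons del: nested_avg.simps)
  finally show ?thesis using hoffman_dual_eqI[OF assms b(1)] by simp
qed

text \<open>Each average costs at most one further factor \<open>harm n\<close>, while the decay 1/n
  is kept.\<close>

lemma avg_pow_bounds:
  assumes "\<And>n. n > 0 \<Longrightarrow> 0 \<le> u n \<and> u n \<le> harm n ^ w / real n" "n > 0"
  shows "0 \<le> (avg ^^ k) u n \<and> (avg ^^ k) u n \<le> harm n ^ (w + k) / real n"
  using assms(2)
proof (induction k arbitrary: n)
  case (Suc k)
  have "(\<Sum>j\<in>{0<..n}. (avg ^^ k) u j) \<le> (\<Sum>j\<in>{0<..n}. harm n ^ (w + k) * inverse (real j))"
  proof (intro sum_mono)
    fix j assume j: "j \<in> {0<..n}"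
    have "harm j ^ (w + k) \<le> (harm n :: real) ^ (w + k)"
      using j by (intro power_mono harm_mono) (auto simp: harm_nonneg)
    then have "harm j ^ (w + k) / real j \<le> harm n ^ (w + k) / real j" by (intro divide_right_mono) auto
    then show "(avg ^^ k) u j \<le> harm n ^ (w + k) * inverse (real j)"
      using Suc.IH[of j] j unfolding divide_inverse by (meson greaterThanAtMost_iff order_trans)
  qed
  also have "\<dots> = harm n ^ (w + k) * harm n"
    unfolding sum_distrib_left[symmetric] by (simp add: harm_def atLeastSucAtMost_greaterThanAtMost)
  also have "\<dots> = harm n ^ (w + Suc k)" by simp
  finally have "(\<Sum>j\<in>{0<..n}. (avg ^^ k) u j) / real n \<le> harm n ^ (w + Suc k) / real n"
    by (intro divide_right_mono) auto
  moreover have "0 \<le> (\<Sum>j\<in>{0<..n}. (avg ^^ k) u j)" using Suc.IH by (intro sum_nonneg) auto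
  ultimately show ?case by (simp only: avg_pow_Suc) simp
qed (use assms in auto)

lemma harm_ge_1: "n > 0 \<Longrightarrow> 1 \<le> (harm n :: real)"
  using harm_mono[of 1 n] by (simp add: harm_expand)

lemma nested_avg_bounds:
  assumes "n > 0" "ks \<noteq> []"
  shows "0 \<le> nested_avg ks n \<and> nested_avg ks n \<le> harm n ^ sum_list ks / real n"
  using assms
proof (induction ks arbitrary: n)
  case (Cons k ks)
  have "0 \<le> nested_avg ks n / real n \<and> nested_avg ks n / real n \<le> harm n ^ sum_list ks / real n" if n: "n > 0" for n
  proof (cases "ks = []")
    case False
    have "harm n ^ sum_list ks / real n \<le> harm n ^ sum_list ks / 1"
      using n by (intro divide_left_mono) (auto simp: harm_nonneg)
    then show ?thesis using Cons.IH[OF n False] n by (auto intro!: divide_right_mono)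
  qed (use n in auto)
  from avg_pow_bounds[OF this Cons.prems(1), of "k - 1"]
  have "0 \<le> nested_avg (k # ks) n \<and> nested_avg (k # ks) n \<le> harm n ^ (sum_list ks + (k - 1)) / real n"
    by simp
  moreover have "harm n ^ (sum_list ks + (k - 1)) / real n \<le> harm n ^ sum_list (k # ks) / real n"
    using harm_ge_1[OF Cons.prems(1)] by (intro divide_right_mono power_increasing) auto
  ultimately show ?case by linarith
qed simp

section \<open>Sums over signs\<close>

text \<open>Collects the powers of each sign. A sign occurs in two neighbouring arguments, so its
  exponent is a sum of two consecutive indices; for the first sign, \<open>c\<close> takes the place
  of the missing neighbour.\<close>

lemma sign_prod:
  assumes d: "d \<ge> 1" and len: "length ns = d"
  shows "\<sigma> 1 ^ c * (\<Prod>j<d. (sign_args d \<sigma> ! j) ^ (ns ! j))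
    = (\<Prod>l\<in>{1..d}. \<sigma> l ^ (ns ! (d - l) + (if l = 1 then c else ns ! (d - l + 1))))"
proof -
  obtain e where e: "d = Suc e" using d by (cases d) auto
  have nth: "sign_args d \<sigma> ! j = (if j = 0 then \<sigma> d else \<sigma> (d - j + 1) * \<sigma> (d - j))" if "j < d" for j
    using that d by (cases j) (auto simp: sign_args_def down_list_def rev_nth nth_Cons Suc_diff_Suc)
  have "(\<Prod>j<d. (sign_args d \<sigma> ! j) ^ (ns ! j)) = \<sigma> d ^ (ns ! 0) * (\<Prod>j<e. (\<sigma> (d - Suc j + 1) * \<sigma> (d - Suc j)) ^ (ns ! Suc j))"
    unfolding e prod.lessThan_Suc_shift using nth by (simp add: e)
  also have "\<dots> = \<sigma> d ^ (ns ! 0) * (\<Prod>j<e. \<sigma> (d - j) ^ (ns ! Suc j)) * (\<Prod>j<e. \<sigma> (d - Suc j) ^ (ns ! Suc j))"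
    by (simp add: power_mult_distrib prod.distrib e Suc_diff_le)
  also have "\<sigma> d ^ (ns ! 0) * (\<Prod>j<e. \<sigma> (d - j) ^ (ns ! Suc j)) * (\<Prod>j<e. \<sigma> (d - Suc j) ^ (ns ! Suc j))
     = (\<Prod>j<d. \<sigma> (d - j) ^ (ns ! j)) * (\<Prod>j<e. \<sigma> (d - j) ^ (ns ! Suc j))"
    unfolding e prod.lessThan_Suc_shift by simp
  also have "(\<Prod>j<d. \<sigma> (d - j) ^ (ns ! j)) = (\<Prod>l\<in>{1..d}. \<sigma> l ^ (ns ! (d - l)))"
    by (rule prod.reindex_bij_witness[of _ "\<lambda>l. d - l" "\<lambda>j. d - j"]) auto
  also have "(\<Prod>j<e. \<sigma> (d - j) ^ (ns ! Suc j)) = (\<Prod>l\<in>{2..d}. \<sigma> l ^ (ns ! (d - l + 1)))"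
    by (rule prod.reindex_bij_witness[of _ "\<lambda>l. d - l" "\<lambda>j. d - j"]) (auto simp: e)
  finally have "\<sigma> 1 ^ c * (\<Prod>j<d. (sign_args d \<sigma> ! j) ^ (ns ! j))
    = (\<Prod>l\<in>{1..d}. \<sigma> l ^ (ns ! (d - l))) * (\<sigma> 1 ^ c * (\<Prod>l\<in>{2..d}. \<sigma> l ^ (ns ! (d - l + 1))))"
    by (simp add: mult_ac)
  also have "\<sigma> 1 ^ c * (\<Prod>l\<in>{2..d}. \<sigma> l ^ (ns ! (d - l + 1)))
    = (\<Prod>l\<in>{1..d}. \<sigma> l ^ (if l = 1 then c else ns ! (d - l + 1)))"
    using d by (subst prod.atLeast_Suc_atMost[of 1]) (auto simp: numeral_2_eq_2 intro!: arg_cong2[of _ _ _ _ "(*)"] prod.cong)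
  finally show ?thesis by (simp add: prod.distrib[symmetric] power_add[symmetric])
qed

lemma finite_signs [simp]: "finite (signs d)"
  unfolding signs_def by (intro finite_PiE) auto

text \<open>Summing over each sign separately forces neighbouring indices to have equal parity; the
  chain begins with \<open>c\<close>, so all of them have the parity of \<open>c\<close>.\<close>

lemma sum_signs:
  assumes d: "d \<ge> 1" and len: "length ns = d"
  shows "(\<Sum>\<sigma>\<in>signs d. \<sigma> 1 ^ c * (\<Prod>j<d. (sign_args d \<sigma> ! j) ^ (ns ! j)))
    = 2 ^ d * (if \<forall>j<d. even (ns ! j + c) then 1 else 0)"
proof -
  define E where "E l = ns ! (d - l) + (if l = 1 then c else ns ! (d - l + 1))" for l
  have "(\<Sum>\<sigma>\<in>signs d. \<sigma> 1 ^ c * (\<Prod>j<d. (sign_args d \<sigma> ! j) ^ (ns ! j)))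
    = (\<Sum>\<sigma>\<in>{1..d} \<rightarrow>\<^sub>E {1, -1}. \<Prod>l\<in>{1..d}. \<sigma> l ^ E l)"
    by (simp only: signs_def sign_prod[OF d len] E_def)
  also have "\<dots> = (\<Prod>l\<in>{1..d}. \<Sum>s\<in>{1, -1}. s ^ E l)"
    by (rule prod_sum_PiE[symmetric]) auto
  also have "\<dots> = (\<Prod>l\<in>{1..d}. 2 * (if even (E l) then 1 else 0))"
    by (intro prod.cong refl) auto
  also have "\<dots> = 2 ^ d * (\<Prod>l\<in>{1..d}. if even (E l) then 1 else 0)"
    by (subst prod.distrib) simp
  also have "(\<Prod>l\<in>{1..d}. if even (E l) then 1 else 0 :: real) = (if \<forall>l\<in>{1..d}. even (E l) then 1 else 0)"
    by (induction d) (auto simp: prod.nat_ivl_Suc' atLeastAtMostSuc_conv)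
  also have "(\<forall>l\<in>{1..d}. even (E l)) \<longleftrightarrow> (\<forall>j<d. even (ns ! j + c))"
  proof
    assume ev: "\<forall>l\<in>{1..d}. even (E l)"
    have "even (ns ! (d - l) + c)" if "l \<in> {1..d}" for l
      using that
    proof (induction l)
      case (Suc l)
      have "even (E (Suc l))" using ev Suc.prems by blast
      then show ?case
      proof (cases "l = 0")
        case False
        then have "even (ns ! (d - l) + c)" "d - Suc l + 1 = d - l" using Suc by auto
        then show ?thesis using \<open>even (E (Suc l))\<close> False by (auto simp: E_def)
      qed (simp add: E_def)
    qed simp
    then show "\<forall>j<d. even (ns ! j + c)"
      by (metis Suc_leI atLeastAtMost_iff diff_diff_cancel diff_le_self less_imp_le One_nat_def zero_less_diff)
  next
    assume ev: "\<forall>j<d. even (ns ! j + c)"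
    show "\<forall>l\<in>{1..d}. even (E l)"
    proof
      fix l assume l: "l \<in> {1..d}"
      then have "even (ns ! (d - l) + c)" using ev by auto
      moreover have "even (ns ! (d - l + 1) + c)" if "l \<noteq> 1" using ev l that by auto
      ultimately show "even (E l)" by (auto simp: E_def)
    qed
  qed
  finally show ?thesis .
qed

definition parity_term :: "nat \<Rightarrow> nat \<Rightarrow> nat \<Rightarrow> real" where
  "parity_term e a n = (if even (n + e) then 1 / real n ^ a else 0)"

lemma convergent_parity_nested_sum:
  assumes "convergent_index as" "list_all2 (\<lambda>g a. \<exists>e. g = parity_term e a) gs as"
  shows "convergent (nested_sum gs 0)"
  using assms(1)
  by (rule convergent_nested_sum, intro list.rel_mono_strong[OF assms(2)]) (auto simp: parity_term_def)

lemma prod_power_div: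
  "(\<Prod>j<q. (xs ! j) ^ (ns ! j) / real (ns ! j) ^ (as ! j)) = (\<Prod>j<q. (xs ! j) ^ (ns ! j)) * (\<Prod>j<q. 1 / real (ns ! j) ^ (as ! j))"
  by (simp add: prod.distrib[symmetric])

lemma abs_sign_args:
  assumes "\<sigma> \<in> signs d" "j < d"
  shows "\<bar>sign_args d \<sigma> ! j\<bar> = 1"
proof -
  have s: "\<bar>\<sigma> l\<bar> = 1" if "l \<in> {1..d}" for l
    using assms(1) that by (auto simp: signs_def PiE_iff dest!: bspec[of _ _ l])
  show ?thesis using assms(2)
    by (cases j) (auto simp: sign_args_def down_list_def rev_nth nth_Cons abs_mult s)
qed

lemma length_sign_args: "d \<ge> 1 \<Longrightarrow> length (sign_args d \<sigma>) = d"
  by (auto simp: sign_args_def down_list_def)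

lemma convergent_mpolylog:
  fixes xs :: "real list"
  assumes "convergent_index as" "length xs = length as" "\<And>j. j < length xs \<Longrightarrow> \<bar>xs ! j\<bar> = 1"
  shows "(\<lambda>N. \<Sum>ns\<in>desc_tuples (length as) N. \<Prod>j<length as. (xs ! j) ^ (ns ! j) / of_nat (ns ! j) ^ (as ! j))
     \<longlonglongrightarrow> mpolylog as xs"
proof -
  define gs where "gs = map2 (\<lambda>a x n. x ^ n / real n ^ a) as xs"
  have "convergent (nested_sum gs 0)"
    by (rule convergent_nested_sum[OF assms(1)])
       (auto simp: gs_def list_all2_conv_all_nth assms abs_mult power_abs abs_divide)
  moreover have "nested_sum gs 0 = (\<lambda>N. \<Sum>ns\<in>desc_tuples (length as) N. \<Prod>j<length as. (xs ! j) ^ (ns ! j) / of_nat (ns ! j) ^ (as ! j))"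
    using sum_desc_tuples[of gs] assms(2) by (auto simp: fun_eq_iff gs_def)
  ultimately show ?thesis unfolding mpolylog_def by (simp add: convergent_LIMSEQ_iff)
qed

text \<open>The prefactor is the first power of the first sign, so \<open>sum_signs\<close> with c =
  1 keeps exactly the tuples of odd indices.\<close>

lemma signed_mpolylog_limit:
  assumes as: "convergent_index as" "length as = d" "d \<ge> 1"
  shows "(\<lambda>N. 2 ^ d * nested_sum (map (parity_term 1) as) 0 N)
    \<longlonglongrightarrow> (\<Sum>\<sigma>\<in>signs d. \<sigma> 1 * mpolylog as (sign_args d \<sigma>))"
proof -
  have "(\<lambda>N. \<Sum>\<sigma>\<in>signs d. \<sigma> 1 * (\<Sum>ns\<in>desc_tuples d N. \<Prod>j<d. (sign_args d \<sigma> ! j) ^ (ns ! j) / of_nat (ns ! j) ^ (as ! j)))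
      \<longlonglongrightarrow> (\<Sum>\<sigma>\<in>signs d. \<sigma> 1 * mpolylog as (sign_args d \<sigma>))"
    using as by (intro tendsto_sum tendsto_mult tendsto_const convergent_mpolylog[OF as(1), unfolded as(2)])
      (auto simp: length_sign_args abs_sign_args)
  moreover have "(\<Sum>\<sigma>\<in>signs d. \<sigma> 1 * (\<Sum>ns\<in>desc_tuples d N. \<Prod>j<d. (sign_args d \<sigma> ! j) ^ (ns ! j) / of_nat (ns ! j) ^ (as ! j)))
      = 2 ^ d * nested_sum (map (parity_term 1) as) 0 N" for N
  proof -
    have "(\<Sum>\<sigma>\<in>signs d. \<sigma> 1 * (\<Sum>ns\<in>desc_tuples d N. \<Prod>j<d. (sign_args d \<sigma> ! j) ^ (ns ! j) / of_nat (ns ! j) ^ (as ! j)))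
      = (\<Sum>ns\<in>desc_tuples d N. (\<Sum>\<sigma>\<in>signs d. \<sigma> 1 ^ 1 * (\<Prod>j<d. (sign_args d \<sigma> ! j) ^ (ns ! j))) * (\<Prod>j<d. 1 / real (ns ! j) ^ (as ! j)))"
      unfolding prod_power_div sum_distrib_left sum_distrib_right by (subst sum.swap) (simp add: mult.assoc)
    also have "\<dots> = (\<Sum>ns\<in>desc_tuples d N. 2 ^ d * (\<Prod>j<d. parity_term 1 (as ! j) (ns ! j)))"
    proof (intro sum.cong refl)
      fix ns assume "ns \<in> desc_tuples d N"
      then have len: "length ns = d" by (simp add: desc_tuples_def)
      show "(\<Sum>\<sigma>\<in>signs d. \<sigma> 1 ^ 1 * (\<Prod>j<d. (sign_args d \<sigma> ! j) ^ (ns ! j))) * (\<Prod>j<d. 1 / real (ns ! j) ^ (as ! j))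
        = 2 ^ d * (\<Prod>j<d. parity_term 1 (as ! j) (ns ! j))"
      proof (cases "\<forall>j<d. even (ns ! j + 1)")
        case True
        then have "(\<Prod>j<d. parity_term 1 (as ! j) (ns ! j)) = (\<Prod>j<d. 1 / real (ns ! j) ^ (as ! j))"
          by (intro prod.cong) (auto simp: parity_term_def)
        then show ?thesis unfolding sum_signs[OF as(3) len] using True by simp
      next
        case False
        then have "(\<Prod>j<d. parity_term 1 (as ! j) (ns ! j)) = 0"
          by (auto simp: parity_term_def)
        then show ?thesis unfolding sum_signs[OF as(3) len]
          by (simp only: if_not_P[OF False] mult_zero_left mult_zero_right)
      qed
    qed
    also have "\<dots> = 2 ^ d * nested_sum (map (parity_term 1) as) 0 N"
      using sum_desc_tuples[of "map (parity_term 1) as" N] as(2)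
      by (simp add: sum_distrib_left[symmetric])
    finally show ?thesis .
  qed
  ultimately show ?thesis by simp
qed

text \<open>The last argument contributes (-1)^n' times the n'-th power of the first sign, so
  \<open>sum_signs\<close> applies with c = n' + 1: all other indices have the parity opposite to
  n'. Even n' gives the first sum, odd n' the second with a minus sign.\<close>

lemma signed_mpolylog_snoc_limit:
  assumes as: "convergent_index as" "length as = d" "d \<ge> 1"
  shows "(\<lambda>N. 2 ^ d * (nested_sum (map (parity_term 1) as @ [parity_term 0 1]) 0 N
        - nested_sum (map (parity_term 0) as @ [parity_term 1 1]) 0 N))
    \<longlonglongrightarrow> (\<Sum>\<sigma>\<in>signs d. \<sigma> 1 * mpolylog (as @ [1]) (sign_args d \<sigma> @ [- \<sigma> 1]))"
proof -
  let ?P = "\<lambda>\<sigma> ns. \<Prod>j<Suc d. ((sign_args d \<sigma> @ [- \<sigma> 1]) ! j) ^ (ns ! j) / of_nat (ns ! j) ^ ((as @ [1]) ! j) :: real"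
  have c: "convergent_index (as @ [1])" "length (as @ [1]) = Suc d"
    using as by (auto simp: convergent_index_def is_index_def hd_append)
  have s1: "\<bar>\<sigma> 1\<bar> = 1" if "\<sigma> \<in> signs d" for \<sigma>
    using that as(3) by (auto simp: signs_def PiE_iff dest!: bspec[of _ _ 1])
  have "(\<lambda>N. \<Sum>\<sigma>\<in>signs d. \<sigma> 1 * (\<Sum>ns\<in>desc_tuples (Suc d) N. ?P \<sigma> ns))
      \<longlonglongrightarrow> (\<Sum>\<sigma>\<in>signs d. \<sigma> 1 * mpolylog (as @ [1]) (sign_args d \<sigma> @ [- \<sigma> 1]))"
    using as by (intro tendsto_sum tendsto_mult tendsto_const convergent_mpolylog[OF c(1), unfolded c(2)])
      (auto simp: length_sign_args abs_sign_args nth_append s1[unfolded One_nat_def] less_Suc_eq)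
  moreover have "(\<Sum>\<sigma>\<in>signs d. \<sigma> 1 * (\<Sum>ns\<in>desc_tuples (Suc d) N. ?P \<sigma> ns))
      = 2 ^ d * (nested_sum (map (parity_term 1) as @ [parity_term 0 1]) 0 N
        - nested_sum (map (parity_term 0) as @ [parity_term 1 1]) 0 N)" for N
  proof -
    have "(\<Sum>\<sigma>\<in>signs d. \<sigma> 1 * (\<Sum>ns\<in>desc_tuples (Suc d) N. ?P \<sigma> ns))
      = (\<Sum>ns\<in>desc_tuples (Suc d) N. \<Sum>\<sigma>\<in>signs d. \<sigma> 1 * ?P \<sigma> ns)"
      unfolding sum_distrib_left by (rule sum.swap)
    also have "\<dots> = (\<Sum>ns\<in>desc_tuples (Suc d) N. 2 ^ d * ((\<Prod>j<Suc d. ((map (parity_term 1) as @ [parity_term 0 1]) ! j) (ns ! j))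
        - (\<Prod>j<Suc d. ((map (parity_term 0) as @ [parity_term 1 1]) ! j) (ns ! j))))"
    proof (intro sum.cong refl)
      fix ns assume "ns \<in> desc_tuples (Suc d) N"
      then have len: "length ns = Suc d" by (simp add: desc_tuples_def)
      define n' where "n' = ns ! d"
      define R where "R = (\<Prod>j<d. 1 / real (ns ! j) ^ (as ! j))"
      \<comment> \<open>Without its last entry, the tuple has one index for each entry of
        \<open>sign_args\<close>.\<close>
      have len': "length (butlast ns) = d" using len by simp
      have nb: "butlast ns ! j = ns ! j" if "j < d" for j using that len by (simp add: nth_butlast)
      have "?P \<sigma> ns = (\<Prod>j<d. (sign_args d \<sigma> ! j) ^ (ns ! j)) * R * ((- \<sigma> 1) ^ n' / real n')" for \<sigma>
      proof -
        have "?P \<sigma> ns = (\<Prod>j<d. (sign_args d \<sigma> ! j) ^ (ns ! j) / real (ns ! j) ^ (as ! j)) * ((- \<sigma> 1) ^ n' / real n')"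
          using as by (simp add: nth_append length_sign_args n'_def)
        then show ?thesis by (simp only: prod_power_div R_def)
      qed
      then have "(\<Sum>\<sigma>\<in>signs d. \<sigma> 1 * ?P \<sigma> ns)
        = (\<Sum>\<sigma>\<in>signs d. (\<sigma> 1 ^ Suc n' * (\<Prod>j<d. (sign_args d \<sigma> ! j) ^ (butlast ns ! j))) * ((-1) ^ n' * R / real n'))"
      proof (intro sum.cong refl)
        fix \<sigma> :: "nat \<Rightarrow> real"
        assume P: "\<And>\<sigma>. ?P \<sigma> ns = (\<Prod>j<d. (sign_args d \<sigma> ! j) ^ (ns ! j)) * R * ((- \<sigma> 1) ^ n' / real n')"
        have "(\<Prod>j<d. (sign_args d \<sigma> ! j) ^ (butlast ns ! j)) = (\<Prod>j<d. (sign_args d \<sigma> ! j) ^ (ns ! j))"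
          by (intro prod.cong) (auto simp: nb)
        then show "\<sigma> 1 * ?P \<sigma> ns = (\<sigma> 1 ^ Suc n' * (\<Prod>j<d. (sign_args d \<sigma> ! j) ^ (butlast ns ! j))) * ((-1) ^ n' * R / real n')"
          unfolding P power_minus[of "\<sigma> 1"] by simp
      qed
      also have "\<dots> = 2 ^ d * (if \<forall>j<d. even (ns ! j + Suc n') then 1 else 0) * ((-1) ^ n' * R / real n')"
        unfolding sum_distrib_right[symmetric] sum_signs[OF as(3) len'] by (simp add: nb)
      also have "\<dots> = 2 ^ d * ((\<Prod>j<d. parity_term 1 (as ! j) (ns ! j)) * parity_term 0 1 n'
        - (\<Prod>j<d. parity_term 0 (as ! j) (ns ! j)) * parity_term 1 1 n')"
      proof -
        have pr: "(\<Prod>j<d. parity_term e (as ! j) (ns ! j)) = (if \<forall>j<d. even (ns ! j + e) then R else 0)" for e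
        proof (cases "\<forall>j<d. even (ns ! j + e)")
          case True
          then show ?thesis unfolding R_def by (auto intro!: prod.cong simp: parity_term_def)
        qed (auto simp: parity_term_def)
        show ?thesis unfolding pr by (cases "even n'") (auto simp: parity_term_def)
      qed
      also have "\<dots> = 2 ^ d * ((\<Prod>j<Suc d. ((map (parity_term 1) as @ [parity_term 0 1]) ! j) (ns ! j))
        - (\<Prod>j<Suc d. ((map (parity_term 0) as @ [parity_term 1 1]) ! j) (ns ! j)))"
        using as by (simp add: nth_append n'_def)
      finally show "(\<Sum>\<sigma>\<in>signs d. \<sigma> 1 * ?P \<sigma> ns) = 2 ^ d * ((\<Prod>j<Suc d. ((map (parity_term 1) as @ [parity_term 0 1]) ! j) (ns ! j))
        - (\<Prod>j<Suc d. ((map (parity_term 0) as @ [parity_term 1 1]) ! j) (ns ! j)))" .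
    qed
    also have "\<dots> = 2 ^ d * (nested_sum (map (parity_term 1) as @ [parity_term 0 1]) 0 N
        - nested_sum (map (parity_term 0) as @ [parity_term 1 1]) 0 N)"
      using sum_desc_tuples[of "map (parity_term 1) as @ [parity_term 0 1]" N]
        sum_desc_tuples[of "map (parity_term 0) as @ [parity_term 1 1]" N] as(2)
      by (simp add: sum_distrib_left[symmetric] sum_subtractf del: prod.lessThan_Suc)
    finally show ?thesis .
  qed
  ultimately show ?thesis by simp
qed

section \<open>From parity conditions to Hurwitz values at integers and half-integers\<close>

lemma strict_mono_odd: "strict_mono (\<lambda>n::nat. 2 * n - 1)"
  unfolding strict_mono_Suc_iff by auto

lemma nested_sum_odd_reindex:
  "nested_sum (map (parity_term 1) as) (2 * M) (2 * N)
    = (1/2) ^ sum_list as * nested_sum (map (\<lambda>a n. 1 / (-1/2 + real n) ^ a) as) M N"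
proof -
  have "nested_sum (map (parity_term 1) as) (2 * M) (2 * N) = nested_sum (map (\<lambda>g. g \<circ> (\<lambda>n. 2 * n - 1)) (map (parity_term 1) as)) M N"
  proof (rule nested_sum_reindex[OF strict_mono_odd])
    fix g n assume g: "g \<in> set (map (parity_term 1) as)" "n > 2 * M" "n \<notin> range (\<lambda>n::nat. 2 * n - 1)"
    have "even n"
    proof (rule ccontr)
      assume "odd n"
      then obtain k where "n = 2 * (k + 1) - 1" by (auto elim: oddE)
      then show False using g(3) by blast
    qed
    then show "g n = 0" using g(1) by (auto simp: parity_term_def)
  qed auto
  also have "\<dots> = nested_sum (map (\<lambda>a n. (1/2) ^ a * (1 / (-1/2 + real n) ^ a)) as) M N"
  proof (rule nested_sum_cong, unfold list.map_comp list_all2_map1 list_all2_map2, rule list.rel_refl_strong, intro allI impI)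
    fix a n :: nat assume n: "n > M"
    have "real (2 * n - 1) = 2 * (-1/2 + real n)" using n by (simp add: of_nat_diff)
    then have "parity_term 1 a (2 * n - 1) = 1 / (2 * (-1/2 + real n)) ^ a"
      using n by (simp only: parity_term_def) auto
    moreover have "1 / (2 * x) ^ a = (1/2) ^ a * (1 / x ^ a)" for x :: real
      by (simp add: power_mult_distrib power_one_over)
    ultimately show "((\<lambda>g. g \<circ> (\<lambda>n. 2 * n - 1)) \<circ> parity_term 1) a n = (1/2) ^ a * (1 / (-1/2 + real n) ^ a)"
      by (simp only: comp_apply)
  qed
  also have "\<dots> = (1/2) ^ sum_list as * nested_sum (map (\<lambda>a n. 1 / (-1/2 + real n) ^ a) as) M N"
    by (rule nested_sum_scale)
  finally show ?thesis .
qed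

text \<open>The lower bound is odd because it will be the smallest index 2M + 1; the even numbers
  above it are 2n with n > M. Writing \<open>0 + real n\<close> keeps the form of
  \<open>hurwitz_SUP\<close> at z = 0.\<close>

lemma nested_sum_even_reindex:
  "nested_sum (map (parity_term 0) as) (Suc (2 * M)) (2 * N)
    = (1/2) ^ sum_list as * nested_sum (map (\<lambda>a n. 1 / (0 + real n) ^ a) as) M N"
proof -
  have "nested_sum (map (parity_term 0) as) (Suc (2 * M)) (2 * N) = nested_sum (map (\<lambda>g. g \<circ> (\<lambda>n. 2 * n)) (map (parity_term 0) as)) M N"
  proof (rule nested_sum_reindex)
    fix g n assume g: "g \<in> set (map (parity_term 0) as)" "n \<notin> range (\<lambda>n::nat. 2 * n)"
    then have "odd n" by (metis evenE rangeI)
    then show "g n = 0" using g(1) by (auto simp: parity_term_def)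
  qed (auto simp: strict_mono_def)
  also have "\<dots> = nested_sum (map (\<lambda>a n. (1/2) ^ a * (1 / (0 + real n) ^ a)) as) M N"
    by (rule nested_sum_cong, unfold list.map_comp list_all2_map1 list_all2_map2, rule list.rel_refl_strong)
       (auto simp: parity_term_def power_mult_distrib power_one_over)
  also have "\<dots> = (1/2) ^ sum_list as * nested_sum (map (\<lambda>a n. 1 / (0 + real n) ^ a) as) M N"
    by (rule nested_sum_scale)
  finally show ?thesis .
qed

lemma filterlim_double: "filterlim (\<lambda>N::nat. 2 * N) at_top sequentially"
  by (rule filterlim_subseq) (simp add: strict_mono_def)

text \<open>The limit is evaluated along even N. The factor 2^d counts the signs; the power of 1/2
  comes from writing each odd index as 2(n - 1/2).\<close>

lemma signed_mpolylog_eq: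
  assumes as: "convergent_index as" "length as = d" "d \<ge> 1"
  shows "(\<Sum>\<sigma>\<in>signs d. \<sigma> 1 * mpolylog as (sign_args d \<sigma>))
    = 2 ^ d * (1/2) ^ sum_list as * hurwitz_real (rev as) (-1/2)"
proof (rule LIMSEQ_unique)
  show "(\<lambda>N. 2 ^ d * nested_sum (map (parity_term 1) as) 0 (2 * N)) \<longlonglongrightarrow> (\<Sum>\<sigma>\<in>signs d. \<sigma> 1 * mpolylog as (sign_args d \<sigma>))"
    using filterlim_compose[OF signed_mpolylog_limit[OF as] filterlim_double] .
  have "(\<lambda>N. nested_sum (map (\<lambda>a n. 1 / (-1/2 + real n) ^ a) as) 0 N) \<longlonglongrightarrow> hurwitz_real (rev as) (-1/2)"
    using nested_sum_tendsto_hurwitz_real[of "rev as" "-1/2" 0] as by simp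
  then show "(\<lambda>N. 2 ^ d * nested_sum (map (parity_term 1) as) 0 (2 * N)) \<longlonglongrightarrow> 2 ^ d * (1/2) ^ sum_list as * hurwitz_real (rev as) (-1/2)"
    using nested_sum_odd_reindex[of as 0] by (auto intro!: tendsto_intros simp: mult.assoc)
qed

text \<open>Finiteness of \<open>S\<close> is a conclusion here: it is inherited from the
  convergence of \<open>u\<close>, which is known by comparison.\<close>

lemma SUP_convergent_subseq:
  assumes "convergent u" "\<And>N. 0 \<le> v N" "mono v" "\<And>N. u (2 * N) = c * v N" "c > 0"
    and S: "(SUP N. ennreal (v N)) = S"
  shows "u \<longlonglongrightarrow> c * enn2real S \<and> S < top"
proof -
  obtain l where l: "u \<longlonglongrightarrow> l" using assms(1) by (auto simp: convergent_def)
  then have "(\<lambda>N. u (2 * N)) \<longlonglongrightarrow> l" using filterlim_compose[OF _ filterlim_double] by blast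
  then have "(\<lambda>N. c * v N / c) \<longlonglongrightarrow> l / c" unfolding assms(4) using assms(5) by (intro tendsto_intros) auto
  then have v: "v \<longlonglongrightarrow> l / c" using assms(5) by simp
  then have l0: "0 \<le> l / c" using assms(2) by (intro LIMSEQ_le_const[OF v]) auto
  have "(\<lambda>N. ennreal (v N)) \<longlonglongrightarrow> ennreal (l / c)" using v by (rule tendsto_ennrealI)
  moreover have "(\<lambda>N. ennreal (v N)) \<longlonglongrightarrow> S"
    unfolding S[symmetric] using assms(3) by (intro LIMSEQ_SUP) (auto simp: mono_def ennreal_leI)
  ultimately have "S = ennreal (l / c)" by (rule LIMSEQ_unique[symmetric])
  then show ?thesis using l l0 assms(5) by simp
qed

text \<open>\<open>X\<close> belongs to tuples with smallest index 2(k + 1) and odd larger ones,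
  \<open>Y\<close> to those with smallest index 2k + 1 and even larger ones. Convergence of each
  part separately shows that \<open>X\<close> and \<open>Y\<close> are finite.\<close>

lemma signed_mpolylog_snoc_eq:
  assumes as: "convergent_index as" "length as = d" "d \<ge> 1"
  defines "X \<equiv> (\<Sum>k. ennreal (1 / real (Suc k)) * hurwitz (rev as) (real k + 1/2))"
    and "Y \<equiv> (\<Sum>k. ennreal (1 / (real k + 1/2)) * hurwitz (rev as) (real k))"
  shows "(\<Sum>\<sigma>\<in>signs d. \<sigma> 1 * mpolylog (as @ [1]) (sign_args d \<sigma> @ [- \<sigma> 1]))
    = 2 ^ d * (1/2) ^ Suc (sum_list as) * (enn2real X - enn2real Y)" "X < top" "Y < top"
proof -
  let ?A = "map (parity_term 1) as @ [parity_term 0 1]"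
  let ?B = "map (parity_term 0) as @ [parity_term 1 1]"
  let ?c = "(1/2 :: real) ^ Suc (sum_list as)"
  let ?F = "\<lambda>z. nested_sum (map (\<lambda>a n. 1 / (z + real n) ^ a) as)"
  have c: "convergent_index (as @ [1])"
    using as by (auto simp: convergent_index_def is_index_def hd_append)
  have F_nonneg: "0 \<le> ?F z M N" if "z + real M > -1" for z M N
    using that by (intro nested_sum_nonneg) auto
  have F_mono: "?F z M N \<le> ?F z M N'" if "z + real M > -1" "N \<le> N'" for z M N N'
    using that by (intro nested_sum_mono) auto
  have X: "nested_sum ?A 0 \<longlonglongrightarrow> ?c * enn2real X \<and> X < top"
  proof (rule SUP_convergent_subseq)
    let ?v = "\<lambda>N. \<Sum>k\<in>{0<..N}. 1 / real k * ?F (-1/2) k N"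
    show "convergent (nested_sum ?A 0)"
      by (rule convergent_parity_nested_sum[OF c]) (auto simp: list_all2_append list_all2_map1 intro!: list.rel_refl_strong)
    show "0 \<le> ?v N" for N by (intro sum_nonneg mult_nonneg_nonneg F_nonneg) auto
    show "mono ?v"
      by (intro monoI order_trans[OF sum_mono sum_mono2] mult_left_mono mult_nonneg_nonneg F_mono F_nonneg) auto
    show "nested_sum ?A 0 (2 * N) = ?c * ?v N" for N
    proof -
      have "nested_sum ?A 0 (2 * N) = (\<Sum>n\<in>{0<..2 * N}. parity_term 0 1 n * nested_sum (map (parity_term 1) as) n (2 * N))"
        by (rule nested_sum_snoc)
      also have "\<dots> = (\<Sum>n\<in>(\<lambda>k. 2 * k) ` {0<..N}. parity_term 0 1 n * nested_sum (map (parity_term 1) as) n (2 * N))"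
        by (intro sum.mono_neutral_right) (auto simp: parity_term_def elim!: evenE)
      also have "\<dots> = (\<Sum>k\<in>{0<..N}. parity_term 0 1 (2 * k) * nested_sum (map (parity_term 1) as) (2 * k) (2 * N))"
        by (subst sum.reindex) (auto simp: inj_on_def)
      also have "\<dots> = ?c * ?v N"
        unfolding nested_sum_odd_reindex sum_distrib_left by (intro sum.cong refl) (auto simp: parity_term_def)
      finally show ?thesis .
    qed
    have "(SUP N. ennreal (?v N)) = (\<Sum>i. ennreal (1 / real (Suc (0 + i))) * (SUP N. ennreal (?F (-1/2) (Suc (0 + i)) N)))"
      by (intro SUP_triangular_sum monoI F_mono F_nonneg) auto
    also have "\<dots> = X"
      unfolding X_def
    proof (intro suminf_cong arg_cong2[of _ _ _ _ "(*)"])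
      fix i
      have "(-1/2 + real (Suc i)) = real i + 1/2" by simp
      then show "(SUP N. ennreal (?F (-1/2) (Suc (0 + i)) N)) = hurwitz (rev as) (real i + 1/2)"
        using hurwitz_SUP[of "-1/2" "Suc i" "rev as"] by (simp add: add.commute)
    qed simp
    finally show "(SUP N. ennreal (?v N)) = X" .
  qed simp
  have Y: "nested_sum ?B 0 \<longlonglongrightarrow> ?c * enn2real Y \<and> Y < top"
  proof (rule SUP_convergent_subseq)
    \<comment> \<open>Here k starts at 1, so the smallest index is 2k - 1, later written
      \<open>Suc (2 * (k - 1))\<close>.\<close>
    let ?v = "\<lambda>N. \<Sum>k\<in>{0<..N}. 1 / (real k - 1/2) * ?F 0 (k - 1) N"
    show "convergent (nested_sum ?B 0)"
      by (rule convergent_parity_nested_sum[OF c]) (auto simp: list_all2_append list_all2_map1 intro!: list.rel_refl_strong)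
    show "0 \<le> ?v N" for N by (intro sum_nonneg mult_nonneg_nonneg F_nonneg) auto
    show "mono ?v"
      by (intro monoI order_trans[OF sum_mono sum_mono2] mult_left_mono mult_nonneg_nonneg F_mono F_nonneg) auto
    show "nested_sum ?B 0 (2 * N) = ?c * ?v N" for N
    proof -
      have "nested_sum ?B 0 (2 * N) = (\<Sum>n\<in>{0<..2 * N}. parity_term 1 1 n * nested_sum (map (parity_term 0) as) n (2 * N))"
        by (rule nested_sum_snoc)
      also have "\<dots> = (\<Sum>n\<in>(\<lambda>k. Suc (2 * (k - 1))) ` {0<..N}. parity_term 1 1 n * nested_sum (map (parity_term 0) as) n (2 * N))"
      proof (intro sum.mono_neutral_right ballI)
        fix n assume n: "n \<in> {0<..2 * N} - (\<lambda>k. Suc (2 * (k - 1))) ` {0<..N}"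
        have "even n"
        proof (rule ccontr)
          assume "odd n"
          then obtain k where "n = Suc (2 * k)" by (auto elim: oddE)
          then have "n = (\<lambda>k. Suc (2 * (k - 1))) (Suc k)" "Suc k \<in> {0<..N}" using n by auto
          then show False using n by blast
        qed
        then show "parity_term 1 1 n * nested_sum (map (parity_term 0) as) n (2 * N) = 0" by (simp add: parity_term_def)
      qed auto
      also have "\<dots> = (\<Sum>k\<in>{0<..N}. parity_term 1 1 (Suc (2 * (k - 1))) * nested_sum (map (parity_term 0) as) (Suc (2 * (k - 1))) (2 * N))"
        by (subst sum.reindex) (auto simp: inj_on_def)
      also have "\<dots> = ?c * ?v N"
        unfolding nested_sum_even_reindex sum_distrib_left
        by (intro sum.cong refl) (auto simp: parity_term_def of_nat_diff field_simps)
      finally show ?thesis .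
    qed
    have "(SUP N. ennreal (?v N)) = (\<Sum>i. ennreal (1 / (real (Suc (0 + i)) - 1/2)) * (SUP N. ennreal (?F 0 (Suc (0 + i) - 1) N)))"
      by (intro SUP_triangular_sum monoI F_mono F_nonneg) auto
    also have "\<dots> = Y"
      unfolding Y_def
    proof (intro suminf_cong arg_cong2[of _ _ _ _ "(*)"])
      fix i
      show "(SUP N. ennreal (?F 0 (Suc (0 + i) - 1) N)) = hurwitz (rev as) (real i)"
        using hurwitz_SUP[of 0 i "rev as"] by simp
    qed simp
    finally show "(SUP N. ennreal (?v N)) = Y" .
  qed simp
  show "X < top" "Y < top" using X Y by auto
  have "(\<lambda>N. 2 ^ d * (nested_sum ?A 0 N - nested_sum ?B 0 N)) \<longlonglongrightarrow> 2 ^ d * (?c * enn2real X - ?c * enn2real Y)"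
    using X Y by (intro tendsto_intros) auto
  from LIMSEQ_unique[OF signed_mpolylog_snoc_limit[OF as] this]
  show "(\<Sum>\<sigma>\<in>signs d. \<sigma> 1 * mpolylog (as @ [1]) (sign_args d \<sigma> @ [- \<sigma> 1]))
    = 2 ^ d * ?c * (enn2real X - enn2real Y)"
    by (simp add: right_diff_distrib mult.assoc)
qed

section \<open>Derivatives and unit tuples\<close>

text \<open>The derivative hits one factor at a time, which raises its exponent and brings down the
  old one. The old exponents are the binomial coefficients of the theorem: m_l + 1 when j_l = 1, and
  1 for the entries with the i's.\<close>

lemma hurwitz_deriv_eq:
  "hurwitz_deriv ks z = (\<Sum>j<length ks. ennreal (real (ks ! j)) * hurwitz (ks[j := Suc (ks ! j)]) z)"
  if "-1 < z"
  using that
proof (induction ks arbitrary: z)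
  case (Cons k ks)
  let ?y = "\<lambda>n. z + real (Suc n)"
  have "hurwitz_deriv (k # ks) z
      = (\<Sum>n. ennreal (1 / ?y n ^ k) * hurwitz_deriv ks (?y n))
        + (\<Sum>n. ennreal (real k / ?y n ^ Suc k) * hurwitz ks (?y n))"
    unfolding hurwitz_deriv.simps by (rule suminf_add[symmetric]) auto
  also have "(\<Sum>n. ennreal (real k / ?y n ^ Suc k) * hurwitz ks (?y n)) = ennreal (real k) * hurwitz (Suc k # ks) z"
  proof -
    have "ennreal (real k / ?y n ^ Suc k) = ennreal (real k) * ennreal (1 / ?y n ^ Suc k)" for n
      using Cons.prems by (simp add: ennreal_mult'[symmetric] del: power_Suc)
    then show ?thesis unfolding hurwitz.simps by (simp only: mult.assoc ennreal_suminf_cmult)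
  qed
  also have "(\<Sum>n. ennreal (1 / ?y n ^ k) * hurwitz_deriv ks (?y n))
      = (\<Sum>n. \<Sum>j<length ks. ennreal (real (ks ! j)) * (ennreal (1 / ?y n ^ k) * hurwitz (ks[j := Suc (ks ! j)]) (?y n)))"
    using Cons.prems by (intro suminf_cong) (simp add: Cons.IH sum_distrib_left mult_ac)
  also have "\<dots> = (\<Sum>j<length ks. ennreal (real (ks ! j)) * hurwitz (k # ks[j := Suc (ks ! j)]) z)"
    unfolding hurwitz.simps ennreal_suminf_cmult[symmetric] by (rule suminf_sum) auto
  finally show ?case by (simp add: sum.lessThan_Suc_shift add.commute del: sum.lessThan_Suc hurwitz.simps)
qed simp

lemma convergent_index_update:
  assumes "convergent_index (rev ks)" "j < length ks"
  shows "convergent_index (rev (ks[j := Suc (ks ! j)]))"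
proof -
  have ne: "ks \<noteq> []" using assms(2) by auto
  have "last ks \<ge> 2" "\<forall>k\<in>set ks. 0 < k"
    using assms(1) ne by (auto simp: convergent_index_def is_index_def hd_rev)
  moreover have "last (ks[j := Suc (ks ! j)]) \<ge> 2"
  proof (cases "j = length ks - 1")
    case True
    then have "ks ! j = last ks" using ne by (simp add: last_conv_nth)
    then show ?thesis using calculation(1) ne True by (simp add: last_list_update)
  next
    case False
    then show ?thesis using calculation(1) ne by (simp add: last_list_update)
  qed
  ultimately show ?thesis
    using set_update_subset_insert[of ks j "Suc (ks ! j)"]
    by (auto simp: convergent_index_def is_index_def hd_rev)
qed

lemma hurwitz_deriv_eq_ennreal:
  assumes "convergent_index (rev ks)" "-1/2 \<le> z"
  shows "hurwitz_deriv ks z = ennreal (\<Sum>j<length ks. real (ks ! j) * hurwitz_real (ks[j := Suc (ks ! j)]) z)"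
proof -
  have "hurwitz_deriv ks z = (\<Sum>j<length ks. ennreal (real (ks ! j) * hurwitz_real (ks[j := Suc (ks ! j)]) z))"
    using assms by (simp add: hurwitz_deriv_eq ennreal_mult' ennreal_hurwitz_real convergent_index_update)
  then show ?thesis by (simp add: sum_ennreal)
qed

text \<open>\<open>unit_fun n 0\<close> is the zero tuple.\<close>

definition unit_fun :: "nat \<Rightarrow> nat \<Rightarrow> nat \<Rightarrow> nat" where
  "unit_fun n l = (\<lambda>i\<in>{1..n}. if i = l then 1 else 0)"

lemma sum_eq_1_unit_fun:
  assumes "f \<in> {1..n} \<rightarrow>\<^sub>E (UNIV :: nat set)" "(\<Sum>l=1..n. f l) = 1"
  shows "\<exists>l\<in>{1..n}. f = unit_fun n l"
proof -
  have "\<exists>l\<in>{1..n}. f l = 1 \<and> (\<forall>k\<in>{1..n}. k \<noteq> l \<longrightarrow> f k = 0)"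
    using assms(2) sum_eq_1_iff[of "{1..n}" f] by auto
  then obtain l where l: "l \<in> {1..n}" "f l = 1" "\<And>k. k \<in> {1..n} \<Longrightarrow> k \<noteq> l \<Longrightarrow> f k = 0" by blast
  then have "f = unit_fun n l"
    using assms(1) by (auto simp: unit_fun_def fun_eq_iff PiE_def extensional_def)
  then show ?thesis using l by blast
qed

lemma sum_eq_0_unit_fun:
  assumes "f \<in> {1..n} \<rightarrow>\<^sub>E (UNIV :: nat set)" "(\<Sum>l=1..n. f l) = 0"
  shows "f = unit_fun n 0"
  using assms by (auto simp: unit_fun_def fun_eq_iff PiE_def extensional_def)

lemma unit_fun_apply: "i \<in> {1..n} \<Longrightarrow> unit_fun n l i = (if i = l then 1 else 0)"
  by (simp add: unit_fun_def)

lemma sum_unit_fun: "(\<Sum>i=1..n. unit_fun n l i) = (if l \<in> {1..n} then 1 else 0)"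
proof -
  have "(\<Sum>i=1..n. unit_fun n l i) = (\<Sum>i=1..n. if i = l then 1 else 0)"
    by (intro sum.cong) (auto simp: unit_fun_apply)
  then show ?thesis by simp
qed

lemma unit_tuples_eq:
  "unit_tuples r p = (\<lambda>l. (unit_fun r l, unit_fun p 0)) ` {1..r} \<union> (\<lambda>l. (unit_fun r 0, unit_fun p l)) ` {1..p}"
proof (intro equalityI subsetI)
  fix x assume "x \<in> unit_tuples r p"
  then obtain "is" js where x: "x = (is, js)" "is \<in> {1..r} \<rightarrow>\<^sub>E UNIV" "js \<in> {1..p} \<rightarrow>\<^sub>E UNIV"
    "(\<Sum>l=1..r. is l) + (\<Sum>l=1..p. js l) = 1" by (auto simp: unit_tuples_def)
  then have "(\<Sum>l=1..r. is l) = 1 \<and> (\<Sum>l=1..p. js l) = 0 \<or> (\<Sum>l=1..r. is l) = 0 \<and> (\<Sum>l=1..p. js l) = 1"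
    by arith
  then show "x \<in> (\<lambda>l. (unit_fun r l, unit_fun p 0)) ` {1..r} \<union> (\<lambda>l. (unit_fun r 0, unit_fun p l)) ` {1..p}"
  proof (elim disjE conjE)
    assume "(\<Sum>l=1..r. is l) = 1" "(\<Sum>l=1..p. js l) = 0"
    then show ?thesis using sum_eq_1_unit_fun[OF x(2)] sum_eq_0_unit_fun[OF x(3)] x(1) by auto
  next
    assume "(\<Sum>l=1..r. is l) = 0" "(\<Sum>l=1..p. js l) = 1"
    then show ?thesis using sum_eq_0_unit_fun[OF x(2)] sum_eq_1_unit_fun[OF x(3)] x(1) by auto
  qed
next
  have ext: "unit_fun n l \<in> {1..n} \<rightarrow>\<^sub>E UNIV" for n l
    by (simp add: unit_fun_def)
  fix x assume "x \<in> (\<lambda>l. (unit_fun r l, unit_fun p 0)) ` {1..r} \<union> (\<lambda>l. (unit_fun r 0, unit_fun p l)) ` {1..p}"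
  then obtain k l where x: "x = (unit_fun r k, unit_fun p l)" "k \<in> {1..r} \<and> l = 0 \<or> k = 0 \<and> l \<in> {1..p}"
    by blast
  have "(\<Sum>i=1..r. unit_fun r k i) + (\<Sum>i=1..p. unit_fun p l i) = 1"
    unfolding sum_unit_fun using x(2) by auto
  then show "x \<in> unit_tuples r p"
    unfolding unit_tuples_def x(1) using ext by blast
qed

lemma sum_unit_tuples:
  fixes F :: "(nat \<Rightarrow> nat) \<Rightarrow> (nat \<Rightarrow> nat) \<Rightarrow> real"
  shows "(\<Sum>(is, js)\<in>unit_tuples r p. F is js)
    = (\<Sum>l=1..r. F (unit_fun r l) (unit_fun p 0)) + (\<Sum>l=1..p. F (unit_fun r 0) (unit_fun p l))"
proof -
  have inj: "l = k" if "unit_fun n l = unit_fun n k" "l \<in> {1..n}" for n l k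
  proof (rule ccontr)
    assume "l \<noteq> k"
    then show False
      using arg_cong[OF that(1), of "\<lambda>f. f l"] unfolding unit_fun_apply[OF that(2)] by simp
  qed
  have "unit_fun r l \<noteq> unit_fun r 0" if "l \<in> {1..r}" for l
    using inj[OF _ that, of 0] that by auto
  then have "(\<lambda>l. (unit_fun r l, unit_fun p 0)) ` {1..r} \<inter> (\<lambda>l. (unit_fun r 0, unit_fun p l)) ` {1..p} = {}"
    by blast
  moreover have "inj_on (\<lambda>l. (unit_fun r l, unit_fun p 0)) {1..r}" "inj_on (\<lambda>l. (unit_fun r 0, unit_fun p l)) {1..p}"
    by (intro inj_onI, elim Pair_inject, erule inj, assumption)+
  ultimately show ?thesis unfolding unit_tuples_eq
    by (simp add: sum.union_disjoint sum.reindex)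
qed

section \<open>The main theorem\<close>

lemma summable_central_harm_bounded:
  assumes "\<And>n. 0 \<le> v n \<and> v n \<le> harm (Suc n) ^ w / real (Suc n)"
  shows "summable (\<lambda>n. central (Suc n) * harm (Suc n) * v n)"
proof (rule summable_comparison_test'[OF summable_harm_power[of "Suc w"]])
  fix n
  have "central (Suc n) * harm (Suc n) * v n
      \<le> real (Suc n) powr (-1/2) * harm (Suc n) * (harm (Suc n) ^ w / real (Suc n))"
    using assms[of n] by (intro mult_mono central_le) (auto simp: harm_nonneg)
  also have "\<dots> = harm (Suc n) ^ Suc w * (real (Suc n) powr (-1/2) * real (Suc n) powr (-1))"
  proof -
    have "real (Suc n) powr (-1) = 1 / real (Suc n)"
      using powr_minus_divide[of "real (Suc n)" 1] by simp
    then show ?thesis by (simp only:) simp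
  qed
  also have "\<dots> = harm (Suc n) ^ Suc w * real (Suc n) powr (-3/2)"
  proof -
    have "real (Suc n) powr (-1/2) * real (Suc n) powr (-1) = real (Suc n) powr (-3/2)"
      unfolding powr_add[symmetric] by simp
    then show ?thesis by (simp only:)
  qed
  finally show "norm (central (Suc n) * harm (Suc n) * v n) \<le> harm (Suc n) ^ Suc w * real (Suc n) powr (-3/2)"
    using assms[of n] by (simp add: harm_nonneg)
qed

lemma zeta_B_star_eq:
  "zeta_B_star [j, 1] = (\<Sum>n. central (Suc n) * harm (Suc n) * (1 / real (Suc n) ^ j))"
proof -
  have "zeta_star n [1] = harm n" for n
    by (simp add: zeta_star_Cons zeta_star_Nil harm_def atLeastSucAtMost_greaterThanAtMost divide_inverse)
  moreover have "h / (a * b) * c = c / b * h * (1 / a)" for a b c h :: real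
    by (simp add: mult.commute)
  ultimately show ?thesis
    unfolding zeta_B_star.simps central_def by (simp only:)
qed

text \<open>Return from \<open>ennreal\<close> to the reals: once every term is known to be finite,
  the identity may be solved for the series.\<close>

lemma central_harm_difference_sum:
  assumes "convergent_index (rev ks)" "ks \<noteq> []"
  defines "X \<equiv> (\<Sum>k. ennreal (1 / real (Suc k)) * hurwitz ks (real k + 1/2))"
    and "Y \<equiv> (\<Sum>k. ennreal (1 / (real k + 1/2)) * hurwitz ks (real k))"
  assumes fin: "X < top" "Y < top"
    and sm: "summable (\<lambda>n. central (Suc n) * harm (Suc n) * alt_diff (Suc n) (\<lambda>i. hurwitz_real ks (real i)) 0)"
  shows "(\<Sum>n. central (Suc n) * harm (Suc n) * alt_diff (Suc n) (\<lambda>i. hurwitz_real ks (real i)) 0)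
      = (\<Sum>j<length ks. real (ks ! j) * hurwitz_real (ks[j := Suc (ks ! j)]) (-1/2))
        - 2 * ln 2 * hurwitz_real ks (-1/2) - (enn2real X - enn2real Y)"
proof -
  let ?a = "\<lambda>n. central (Suc n) * harm (Suc n) * alt_diff (Suc n) (\<lambda>i. hurwitz_real ks (real i)) 0"
  let ?D = "\<Sum>j<length ks. real (ks ! j) * hurwitz_real (ks[j := Suc (ks ! j)]) (-1/2)"
  note nn = hurwitz_identity(2)[OF assms(1,2)]
  have a_nn: "0 \<le> ?a n" for n
    using nn[of "Suc n"] by (intro mult_nonneg_nonneg) (auto simp: harm_nonneg simp del: alt_diff.simps)
  have "(\<Sum>n. ennreal (central (Suc n) * harm (Suc n)) * ennreal (alt_diff (Suc n) (\<lambda>i. hurwitz_real ks (real i)) 0)) = (\<Sum>n. ennreal (?a n))"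
    using nn by (simp only: ennreal_mult''[symmetric])
  also have "\<dots> = ennreal (\<Sum>n. ?a n)" using sm a_nn by (intro suminf_ennreal2) auto
  finally have eq: "ennreal (\<Sum>n. ?a n) + ennreal (2 * ln 2) * ennreal (hurwitz_real ks (-1/2)) + ennreal (enn2real X)
      = ennreal ?D + ennreal (enn2real Y)"
    using hurwitz_identity(1)[OF assms(1,2)]
    unfolding hurwitz_deriv_eq_ennreal[OF assms(1) order_refl] ennreal_hurwitz_real[OF assms(1) order_refl]
      X_def[symmetric] Y_def[symmetric] ennreal_enn2real[OF fin(1)] ennreal_enn2real[OF fin(2)]
    by (simp only:)
  have S: "0 \<le> (\<Sum>n. ?a n)" using sm a_nn by (intro suminf_nonneg) auto
  have D: "0 \<le> ?D" by (intro sum_nonneg) auto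
  have h: "ennreal (2 * ln 2) * ennreal (hurwitz_real ks (-1/2)) = ennreal (2 * ln 2 * hurwitz_real ks (-1/2))"
    by (simp add: ennreal_mult'')
  have cancel: "A + B + C = D + E"
    if "ennreal A + ennreal B + ennreal C = ennreal D + ennreal E"
      "0 \<le> A" "0 \<le> B" "0 \<le> C" "0 \<le> D" "0 \<le> E" for A B C D E
    using that by (simp add: ennreal_plus[symmetric] del: ennreal_plus)
  have "(\<Sum>n. ?a n) + 2 * ln 2 * hurwitz_real ks (-1/2) + enn2real X = ?D + enn2real Y"
    by (rule cancel[OF eq[unfolded h] S _ enn2real_nonneg D enn2real_nonneg]) simp
  then show ?thesis by linarith
qed

context
  fixes p r :: nat and m :: "nat \<Rightarrow> nat"
  assumes p: "p \<ge> 1" and m1: "m 1 \<ge> 1" and mp: "m p \<ge> 1"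
begin

definition "base_index = map (\<lambda>l. m l + 1) [1..<p + 1]"

text \<open>The number \<open>q\<close> of ones varies because the terms with
  \<open>zeta_B_star [j, 1]\<close> involve r - j of them.\<close>

definition "full_index q = replicate q 1 @ base_index"

lemma length_base_index: "length base_index = p"
  by (simp add: base_index_def)

lemma convergent_full_index: "convergent_index (rev (full_index q))"
  using p mp by (auto simp: convergent_index_def full_index_def base_index_def is_index_def)

lemma full_index_0: "full_index 0 = base_index"
  by (simp add: full_index_def)

lemma full_index_neq_Nil: "full_index q \<noteq> []"
  using p by (auto simp: full_index_def base_index_def)

lemma mzv_full_index:
  "mzv (down_list (\<lambda>l. m l + 1) p 1 @ replicate q 1) = hurwitz_real (full_index q) 0"
proof -
  have "down_list (\<lambda>l. m l + 1) p 1 @ replicate q 1 = rev (full_index q)"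
    by (simp add: full_index_def base_index_def down_list_def rev_map)
  then show ?thesis using mzv_eq_hurwitz_real[OF convergent_full_index[of q]] by simp
qed

lemma mzv_drop_base_index:
  "mzv (down_list (\<lambda>l. m l + 1) p (j + 1)) = hurwitz_real (drop j base_index) 0"
proof -
  have eq: "down_list (\<lambda>l. m l + 1) p (j + 1) = rev (drop j base_index)"
    by (simp add: base_index_def down_list_def rev_map drop_map drop_upt)
  have "convergent_index (rev (drop j base_index))"
  proof -
    have "\<forall>k\<in>set base_index. 0 < k" by (auto simp: base_index_def)
    moreover have "last base_index = m p + 1" using p by (simp add: base_index_def last_map)
    ultimately show ?thesis
      using mp by (auto simp: convergent_index_def is_index_def hd_rev last_drop dest: in_set_dropD)
  qed
  then show ?thesis unfolding eq using mzv_eq_hurwitz_real by fastforce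
qed

lemma zeta_star_m_index:
  assumes "1 \<le> j" "j \<le> p"
  shows "zeta_star n (hoffman_dual (m_index m j)) / real n = nested_avg (take j base_index) n"
proof -
  have "take j base_index = Suc (m 1) # map (\<lambda>i. m i + 1) [2..<j + 1]"
    using assms take_upt[of 1 j "p + 1"] upt_conv_Cons[of 1 "j + 1"]
    by (simp add: base_index_def take_map numeral_2_eq_2 del: upt_Suc)
  moreover have "is_index (m_index m j)" using m1 by (auto simp: m_index_def is_index_def)
  ultimately show ?thesis
    using nested_avg_hoffman_dual[of "m 1" "map (\<lambda>i. m i + 1) [2..<j + 1]" n]
    by (simp only: m_index_def)
qed

definition "diff_seq q n = alt_diff (Suc n) (\<lambda>i. hurwitz_real (full_index q) (real i)) 0"

text \<open>The pointwise identity \<open>key\<close> combines the expansion over prefixes with the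
  absorption of 1/n^r; it is then multiplied by c_n H_n and summed.\<close>

lemma lhs_eq:
  "(\<Sum>j=1..p. (-1) ^ (j - 1) * mzv (down_list (\<lambda>l. m l + 1) p (j + 1)) *
        (\<Sum>n. zeta_star (Suc n) (hoffman_dual (m_index m j)) * harm (Suc n) /
              (real (Suc n) ^ (r + 1) * 4 ^ Suc n) * real ((2 * Suc n) choose Suc n)))
   = (\<Sum>j=1..r. (-1) ^ (r - j) * mzv (down_list (\<lambda>l. m l + 1) p 1 @ replicate (r - j) 1) * zeta_B_star [j, 1])
     + (-1) ^ r * (\<Sum>n. central (Suc n) * harm (Suc n) * diff_seq r n)"
    (is "?L = ?R")
  and summable_diff_seq: "summable (\<lambda>n. central (Suc n) * harm (Suc n) * diff_seq r n)"
proof -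
  let ?c = "\<lambda>n. central (Suc n) * harm (Suc n)"
  let ?z = "\<lambda>j. (-1) ^ (j - 1) * hurwitz_real (drop j base_index) 0"
  let ?v = "\<lambda>j n. nested_avg (take j base_index) (Suc n) / real (Suc n) ^ r"
  let ?y = "\<lambda>j. (-1) ^ (r - j) * hurwitz_real (full_index (r - j)) 0"
  have summand: "zeta_star (Suc n) (hoffman_dual (m_index m j)) * harm (Suc n) /
              (real (Suc n) ^ (r + 1) * 4 ^ Suc n) * real ((2 * Suc n) choose Suc n) = ?c n * ?v j n"
    if "j \<in> {1..p}" for j n
    using zeta_star_m_index[of j "Suc n"] that
    by (simp add: central_def field_simps del: of_nat_Suc binomial_Suc_Suc mult_Suc_right)
  have sv: "summable (\<lambda>n. ?c n * ?v j n)" if "j \<in> {1..p}" for j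
  proof (rule summable_central_harm_bounded)
    fix n
    have "take j base_index \<noteq> []" using that length_base_index by auto
    then have b: "0 \<le> nested_avg (take j base_index) (Suc n)"
      "nested_avg (take j base_index) (Suc n) \<le> harm (Suc n) ^ sum_list (take j base_index) / real (Suc n)"
      using nested_avg_bounds[of "Suc n"] by auto
    have "?v j n \<le> nested_avg (take j base_index) (Suc n) / 1"
      using b(1) by (intro divide_left_mono) auto
    then show "0 \<le> ?v j n \<and> ?v j n \<le> harm (Suc n) ^ sum_list (take j base_index) / real (Suc n)"
      using b by auto
  qed
  have sy: "summable (\<lambda>n. ?c n * (1 / real (Suc n) ^ j))" if "1 \<le> j" for j
  proof (rule summable_central_harm_bounded[of _ 0])
    fix n
    have "real (Suc n) ^ 1 \<le> real (Suc n) ^ j" using that by (intro power_increasing) auto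
    then show "0 \<le> 1 / real (Suc n) ^ j \<and> 1 / real (Suc n) ^ j \<le> harm (Suc n) ^ 0 / real (Suc n)"
      by (simp add: field_simps del: of_nat_Suc)
  qed
  have key: "(\<Sum>j=1..p. ?z j * (?c n * ?v j n))
      = (\<Sum>j=1..r. ?y j * (?c n * (1 / real (Suc n) ^ j))) + (-1) ^ r * (?c n * diff_seq r n)" for n
  proof -
    have "(\<Sum>j=1..p. ?z j * ?v j n) = alt_diff (Suc n) (\<lambda>i. hurwitz_real base_index (real i)) 0 / real (Suc n) ^ r"
      using alt_diff_hurwitz_real[OF convergent_full_index[of 0], of "Suc n"]
      by (simp add: full_index_0 length_base_index sum_divide_distrib del: alt_diff.simps)
    also have "\<dots> = (\<Sum>j=1..r. ?y j * (1 / real (Suc n) ^ j)) + (-1) ^ r * diff_seq r n"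
      using alt_diff_hurwitz_real_replicate[OF convergent_full_index[of 0] full_index_neq_Nil zero_less_Suc,
          of n r, unfolded full_index_0, folded full_index_def]
      by (simp only: diff_seq_def times_divide_eq_right mult_1_right)
    finally have "?c n * (\<Sum>j=1..p. ?z j * ?v j n) = ?c n * ((\<Sum>j=1..r. ?y j * (1 / real (Suc n) ^ j)) + (-1) ^ r * diff_seq r n)"
      by simp
    then show ?thesis by (simp only: distrib_left sum_distrib_left mult.left_commute)
  qed
  have s1: "summable (\<lambda>n. \<Sum>j=1..p. ?z j * (?c n * ?v j n))"
    by (intro summable_sum summable_mult sv)
  have s2: "summable (\<lambda>n. \<Sum>j=1..r. ?y j * (?c n * (1 / real (Suc n) ^ j)))"
    by (intro summable_sum summable_mult sy) auto
  \<comment> \<open>No separate estimate of \<open>diff_seq\<close> is made: by \<open>key\<close>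
    it is the difference of two sequences whose weighted series converge.\<close>
  have s3: "summable (\<lambda>n. (-1) ^ r * (?c n * diff_seq r n))"
    using summable_diff[OF s1 s2] unfolding key by simp
  then show s4: "summable (\<lambda>n. ?c n * diff_seq r n)"
    by (subst (asm) summable_cmult_iff) auto
  have "?L = (\<Sum>j=1..p. ?z j * (\<Sum>n. ?c n * ?v j n))"
    by (intro sum.cong refl) (simp only: summand mzv_drop_base_index)
  also have "\<dots> = (\<Sum>j=1..p. \<Sum>n. ?z j * (?c n * ?v j n))"
    by (intro sum.cong refl suminf_mult[symmetric] sv)
  also have "\<dots> = (\<Sum>n. \<Sum>j=1..p. ?z j * (?c n * ?v j n))"
    by (rule suminf_sum[symmetric]) (intro summable_mult sv)
  also have "\<dots> = (\<Sum>n. \<Sum>j=1..r. ?y j * (?c n * (1 / real (Suc n) ^ j))) + (\<Sum>n. (-1) ^ r * (?c n * diff_seq r n))"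
    unfolding key by (rule suminf_add[OF s2 s3, symmetric])
  also have "(\<Sum>n. \<Sum>j=1..r. ?y j * (?c n * (1 / real (Suc n) ^ j))) = (\<Sum>j=1..r. ?y j * zeta_B_star [j, 1])"
  proof -
    have "(\<Sum>n. \<Sum>j=1..r. ?y j * (?c n * (1 / real (Suc n) ^ j))) = (\<Sum>j=1..r. \<Sum>n. ?y j * (?c n * (1 / real (Suc n) ^ j)))"
      by (rule suminf_sum) (intro summable_mult sy, simp)
    also have "\<dots> = (\<Sum>j=1..r. ?y j * zeta_B_star [j, 1])"
      unfolding zeta_B_star_eq by (intro sum.cong refl suminf_mult sy) simp
    finally show ?thesis .
  qed
  also have "(\<Sum>n. (-1) ^ r * (?c n * diff_seq r n)) = (-1) ^ r * (\<Sum>n. ?c n * diff_seq r n)"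
    by (rule suminf_mult[OF s4])
  also have "(\<Sum>j=1..r. ?y j * zeta_B_star [j, 1])
      = (\<Sum>j=1..r. (-1) ^ (r - j) * mzv (down_list (\<lambda>l. m l + 1) p 1 @ replicate (r - j) 1) * zeta_B_star [j, 1])"
    by (simp only: mzv_full_index)
  finally show "?L = ?R" .
qed

lemma sum_list_full_index: "sum_list (full_index r) = (\<Sum>l=1..p. m l) + (p + r)"
proof -
  have "sum_list base_index = (\<Sum>l=1..p. m l + 1)"
    unfolding base_index_def by (simp add: interv_sum_list_conv_sum_set_nat atLeastLessThanSuc_atLeastAtMost del: upt_Suc)
  also have "\<dots> = (\<Sum>l=1..p. m l) + (\<Sum>l=1..p. 1)" by (rule sum.distrib)
  also have "\<dots> = (\<Sum>l=1..p. m l) + p" by simp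
  finally show ?thesis by (simp add: full_index_def sum_list_replicate)
qed

lemma length_down_list: "length (down_list f b 1) = b"
  by (simp add: down_list_def)

definition "signed_sum is js = (\<Sum>\<sigma>\<in>signs (p + r). \<sigma> 1 *
   mpolylog (down_list (\<lambda>l. m l + js l + 1) p 1 @ down_list (\<lambda>l. is l + 1) r 1) (sign_args (p + r) \<sigma>))"

text \<open>The depth is p + r and the weight |m| + p + r + 1, so the powers of 2 from
  \<open>signed_mpolylog_eq\<close> cancel against the prefactor.\<close>

lemma signed_sum_unit:
  assumes upd: "map (\<lambda>l. is l + 1) [1..<r + 1] @ map (\<lambda>l. m l + js l + 1) [1..<p + 1] = (full_index r)[j := Suc (full_index r ! j)]"
    and j: "j < p + r"
  shows "2 ^ ((\<Sum>l=1..p. m l) + 1) * signed_sum is js = hurwitz_real ((full_index r)[j := Suc (full_index r ! j)]) (-1/2)"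
proof -
  let ?as = "down_list (\<lambda>l. m l + js l + 1) p 1 @ down_list (\<lambda>l. is l + 1) r 1"
  have len: "length (full_index r) = p + r" by (simp add: full_index_def length_base_index)
  have rev: "rev ?as = (full_index r)[j := Suc (full_index r ! j)]"
    using upd by (simp add: down_list_def rev_map del: upt_Suc)
  then have as: "?as = rev ((full_index r)[j := Suc (full_index r ! j)])" by (metis rev_rev_ident)
  have sum: "sum_list ?as = Suc (sum_list (full_index r))"
    unfolding as using j len by (simp add: sum_list_rev sum_list_update member_le_sum_list)
  have conv: "convergent_index ?as"
    unfolding as using j len by (intro convergent_index_update convergent_full_index) simp
  have "length ?as = p + r" by (simp add: length_down_list del: One_nat_def)
  from signed_mpolylog_eq[OF conv this] p
  have "signed_sum is js = 2 ^ (p + r) * (1/2) ^ Suc (sum_list (full_index r)) * hurwitz_real (rev ?as) (-1/2)"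
    unfolding signed_sum_def sum by simp
  then show ?thesis
    unfolding rev by (simp add: sum_list_full_index power_add power_one_over field_simps)
qed

text \<open>The single 1 at position l of \<open>is\<close> raises entry l - 1 of
  \<open>full_index r\<close>, which is 1; at position l of \<open>js\<close> it raises entry r + l
  - 1, which is m_l + 1. The result is -f'(-1/2).\<close>

lemma unit_tuples_sum:
  "2 ^ ((\<Sum>l=1..p. m l) + 1) * (\<Sum>(is, js)\<in>unit_tuples r p. (\<Prod>l=1..p. real ((m l + js l) choose js l)) * signed_sum is js)
    = (\<Sum>j<p + r. real (full_index r ! j) * hurwitz_real ((full_index r)[j := Suc (full_index r ! j)]) (-1/2))"
proof -
  let ?w = "2 ^ ((\<Sum>l=1..p. m l) + 1) :: real"
  let ?h = "\<lambda>j. real (full_index r ! j) * hurwitz_real ((full_index r)[j := Suc (full_index r ! j)]) (-1/2)"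
  let ?F = "\<lambda>is js. (\<Prod>l=1..p. real ((m l + js l) choose js l)) * signed_sum is js"
  have 1: "?w * ?F (unit_fun r l) (unit_fun p 0) = ?h (l - 1)" if l: "l \<in> {1..r}" for l
  proof -
    have "?w * signed_sum (unit_fun r l) (unit_fun p 0) = hurwitz_real ((full_index r)[l - 1 := Suc (full_index r ! (l - 1))]) (-1/2)"
    proof (rule signed_sum_unit)
      show "map (\<lambda>i. unit_fun r l i + 1) [1..<r + 1] @ map (\<lambda>l. m l + unit_fun p 0 l + 1) [1..<p + 1]
        = (full_index r)[l - 1 := Suc (full_index r ! (l - 1))]"
        using l by (intro nth_equalityI)
          (auto simp: full_index_def base_index_def nth_append nth_list_update unit_fun_apply simp del: upt_Suc)
    qed (use l in auto)
    moreover have "(\<Prod>l=1..p. real ((m l + unit_fun p 0 l) choose unit_fun p 0 l)) = 1"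
      by (intro prod.neutral) (auto simp: unit_fun_apply)
    moreover have "full_index r ! (l - 1) = 1" using l by (auto simp: full_index_def nth_append)
    ultimately show ?thesis by simp
  qed
  have 2: "?w * ?F (unit_fun r 0) (unit_fun p l) = ?h (r + l - 1)" if l: "l \<in> {1..p}" for l
  proof -
    have "?w * signed_sum (unit_fun r 0) (unit_fun p l) = hurwitz_real ((full_index r)[r + l - 1 := Suc (full_index r ! (r + l - 1))]) (-1/2)"
    proof (rule signed_sum_unit)
      show "map (\<lambda>i. unit_fun r 0 i + 1) [1..<r + 1] @ map (\<lambda>i. m i + unit_fun p l i + 1) [1..<p + 1]
        = (full_index r)[r + l - 1 := Suc (full_index r ! (r + l - 1))]"
        using l by (intro nth_equalityI)
          (auto simp: full_index_def base_index_def nth_append nth_list_update unit_fun_apply simp del: upt_Suc)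
    qed (use l in auto)
    moreover have "(\<Prod>i=1..p. real ((m i + unit_fun p l i) choose unit_fun p l i)) = real (m l + 1)"
    proof -
      have "(\<Prod>i=1..p. real ((m i + unit_fun p l i) choose unit_fun p l i)) = (\<Prod>i=1..p. if i = l then real (m l + 1) else 1)"
        by (intro prod.cong) (auto simp: unit_fun_apply)
      then show ?thesis using l by simp
    qed
    moreover have "full_index r ! (r + l - 1) = m l + 1"
      using l by (auto simp: full_index_def base_index_def nth_append simp del: upt_Suc)
    ultimately show ?thesis by (simp add: mult.left_commute)
  qed
  have "?w * (\<Sum>(is, js)\<in>unit_tuples r p. ?F is js) = (\<Sum>l=1..r. ?h (l - 1)) + (\<Sum>l=1..p. ?h (r + l - 1))"
    unfolding sum_unit_tuples distrib_left sum_distrib_left by (intro arg_cong2[of _ _ _ _ "(+)"] sum.cong refl 1 2)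
  also have "(\<Sum>l=1..r. ?h (l - 1)) = (\<Sum>j\<in>{0..<r}. ?h j)"
    by (rule sum.reindex_bij_witness[of _ Suc "\<lambda>l. l - 1"]) auto
  also have "(\<Sum>l=1..p. ?h (r + l - 1)) = (\<Sum>j\<in>{r..<p + r}. ?h j)"
    by (rule sum.reindex_bij_witness[of _ "\<lambda>j. Suc j - r" "\<lambda>l. r + l - 1"]) auto
  also have "(\<Sum>j\<in>{0..<r}. ?h j) + (\<Sum>j\<in>{r..<p + r}. ?h j) = (\<Sum>j<p + r. ?h j)"
    by (subst sum.atLeastLessThan_concat) (auto simp: lessThan_atLeast0)
  finally show ?thesis .
qed

lemma diff_seq_sum:
  "(\<Sum>n. central (Suc n) * harm (Suc n) * diff_seq r n)
    = 2 ^ ((\<Sum>l=1..p. m l) + 1) * (\<Sum>(is, js)\<in>unit_tuples r p. (\<Prod>l=1..p. real ((m l + js l) choose js l)) * signed_sum is js)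
      - 2 ^ ((\<Sum>l=1..p. m l) + 1) * ln 2 * (\<Sum>\<sigma>\<in>signs (p + r). \<sigma> 1 * mpolylog (rev (full_index r)) (sign_args (p + r) \<sigma>))
      - 2 ^ ((\<Sum>l=1..p. m l) + 1) * (\<Sum>\<sigma>\<in>signs (p + r). \<sigma> 1 * mpolylog (rev (full_index r) @ [1]) (sign_args (p + r) \<sigma> @ [- \<sigma> 1]))"
proof -
  let ?ks = "full_index r"
  have len: "length ?ks = p + r" "length (rev ?ks) = p + r" by (simp_all add: full_index_def length_base_index)
  have d: "p + r \<ge> 1" using p by simp
  note e1 = signed_mpolylog_eq[OF convergent_full_index len(2) d]
  note e2 = signed_mpolylog_snoc_eq[OF convergent_full_index len(2) d]
  \<comment> \<open>The balance of the powers of 2 for weight |m| + p + r + 1, as in the term with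
    the extra argument.\<close>
  have w: "2 ^ ((\<Sum>l=1..p. m l) + 1) * (2 ^ (p + r) * (1/2) ^ Suc (sum_list (rev ?ks))) = (1 :: real)"
    by (simp add: sum_list_rev sum_list_full_index power_add power_one_over field_simps)
  define D where "D = (\<Sum>j<p + r. real (?ks ! j) * hurwitz_real (?ks[j := Suc (?ks ! j)]) (-1/2))"
  define X where "X = enn2real (\<Sum>k. ennreal (1 / real (Suc k)) * hurwitz ?ks (real k + 1/2))"
  define Y where "Y = enn2real (\<Sum>k. ennreal (1 / (real k + 1/2)) * hurwitz ?ks (real k))"
  have S: "(\<Sum>n. central (Suc n) * harm (Suc n) * diff_seq r n) = D - 2 * ln 2 * hurwitz_real ?ks (-1/2) - (X - Y)"
    using central_harm_difference_sum[OF convergent_full_index full_index_neq_Nil e2(2,3)[unfolded rev_rev_ident]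
        summable_diff_seq[unfolded diff_seq_def]]
    unfolding diff_seq_def D_def X_def Y_def len .
  \<comment> \<open>The same balance for weight |m| + p + r; its value 2 gives 2 ln 2 in front of
    f(-1/2).\<close>
  define v where "v = 2 ^ ((\<Sum>l=1..p. m l) + 1) * (2 ^ (p + r) * (1/2 :: real) ^ sum_list (rev ?ks))"
  have v: "v = 2" using w by (simp add: v_def field_simps)
  have "2 ^ ((\<Sum>l=1..p. m l) + 1) * ln 2 * (2 ^ (p + r) * (1/2) ^ sum_list (rev ?ks) * hurwitz_real ?ks (-1/2))
      = v * ln 2 * hurwitz_real ?ks (-1/2)" by (simp add: v_def)
  then have A: "2 ^ ((\<Sum>l=1..p. m l) + 1) * ln 2 * (2 ^ (p + r) * (1/2) ^ sum_list (rev ?ks) * hurwitz_real ?ks (-1/2))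
      = 2 * ln 2 * hurwitz_real ?ks (-1/2)" unfolding v .
  have "2 ^ ((\<Sum>l=1..p. m l) + 1) * (2 ^ (p + r) * (1/2) ^ Suc (sum_list (rev ?ks)) * (X - Y))
      = 2 ^ ((\<Sum>l=1..p. m l) + 1) * (2 ^ (p + r) * (1/2) ^ Suc (sum_list (rev ?ks))) * (X - Y)"
    by (simp only: mult.assoc)
  then have B: "2 ^ ((\<Sum>l=1..p. m l) + 1) * (2 ^ (p + r) * (1/2) ^ Suc (sum_list (rev ?ks)) * (X - Y)) = X - Y"
    unfolding w by simp
  show ?thesis
    unfolding unit_tuples_sum e1 e2(1) rev_rev_ident X_def[symmetric] Y_def[symmetric] D_def[symmetric] S A B ..
qed

end

theorem theorem4p4:
  fixes p r :: nat and m :: "nat \<Rightarrow> nat"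
  assumes "p \<ge> 1" and "m 1 \<ge> 1" and "m p \<ge> 1"
  shows
    "(\<Sum>j=1..p. (-1) ^ (j - 1) * mzv (down_list (\<lambda>l. m l + 1) p (j + 1)) *
        (\<Sum>n. zeta_star (Suc n) (hoffman_dual (m_index m j)) * harm (Suc n) /
              (real (Suc n) ^ (r + 1) * 4 ^ Suc n) * real ((2 * Suc n) choose Suc n)))
     = (\<Sum>j=1..r. (-1) ^ (r - j) *
          mzv (down_list (\<lambda>l. m l + 1) p 1 @ replicate (r - j) 1) * zeta_B_star [j, 1])
       + (-1) ^ r * 2 ^ ((\<Sum>l=1..p. m l) + 1) *
         (\<Sum>(is, js)\<in>unit_tuples r p. (\<Prod>l=1..p. real ((m l + js l) choose js l)) *
            (\<Sum>\<sigma>\<in>signs (p + r). \<sigma> 1 *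
               mpolylog (down_list (\<lambda>l. m l + js l + 1) p 1 @ down_list (\<lambda>l. is l + 1) r 1)
                 (sign_args (p + r) \<sigma>)))
       - (-1) ^ r * 2 ^ ((\<Sum>l=1..p. m l) + 1) * ln 2 *
         (\<Sum>\<sigma>\<in>signs (p + r). \<sigma> 1 *
            mpolylog (down_list (\<lambda>l. m l + 1) p 1 @ replicate r 1) (sign_args (p + r) \<sigma>))
       - (-1) ^ r * 2 ^ ((\<Sum>l=1..p. m l) + 1) *
         (\<Sum>\<sigma>\<in>signs (p + r). \<sigma> 1 *
            mpolylog (down_list (\<lambda>l. m l + 1) p 1 @ replicate (r + 1) 1)
              (sign_args (p + r) \<sigma> @ [- \<sigma> 1]))"
proof -
  have 1: "down_list (\<lambda>l. m l + 1) p 1 @ replicate r 1 = rev (full_index p m r)"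
    by (simp add: full_index_def[OF assms] base_index_def[OF assms] down_list_def rev_map)
  have 2: "down_list (\<lambda>l. m l + 1) p 1 @ replicate (r + 1) 1 = rev (full_index p m r) @ [1]"
    unfolding 1[symmetric] by (simp add: replicate_append_same)
  have 3: "a + e * (k * u - k * l * v - k * w) = a + e * k * u - e * k * l * v - e * k * w"
    for a e k l u v w :: real
    by (simp add: algebra_simps)
  show ?thesis
    unfolding lhs_eq[OF assms] diff_seq_sum[OF assms] signed_sum_def[OF assms] 1 2 3 ..
qed

end
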